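(* Let $p\neq2,3$ be a prime, $q$ a power of $p$, and $G=\mathbf{SL}(2,\mathbb{F}_q)$. Let $g$ be either $c_5=\begin{pmatrix}-1&1\\0&-1\end{pmatrix}$ or $c_6=\begin{pmatrix}-1&x\\0&-1\end{pmatrix}$, where $x\in\mathbb{F}_q^\times$ is not a square in $\mathbb{F}_q$. The centralizer of $g$ in $G$ is $\mathcal{Z}_g=\left\{\pm\begin{pmatrix}1&t\\0&1\end{pmatrix}: t\in\mathbb{F}_q\right\}\simeq\mathbb{Z}_2\times\mathbb{F}_q$, where $\mathbb{Z}_2=\{\pm I\}$ ($I$ the identity matrix) and $t\in\mathbb{F}_q$ corresponds to $\begin{pmatrix}1&t\\0&1\end{pmatrix}$. Let $\chi$ be a character of $\mathcal{Z}_g$ with values in $k^\times$. If $\dim\mathfrak{B}(V(g,\chi))<\infty$, then $\chi=\mathrm{sgn}\times\varepsilon$, where $\mathrm{sgn}$ is the non-trivial representation of $\mathbb{Z}_2$ and $\varepsilon$ is the trivial representation of $\mathbb{F}_q$.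
   Context: $k$ is an algebraically closed field of characteristic $0$. For a finite group $G$, a Yetter-Drinfeld module over $kG$ is a $G$-graded $k$-vector space $V=\bigoplus_{h\in G}V_h$ with a linear $G$-action such that $g\cdot V_h\subseteq V_{ghg^{-1}}$. It is a braided vector space with braiding $c(v\otimes w)=h\cdot w\otimes v$ for $v\in V_h$, $w\in V$. For $g\in G$, $\mathcal{Z}_g$ is the centralizer of $g$ in $G$. For a character $\chi$ of $\mathcal{Z}_g$, $V(g,\chi)=\mathrm{Ind}_{\mathcal{Z}_g}^G\chi=kG\otimes_{k\mathcal{Z}_g}k_\chi$, graded so that $h\otimes w$ has degree $hgh^{-1}$. The Nichols algebra of a braided vector space $(V,c)$ is $\mathfrak{B}(V)=T(V)/\bigoplus_{n\ge2}\ker(\mathfrak{S}_n)$, where $\mathfrak{S}_n=\sum_{\sigma\in\mathbb{S}_n}c_\sigma$ acts on $V^{\otimes n}$ and $c_\sigma$ is obtained from a reduced expression of $\sigma$ by replacing each transposition $(i\ i{+}1)$ with $c$ acting on the factors $i,i+1$. *)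

theory Defs
  imports
    "HOL-Analysis.Determinants"
    "HOL-Algebra.Algebra"
    "HOL-Algebra.Algebraic_Closure_Type"
    "HOL-Combinatorics.Permutations"
begin

section \<open>Linear algebra over a field given by a type class\<close>

text \<open>
  A vector space over \<open>'k\<close> is a record of type \<open>('k, 'v) module\<close>, understood as a module over
  \<open>ring_of_type_algebra :: 'k ring\<close>. The fields \<open>mult\<close> and \<open>one\<close> of such a record carry the
  product when the space is an algebra and are meaningless otherwise.
\<close>

definition lin_span :: "('k::field, 'v, 'm) module_scheme \<Rightarrow> 'v set \<Rightarrow> 'v set" where
  "lin_span M S = \<Inter>{N. submodule N (ring_of_type_algebra :: 'k ring) M \<and> S \<subseteq> N}"

definition fin_dim :: "('k::field, 'v, 'm) module_scheme \<Rightarrow> bool" where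
  "fin_dim M \<longleftrightarrow> (\<exists>B. finite B \<and> B \<subseteq> carrier M \<and> lin_span M B = carrier M)"

text \<open>The quotient by a subspace, or by a two-sided ideal if \<open>M\<close> is an algebra (this is
  \<^const>\<open>FactRing\<close> with a scalar multiplication). Its elements are the cosets.\<close>

definition quot_module :: "('k, 'v, 'm) module_scheme \<Rightarrow> 'v set \<Rightarrow> ('k, 'v set) module" where
  "quot_module M N =
     \<lparr>carrier = a_rcosets\<^bsub>M\<^esub> N,
      mult = rcoset_mult M N,
      one = N +>\<^bsub>M\<^esub> \<one>\<^bsub>M\<^esub>,
      ring.zero = N,
      add = set_add M,
      module.smult = (\<lambda>a C. \<Union>x\<in>C. N +>\<^bsub>M\<^esub> (a \<odot>\<^bsub>M\<^esub> x))\<rparr>"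

definition free_module :: "'s set \<Rightarrow> ('k::field, 's \<Rightarrow> 'k) module" where
  "free_module S =
     \<lparr>carrier = {f. finite {x. f x \<noteq> 0} \<and> {x. f x \<noteq> 0} \<subseteq> S},
      mult = undefined,
      one = undefined,
      ring.zero = (\<lambda>x. 0),
      add = (\<lambda>f h x. f x + h x),
      module.smult = (\<lambda>a f x. a * f x)\<rparr>"

definition single :: "'s \<Rightarrow> 's \<Rightarrow> 'k::field" where
  "single s = (\<lambda>x. if x = s then 1 else 0)"

text \<open>The linear map between free modules with \<open>single x \<mapsto> single (\<phi> x)\<close>.\<close>

definition free_map :: "('s \<Rightarrow> 't) \<Rightarrow> ('s \<Rightarrow> 'k::field) \<Rightarrow> 't \<Rightarrow> 'k" where
  "free_map \<phi> f = (\<lambda>y. \<Sum>x | f x \<noteq> 0 \<and> \<phi> x = y. f x)"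


section \<open>Yetter-Drinfeld modules and the modules \<open>V(g, chi)\<close>\<close>

record ('g, 'k, 'v) yd_module = "('k, 'v) module" +
  act :: "'g \<Rightarrow> 'v \<Rightarrow> 'v"
  deg :: "'g \<Rightarrow> 'v set"

definition centralizer :: "('g, 'm) monoid_scheme \<Rightarrow> 'g \<Rightarrow> 'g set" where
  "centralizer G g = {x \<in> carrier G. x \<otimes>\<^bsub>G\<^esub> g = g \<otimes>\<^bsub>G\<^esub> x}"

text \<open>
  The tensor product \<open>kG \<otimes> k_chi\<close> over \<open>kH\<close>, where the group algebra \<open>kG\<close> is the free module on
  \<open>carrier G\<close> and \<open>k_chi\<close> is \<open>k\<close> with \<open>z \<in> H\<close> acting by \<open>chi z\<close>: the free vector space on
  \<open>kG \<times> k\<close> modulo bilinearity and \<open>a z \<otimes> w = a \<otimes> chi(z) w\<close>. By bilinearity it suffices to impose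
  the last relation for \<open>z \<in> H\<close>.
\<close>

definition tensor_gens :: "('g, 'm) monoid_scheme \<Rightarrow> ('k::field, ('g \<Rightarrow> 'k) \<times> 'k \<Rightarrow> 'k) module" where
  "tensor_gens G = free_module (carrier (free_module (carrier G)) \<times> UNIV)"

definition tensor_rels ::
    "('g, 'm) monoid_scheme \<Rightarrow> 'g set \<Rightarrow> ('g \<Rightarrow> 'k::field) \<Rightarrow> (('g \<Rightarrow> 'k) \<times> 'k \<Rightarrow> 'k) set" where
  "tensor_rels G H chi =
     (let A = free_module (carrier G); F = tensor_gens G in
      lin_span F
       ({single (a \<oplus>\<^bsub>A\<^esub> b, w) \<ominus>\<^bsub>F\<^esub> (single (a, w) \<oplus>\<^bsub>F\<^esub> single (b, w)) | a b w.
           a \<in> carrier A \<and> b \<in> carrier A} \<union>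
        {single (a, v + w) \<ominus>\<^bsub>F\<^esub> (single (a, v) \<oplus>\<^bsub>F\<^esub> single (a, w)) | a v w. a \<in> carrier A} \<union>
        {single (r \<odot>\<^bsub>A\<^esub> a, w) \<ominus>\<^bsub>F\<^esub> r \<odot>\<^bsub>F\<^esub> single (a, w) | r a w. a \<in> carrier A} \<union>
        {single (a, r * w) \<ominus>\<^bsub>F\<^esub> r \<odot>\<^bsub>F\<^esub> single (a, w) | r a w. a \<in> carrier A} \<union>
        {single (free_map (\<lambda>y. y \<otimes>\<^bsub>G\<^esub> z) a, w) \<ominus>\<^bsub>F\<^esub> single (a, chi z * w) | a z w.
           a \<in> carrier A \<and> z \<in> H}))"

definition induced_module ::
    "('g, 'm) monoid_scheme \<Rightarrow> 'g set \<Rightarrow> ('g \<Rightarrow> 'k::field) \<Rightarrow>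
     ('k, (('g \<Rightarrow> 'k) \<times> 'k \<Rightarrow> 'k) set) module" where
  "induced_module G H chi = quot_module (tensor_gens G) (tensor_rels G H chi)"

definition induced_tensor ::
    "('g, 'm) monoid_scheme \<Rightarrow> 'g set \<Rightarrow> ('g \<Rightarrow> 'k::field) \<Rightarrow> ('g \<Rightarrow> 'k) \<Rightarrow> 'k \<Rightarrow>
     (('g \<Rightarrow> 'k) \<times> 'k \<Rightarrow> 'k) set" where
  "induced_tensor G H chi a w = tensor_rels G H chi +>\<^bsub>tensor_gens G\<^esub> single (a, w)"

text \<open>\<open>x \<cdot> (a \<otimes> w) = (x a) \<otimes> w\<close>, extended linearly to cosets.\<close>

definition induced_act ::
    "('g, 'm) monoid_scheme \<Rightarrow> 'g set \<Rightarrow> ('g \<Rightarrow> 'k::field) \<Rightarrow> 'g \<Rightarrow>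
     (('g \<Rightarrow> 'k) \<times> 'k \<Rightarrow> 'k) set \<Rightarrow> (('g \<Rightarrow> 'k) \<times> 'k \<Rightarrow> 'k) set" where
  "induced_act G H chi x C =
     (\<Union>f\<in>C. tensor_rels G H chi +>\<^bsub>tensor_gens G\<^esub>
        free_map (\<lambda>(a, w). (free_map (\<lambda>y. x \<otimes>\<^bsub>G\<^esub> y) a, w)) f)"

definition yd_V ::
    "('g, 'm) monoid_scheme \<Rightarrow> 'g \<Rightarrow> ('g \<Rightarrow> 'k::field) \<Rightarrow>
     ('g, 'k, (('g \<Rightarrow> 'k) \<times> 'k \<Rightarrow> 'k) set) yd_module" where
  "yd_V G g chi =
     (let H = centralizer G g; M = induced_module G H chi in
      \<lparr>carrier = carrier M, mult = mult M, one = one M, ring.zero = \<zero>\<^bsub>M\<^esub>, add = add M,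
       module.smult = module.smult M,
       act = induced_act G H chi,
       deg = (\<lambda>t. lin_span M {induced_tensor G H chi (single h) w | h w.
                 h \<in> carrier G \<and> h \<otimes>\<^bsub>G\<^esub> g \<otimes>\<^bsub>G\<^esub> inv\<^bsub>G\<^esub> h = t})\<rparr>)"


section \<open>The tensor algebra\<close>

definition free_alg :: "'s set \<Rightarrow> ('k::field, 's list \<Rightarrow> 'k) module" where
  "free_alg S =
     (free_module (lists S))
       \<lparr>mult := (\<lambda>f h l. \<Sum>i\<le>length l. f (take i l) * h (drop i l)),
        one := single []\<rparr>"

definition tensor_alg_ideal :: "('k::field, 'v, 'm) module_scheme \<Rightarrow> ('v list \<Rightarrow> 'k) set" where
  "tensor_alg_ideal V =
     (let F = free_alg (carrier V) in
      Idl\<^bsub>F\<^esub>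
       ({single [v \<oplus>\<^bsub>V\<^esub> w] \<ominus>\<^bsub>F\<^esub> (single [v] \<oplus>\<^bsub>F\<^esub> single [w]) | v w.
           v \<in> carrier V \<and> w \<in> carrier V} \<union>
        {single [r \<odot>\<^bsub>V\<^esub> v] \<ominus>\<^bsub>F\<^esub> r \<odot>\<^bsub>F\<^esub> single [v] | r v. v \<in> carrier V}))"

definition tensor_alg :: "('k::field, 'v, 'm) module_scheme \<Rightarrow> ('k, ('v list \<Rightarrow> 'k) set) module" where
  "tensor_alg V = quot_module (free_alg (carrier V)) (tensor_alg_ideal V)"

definition pure_tensor :: "('k::field, 'v, 'm) module_scheme \<Rightarrow> 'v list \<Rightarrow> ('v list \<Rightarrow> 'k) set" where
  "pure_tensor V vs = tensor_alg_ideal V +>\<^bsub>free_alg (carrier V)\<^esub> single vs"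

definition tensor_power :: "('k::field, 'v, 'm) module_scheme \<Rightarrow> nat \<Rightarrow> ('v list \<Rightarrow> 'k) set set" where
  "tensor_power V n = lin_span (tensor_alg V) (pure_tensor V ` {vs \<in> lists (carrier V). length vs = n})"

text \<open>
  If \<open>F\<close> is multilinear on lists of each fixed length, \<open>tensor_lift V F\<close> is the linear map on
  \<open>T(V)\<close> with \<open>v\<^sub>1 \<otimes> \<dots> \<otimes> v\<^sub>n \<mapsto> F [v\<^sub>1, \<dots>, v\<^sub>n]\<close>: all representatives of a coset then
  have the same value, which is what \<^const>\<open>the_elem\<close> selects.
\<close>

definition tensor_lift ::
    "('k::field, 'v, 'm) module_scheme \<Rightarrow> ('v list \<Rightarrow> ('v list \<Rightarrow> 'k) set) \<Rightarrow>
     ('v list \<Rightarrow> 'k) set \<Rightarrow> ('v list \<Rightarrow> 'k) set" where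
  "tensor_lift V F C =
     the_elem ((\<lambda>f. \<Oplus>\<^bsub>tensor_alg V\<^esub>l\<in>{l. f l \<noteq> 0}. f l \<odot>\<^bsub>tensor_alg V\<^esub> F l) ` C)"


section \<open>Nichols algebras\<close>

text \<open>
  A braiding is a map \<open>c\<close> on \<open>tensor_power V 2\<close>. \<open>braid_at V c i\<close> applies \<open>c\<close> to the tensor
  factors with positions \<open>i\<close> and \<open>i + 1\<close>, counted from \<open>0\<close>; tensors that are too short are sent
  to \<open>0\<close>, which is irrelevant below.
\<close>

definition braid_at ::
    "('k::field, 'v, 'm) module_scheme \<Rightarrow> (('v list \<Rightarrow> 'k) set \<Rightarrow> ('v list \<Rightarrow> 'k) set) \<Rightarrow> nat \<Rightarrow>
     ('v list \<Rightarrow> 'k) set \<Rightarrow> ('v list \<Rightarrow> 'k) set" where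
  "braid_at V c i =
     tensor_lift V (\<lambda>l.
       if Suc i < length l
       then pure_tensor V (take i l) \<otimes>\<^bsub>tensor_alg V\<^esub> c (pure_tensor V [l ! i, l ! Suc i])
              \<otimes>\<^bsub>tensor_alg V\<^esub> pure_tensor V (drop (i + 2) l)
       else \<zero>\<^bsub>tensor_alg V\<^esub>)"

definition transp_word :: "nat \<Rightarrow> (nat \<Rightarrow> nat) \<Rightarrow> nat list \<Rightarrow> bool" where
  "transp_word n \<sigma> is \<longleftrightarrow>
     set is \<subseteq> {i. Suc i < n} \<and> \<sigma> = foldr (\<lambda>i \<tau>. Transposition.transpose i (Suc i) \<circ> \<tau>) is id"

definition reduced_expr :: "nat \<Rightarrow> (nat \<Rightarrow> nat) \<Rightarrow> nat list \<Rightarrow> bool" where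
  "reduced_expr n \<sigma> is \<longleftrightarrow>
     transp_word n \<sigma> is \<and> (\<forall>js. transp_word n \<sigma> js \<longrightarrow> length is \<le> length js)"

text \<open>The choice of the reduced expression does not matter if \<open>c\<close> satisfies the braid equation.\<close>

definition braid_perm ::
    "('k::field, 'v, 'm) module_scheme \<Rightarrow> (('v list \<Rightarrow> 'k) set \<Rightarrow> ('v list \<Rightarrow> 'k) set) \<Rightarrow> nat \<Rightarrow>
     (nat \<Rightarrow> nat) \<Rightarrow> ('v list \<Rightarrow> 'k) set \<Rightarrow> ('v list \<Rightarrow> 'k) set" where
  "braid_perm V c n \<sigma> = foldr (\<lambda>i \<tau>. braid_at V c i \<circ> \<tau>) (SOME is. reduced_expr n \<sigma> is) id"

definition quantum_symmetrizer ::
    "('k::field, 'v, 'm) module_scheme \<Rightarrow> (('v list \<Rightarrow> 'k) set \<Rightarrow> ('v list \<Rightarrow> 'k) set) \<Rightarrow> nat \<Rightarrow>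
     ('v list \<Rightarrow> 'k) set \<Rightarrow> ('v list \<Rightarrow> 'k) set" where
  "quantum_symmetrizer V c n C =
     (\<Oplus>\<^bsub>tensor_alg V\<^esub>\<sigma>\<in>{\<sigma>. \<sigma> permutes {..<n}}. braid_perm V c n \<sigma> C)"

definition nichols_ideal ::
    "('k::field, 'v, 'm) module_scheme \<Rightarrow> (('v list \<Rightarrow> 'k) set \<Rightarrow> ('v list \<Rightarrow> 'k) set) \<Rightarrow>
     ('v list \<Rightarrow> 'k) set set" where
  "nichols_ideal V c =
     lin_span (tensor_alg V)
       (\<Union>n\<in>{2..}. {C \<in> tensor_power V n. quantum_symmetrizer V c n C = \<zero>\<^bsub>tensor_alg V\<^esub>})"

definition nichols_algebra ::
    "('k::field, 'v, 'm) module_scheme \<Rightarrow> (('v list \<Rightarrow> 'k) set \<Rightarrow> ('v list \<Rightarrow> 'k) set) \<Rightarrow>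
     ('k, ('v list \<Rightarrow> 'k) set set) module" where
  "nichols_algebra V c = quot_module (tensor_alg V) (nichols_ideal V c)"

text \<open>The component of \<open>v\<close> of degree \<open>h\<close>, for a finite group \<open>G\<close>; it is unique for
  \<open>h \<in> carrier G\<close> because \<open>V\<close> is the direct sum of the \<open>deg V h\<close>.\<close>

definition homog_component ::
    "('g, 'n) monoid_scheme \<Rightarrow> ('g, 'k, 'v, 'm) yd_module_scheme \<Rightarrow> 'g \<Rightarrow> 'v \<Rightarrow> 'v" where
  "homog_component G V h v =
     (SOME u. (\<forall>t\<in>carrier G. u t \<in> deg V t) \<and> v = (\<Oplus>\<^bsub>V\<^esub>t\<in>carrier G. u t)) h"

text \<open>\<open>c (v \<otimes> w) = h \<cdot> w \<otimes> v\<close> for \<open>v\<close> of degree \<open>h\<close>, hence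
  \<open>c (v \<otimes> w) = \<Sum>h. h \<cdot> w \<otimes> v\<^sub>h\<close> for arbitrary \<open>v\<close>.\<close>

definition yd_braiding ::
    "('g, 'n) monoid_scheme \<Rightarrow> ('g, 'k::field, 'v, 'm) yd_module_scheme \<Rightarrow>
     ('v list \<Rightarrow> 'k) set \<Rightarrow> ('v list \<Rightarrow> 'k) set" where
  "yd_braiding G V =
     tensor_lift V (\<lambda>l. case l of
         [v, w] \<Rightarrow> (\<Oplus>\<^bsub>tensor_alg V\<^esub>h\<in>carrier G. pure_tensor V [act V h w, homog_component G V h v])
       | _ \<Rightarrow> \<zero>\<^bsub>tensor_alg V\<^esub>)"

definition yd_nichols ::
    "('g, 'n) monoid_scheme \<Rightarrow> ('g, 'k::field, 'v, 'm) yd_module_scheme \<Rightarrow>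
     ('k, ('v list \<Rightarrow> 'k) set set) module" where
  "yd_nichols G V = nichols_algebra V (yd_braiding G V)"


section \<open>The group \<open>SL(2, F)\<close>\<close>

definition SL2 :: "('f::field^2^2) monoid" where
  "SL2 = \<lparr>carrier = {A. det A = 1}, mult = (**), one = mat 1\<rparr>"

definition mat22 :: "'f \<Rightarrow> 'f \<Rightarrow> 'f \<Rightarrow> 'f \<Rightarrow> ('f::field)^2^2" where
  "mat22 a b c d = vector [vector [a, b], vector [c, d]]"

definition upper_unip :: "'f::field \<Rightarrow> 'f^2^2" where
  "upper_unip t = mat22 1 t 0 1"

definition plus_minus_one :: "('f::field^2^2) set" where
  "plus_minus_one = {mat 1, - mat 1}"

text \<open>The non-trivial character of \<open>{I, -I}\<close>, and the trivial character of the additive group of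
  \<open>F\<close>.\<close>

definition sgn_char :: "'f::field^2^2 \<Rightarrow> 'k::field" where
  "sgn_char s = (if s = mat 1 then 1 else - 1)"

definition triv_char :: "'f::field \<Rightarrow> 'k::field" where
  "triv_char t = 1"

end

(*
  Let u(t) be the upper unitriangular matrix with entry t, so that g = -u(-x) for some x, and let
  r = a^2 be a non-zero square. The vectors x_r = diag(a, 1/a) (x) 1 of V(g, chi) span a braided
  subspace of diagonal type: c(x_r (x) x_s) = q(r, s) x_s (x) x_r with q(r, s) = eps psi(r / s),
  where eps = chi(-I) and psi(y) = chi(u(-x y)). If the Nichols algebra is finite-dimensional, then
  all products of sufficiently many letters x_r vanish.

  Let z be an iterated braided commutator [x_i1, [..., [x_in, x_r]]] with r different from all i_j,
  and let Q be the product of q(s, t) over all pairs of letters s, t of z. If z is non-zero and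
  Q = 1, then skew derivations map z^k to k times a non-zero multiple of z^(k - 1), so all powers of
  z are non-zero, which is a contradiction. Here Q = eps^(m^2) psi(S T), where m is the number of
  letters, S their sum and T the sum of their inverses, and z is non-zero if q(i, s) q(s, i) is not
  1 at each step, with s the innermost letter or the product of all letters so far. Unless eps = -1
  and psi is trivial, there are squares that satisfy these conditions: 1 and -1 (or 1, -1, rho,
  -rho) if -1 is a square, and otherwise the powers of 4, possibly with one more letter, or a few
  squares related to the prime field.
*)
theory Submission
  imports Defs "HOL-Combinatorics.Multiset_Permutations"
begin

section \<open>Quantum shuffles\<close>

text \<open>The Nichols algebra is studied through the image of the quantum symmetrizer in the
  quantum shuffle algebra. There elements are coefficient functions on words, products are operators
  on such functions, and a skew derivation strips the first or the last letter. Finite dimension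
  enters through functionals on the whole of T(V) that are diagonal for the braiding, so no
  inclusion of the Nichols algebra of a braided subspace has to be established. The two tests for a
  non-zero commutator come from the two sides. Stripping the first letter sees only the innermost
  letter, because the coefficients of the commutator cancel the rest. Stripping the last letter sees
  the product of all letters, and this test also admits a repeated letter. Letters are chosen with S
  = 0 where possible, so that \<psi>(S T) = 1 for every \<psi>. Pairs i, -i give this if -1 is a
  square. If it is not, a zero sum comes from a group of squares, whose order is odd, or from a
  special sum in the prime field, while eps = -1 asks for an even number of letters; this conflict
  causes the case distinction.\<close>

text \<open>Words stand for the dual basis of the tensor algebra: \<open>qshuf q j\<close> is multiplication by the
  letter \<open>j\<close> in the quantum shuffle algebra, and \<open>qword q v wsingle\<close> is the image of the word \<open>v\<close>
  under the quantum symmetrizer.\<close>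

fun qshuf :: "('s \<Rightarrow> 's \<Rightarrow> 'k::field) \<Rightarrow> 's \<Rightarrow> ('s list \<Rightarrow> 'k) \<Rightarrow> 's list \<Rightarrow> 'k" where
  "qshuf q j f [] = 0"
| "qshuf q j f (i # u) = (if i = j then f u else 0) + q j i * qshuf q j (\<lambda>x. f (i # x)) u"

definition wsingle :: "('s list \<Rightarrow> 'k::field)" where
  "wsingle = (\<lambda>u. if u = [] then 1 else 0)"

fun qword :: "('s \<Rightarrow> 's \<Rightarrow> 'k::field) \<Rightarrow> 's list \<Rightarrow> ('s list \<Rightarrow> 'k) \<Rightarrow> ('s list \<Rightarrow> 'k)" where
  "qword q [] f = f"
| "qword q (j # v) f = qshuf q j (qword q v f)"

definition qmul :: "('s \<Rightarrow> 's \<Rightarrow> 'k::field) \<Rightarrow> 's list \<Rightarrow> 's \<Rightarrow> 'k" where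
  "qmul q w j = prod_list (map (\<lambda>l. q l j) w)"

definition qmulr :: "('s \<Rightarrow> 's \<Rightarrow> 'k::field) \<Rightarrow> 's \<Rightarrow> 's list \<Rightarrow> 'k" where
  "qmulr q j w = prod_list (map (\<lambda>l. q j l) w)"

lemma qmul_simps [simp]: "qmul q [] j = 1" "qmul q (i # w) j = q i j * qmul q w j"
  "qmulr q j [] = 1" "qmulr q j (i # w) = q j i * qmulr q j w"
  by (simp_all add: qmul_def qmulr_def)

lemma qmul_append [simp]: "qmul q (v @ w) j = qmul q v j * qmul q w j"
  "qmulr q j (v @ w) = qmulr q j v * qmulr q j w"
  by (simp_all add: qmul_def qmulr_def)

section \<open>Skew derivations and the torus action\<close>

definition dleft :: "'s \<Rightarrow> ('s list \<Rightarrow> 'k) \<Rightarrow> ('s list \<Rightarrow> 'k)" where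
  "dleft i f = (\<lambda>u. f (i # u))"

definition dright :: "'s \<Rightarrow> ('s list \<Rightarrow> 'k) \<Rightarrow> ('s list \<Rightarrow> 'k)" where
  "dright i f = (\<lambda>u. f (u @ [i]))"

definition torus :: "('s \<Rightarrow> 's \<Rightarrow> 'k::field) \<Rightarrow> 's \<Rightarrow> ('s list \<Rightarrow> 'k) \<Rightarrow> ('s list \<Rightarrow> 'k)" where
  "torus q i f = (\<lambda>u. qmulr q i u * f u)"

text \<open>Named so that one rewrite rule per operator covers sums, multiples and zero.\<close>

definition lcomb :: "'k \<Rightarrow> ('s list \<Rightarrow> 'k::field) \<Rightarrow> 'k \<Rightarrow> ('s list \<Rightarrow> 'k) \<Rightarrow> ('s list \<Rightarrow> 'k)" where
  "lcomb a f b h = (\<lambda>u. a * f u + b * h u)"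

lemma qshuf_lcomb: "qshuf q j (lcomb a f b h) = lcomb a (qshuf q j f) b (qshuf q j h)"
proof
  fix u show "qshuf q j (lcomb a f b h) u = lcomb a (qshuf q j f) b (qshuf q j h) u"
  proof (induction u arbitrary: f h)
    case (Cons i u)
    have "(\<lambda>x. lcomb a f b h (i # x)) = lcomb a (\<lambda>x. f (i # x)) b (\<lambda>x. h (i # x))"
      by (simp add: lcomb_def)
    then show ?case using Cons.IH by (simp add: lcomb_def algebra_simps)
  qed (simp add: lcomb_def)
qed

lemma qshuf_scale: "qshuf q j (\<lambda>u. c * h u) = (\<lambda>u. c * qshuf q j h u)"
  using qshuf_lcomb[of q j c h 0 h] by (simp add: lcomb_def)

lemma qshuf_zero [simp]: "qshuf q j (\<lambda>u. 0) = (\<lambda>u. 0)"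
  using qshuf_scale[of q j 0 "\<lambda>u. 0"] by simp

lemma qword_lcomb: "qword q v (lcomb a f b h) = lcomb a (qword q v f) b (qword q v h)"
  by (induction v) (simp_all add: qshuf_lcomb)

lemma qword_append: "qword q (v @ w) f = qword q v (qword q w f)"
  by (induction v) simp_all

text \<open>The first letter of a shuffle is the inserted \<open>j\<close> or the old first letter,
  which \<open>j\<close> has then passed at the cost \<open>q j i\<close>: a twisted Leibniz
  rule.\<close>

lemma dleft_qshuf: "dleft i (qshuf q j f) = lcomb (if i = j then 1 else 0) f (q j i) (qshuf q j (dleft i f))"
  by (auto simp: dleft_def lcomb_def fun_eq_iff)

text \<open>An inserted letter that ends up last has passed the whole word; \<open>torus\<close>
  collects the resulting factor.\<close>

lemma dright_qshuf: "dright i (qshuf q j f) = lcomb 1 (qshuf q j (dright i f)) (if i = j then 1 else 0) (torus q i f)"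
proof
  fix u show "dright i (qshuf q j f) u = lcomb 1 (qshuf q j (dright i f)) (if i = j then 1 else 0) (torus q i f) u"
  proof (induction u arbitrary: f)
    case (Cons k u)
    then show ?case by (auto simp: lcomb_def dright_def torus_def algebra_simps)
  qed (auto simp: lcomb_def dright_def torus_def)
qed

lemma torus_qshuf: "torus q i (qshuf q j f) = (\<lambda>u. q i j * qshuf q j (torus q i f) u)"
proof
  fix u show "torus q i (qshuf q j f) u = q i j * qshuf q j (torus q i f) u"
  proof (induction u arbitrary: f)
    case (Cons k u)
    have "qshuf q j (\<lambda>x. torus q i f (k # x)) u = q i k * qshuf q j (torus q i (\<lambda>x. f (k # x))) u"
    proof -
      have "(\<lambda>x. torus q i f (k # x)) = lcomb (q i k) (torus q i (\<lambda>x. f (k # x))) 0 (\<lambda>_. 0)"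
        by (auto simp: torus_def lcomb_def algebra_simps)
      then show ?thesis by (simp only: qshuf_lcomb) (simp add: lcomb_def)
    qed
    then show ?case using Cons.IH[of "\<lambda>x. f (k # x)"] by (auto simp: torus_def algebra_simps)
  qed (auto simp: torus_def)
qed

text \<open>Shuffling only permutes letters. The auxiliary claim is about any \<open>f\<close>
  supported on words of one letter content, since the recursion of \<open>qshuf\<close> replaces
  \<open>f\<close> by its shifts.\<close>

lemma qword_support: "qword q v wsingle u \<noteq> 0 \<Longrightarrow> mset u = mset v"
proof -
  have 1: "qshuf q j f u \<noteq> 0 \<Longrightarrow> (\<And>u. f u \<noteq> 0 \<Longrightarrow> mset u = A) \<Longrightarrow> mset u = add_mset j A" for j f u A
  proof (induction u arbitrary: f A)
    case (Cons i u)
    show ?case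
    proof (cases "i = j \<and> f u \<noteq> 0")
      case True then show ?thesis using Cons.prems by auto
    next
      case False
      then have nz: "qshuf q j (\<lambda>x. f (i # x)) u \<noteq> 0" using Cons.prems(1) by (auto split: if_splits)
      have A: "mset x = A - {#i#}" if "f (i # x) \<noteq> 0" for x
        using Cons.prems(2)[OF that] by (metis add_mset_remove_trivial mset.simps(2))
      obtain x where "f (i # x) \<noteq> 0"
      proof (rule ccontr)
        assume "\<not> thesis"
        then have "(\<lambda>x. f (i # x)) = (\<lambda>x. 0)" using that by blast
        moreover have "qshuf q j (\<lambda>x. 0) u = 0" by (induction u) auto
        ultimately show False using nz by simp
      qed
      then have "i \<in># A" using Cons.prems(2) by fastforce
      then show ?thesis using Cons.IH[OF nz A] by simp
    qed
  qed simp
  show "qword q v wsingle u \<noteq> 0 \<Longrightarrow> mset u = mset v"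
    by (induction v arbitrary: u) (auto simp: wsingle_def split: if_splits intro: 1)
qed

text \<open>Homogeneous elements of letter content \<open>w\<close>, kept as operators on arbitrary
  \<open>f\<close>: products are then compositions, and a derivation can act on whatever stands to
  the right.\<close>

inductive_set wspan :: "('s \<Rightarrow> 's \<Rightarrow> 'k::field) \<Rightarrow> 's list \<Rightarrow> (('s list \<Rightarrow> 'k) \<Rightarrow> ('s list \<Rightarrow> 'k)) set"
  for q w where
  word: "mset v = mset w \<Longrightarrow> qword q v \<in> wspan q w"
| comb: "A \<in> wspan q w \<Longrightarrow> B \<in> wspan q w \<Longrightarrow> (\<lambda>f. lcomb a (A f) b (B f)) \<in> wspan q w"

lemma wspan_mset: "mset v = mset w \<Longrightarrow> wspan q v = wspan q w"
proof -
  have "A \<in> wspan q w" if "A \<in> wspan q v" "mset v = mset w" for A v w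
    using that by (induction) (auto intro: wspan.intros)
  then show "mset v = mset w \<Longrightarrow> wspan q v = wspan q w" by auto
qed

lemma wspan_lcomb: "A \<in> wspan q w \<Longrightarrow> A (lcomb a f b h) = lcomb a (A f) b (A h)"
proof (induction rule: wspan.induct)
  case (comb A B c d)
  then show ?case by (simp add: lcomb_def algebra_simps)
qed (simp add: qword_lcomb)

lemma wspan_comp: assumes "A \<in> wspan q v" "B \<in> wspan q w" shows "(\<lambda>f. A (B f)) \<in> wspan q (v @ w)"
  using assms
proof (induction A rule: wspan.induct)
  case (word x)
  from word(2,1) show ?case
  proof (induction B rule: wspan.induct)
    case (word y)
    have "(\<lambda>f. qword q x (qword q y f)) = qword q (x @ y)" by (simp add: qword_append fun_eq_iff)
    then show ?case using word by (metis wspan.word mset_append)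
  next
    case (comb A B a b)
    then show ?case by (simp add: qword_lcomb wspan.comb)
  qed
next
  case (comb A B' a b)
  then show ?case by (simp add: wspan.comb)
qed

lemma wspan_zero: assumes "A \<in> wspan q w" "\<And>v. mset v = mset w \<Longrightarrow> qword q v wsingle = (\<lambda>_. 0)"
  shows "A wsingle = (\<lambda>_. 0)"
  using assms by (induction rule: wspan.induct) (auto simp: lcomb_def)

lemma wspan_support: "A \<in> wspan q w \<Longrightarrow> A wsingle u \<noteq> 0 \<Longrightarrow> mset u = mset w"
proof (induction arbitrary: u rule: wspan.induct)
  case (comb A B a b)
  then show ?case by (cases "A wsingle u = 0") (auto simp: lcomb_def)
qed (auto dest: qword_support)

text \<open>A letter outside the content is never the inserted one, so only the passing factors of
  the Leibniz rule remain. They depend on the multiset of letters alone and are common to all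
  rearrangements.\<close>

lemma dleft_wspan: "A \<in> wspan q w \<Longrightarrow> i \<notin> set w \<Longrightarrow> dleft i (A f) = lcomb (qmul q w i) (A (dleft i f)) 0 f"
proof (induction arbitrary: rule: wspan.induct)
  case (word v)
  have "i \<notin> set v" "qmul q v i = qmul q w i" using word
    by (auto simp: qmul_def simp flip: prod_mset_prod_list dest: mset_eq_setD)
  moreover have "i \<notin> set v \<Longrightarrow> dleft i (qword q v f) = lcomb (qmul q v i) (qword q v (dleft i f)) 0 f" for v
  proof (induction v)
    case (Cons j v)
    then show ?case by (auto simp: dleft_qshuf qshuf_scale lcomb_def algebra_simps)
  qed (simp add: lcomb_def)
  ultimately show ?case by metis
next
  case (comb A B a b)
  then have "dleft i (A f) u = lcomb (qmul q w i) (A (dleft i f)) 0 f u"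
    "dleft i (B f) u = lcomb (qmul q w i) (B (dleft i f)) 0 f u" for u by auto
  then show ?case by (auto simp: lcomb_def dleft_def algebra_simps fun_eq_iff)
qed

lemma dright_wspan: "A \<in> wspan q w \<Longrightarrow> i \<notin> set w \<Longrightarrow> dright i (A f) = A (dright i f)"
proof (induction arbitrary: rule: wspan.induct)
  case (word v)
  have "i \<notin> set v" using word by (auto dest: mset_eq_setD)
  moreover have "i \<notin> set v \<Longrightarrow> dright i (qword q v f) = qword q v (dright i f)" for v
  proof (induction v)
    case (Cons j v)
    then show ?case by (auto simp: dright_qshuf lcomb_def)
  qed simp
  ultimately show ?case by metis
next
  case (comb A B a b)
  then have "dright i (A f) u = A (dright i f) u" "dright i (B f) u = B (dright i f) u" for u by auto
  then show ?case by (auto simp: lcomb_def dright_def fun_eq_iff)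
qed

lemma torus_wspan: "A \<in> wspan q w \<Longrightarrow> torus q i (A f) = (\<lambda>u. qmulr q i w * A (torus q i f) u)"
proof (induction arbitrary: rule: wspan.induct)
  case (word v)
  have "qmulr q i v = qmulr q i w" using word by (auto simp: qmulr_def simp flip: prod_mset_prod_list)
  moreover have "torus q i (qword q v f) = (\<lambda>u. qmulr q i v * qword q v (torus q i f) u)" for v
  proof (induction v)
    case (Cons j v)
    then show ?case by (auto simp: torus_qshuf qshuf_scale)
  qed simp
  ultimately show ?case by metis
next
  case (comb A B a b)
  then have "torus q i (A f) u = qmulr q i w * A (torus q i f) u" "torus q i (B f) u = qmulr q i w * B (torus q i f) u" for u by auto
  then show ?case by (auto simp: lcomb_def torus_def fun_eq_iff algebra_simps)
qed

text \<open>\<open>qword q u\<close> and \<open>qword q v\<close> pair by stripping the letters of \<open>u\<close> one after the other.\<close>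

lemma qword_eval:
  assumes "length v = length u" "\<And>j y. j \<in> set u \<Longrightarrow> f (j # y) = 0"
  shows "qword q v f (u @ x) = qword q v wsingle u * f x"
proof -
  \<comment> \<open>\<open>der v j\<close> lists the terms of the skew derivation for
    \<open>j\<close> on the word \<open>v\<close>: a coefficient and the word with one
    \<open>j\<close> removed.\<close>
  define der where "der = rec_list (\<lambda>j. []) (\<lambda>a v d j. (if j = a then [(1::'b, v)] else []) @ map (\<lambda>(c, y). (c * q a j, a # y)) (d j))"
  have der: "der [] j = []" "der (a # v) j = (if j = a then [(1, v)] else []) @ map (\<lambda>(c, y). (c * q a j, a # y)) (der v j)" for a v j
    by (simp_all add: der_def)
  have len: "(c, y) \<in> set (der v j) \<Longrightarrow> Suc (length y) = length v" for c y v j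
    by (induction v arbitrary: c y) (auto simp: der split: if_splits)
  have sum: "qshuf q a (\<lambda>x. \<Sum>(c, y)\<leftarrow>L. c * F y x) x = (\<Sum>(c, y)\<leftarrow>L. c * qshuf q a (F y) x)" for a L F x
  proof (induction L arbitrary: x)
    case Nil
    then show ?case by simp
  next
    case (Cons p L)
    then show ?case using qshuf_lcomb[of q a "fst p" "F (snd p)" 1 "\<lambda>x. \<Sum>(c, y)\<leftarrow>L. c * F y x"]
      by (simp add: lcomb_def case_prod_unfold)
  qed
  \<comment> \<open>Stripping \<open>j\<close> acts on the word \<open>v\<close> alone, because
    \<open>f\<close> has no part that begins with \<open>j\<close>.\<close>
  have main: "qword q v f (j # x) = (\<Sum>(c, y)\<leftarrow>der v j. c * qword q y f x)" if "\<And>y. f (j # y) = 0" for v j x and f :: "'a list \<Rightarrow> 'b"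
  proof (induction v arbitrary: x)
    case Nil then show ?case using that by (simp add: der)
  next
    case (Cons a v)
    have "qword q (a # v) f (j # x) = (if j = a then qword q v f x else 0) + q a j * qshuf q a (\<lambda>x. qword q v f (j # x)) x"
      by simp
    also have "(\<lambda>x. qword q v f (j # x)) = (\<lambda>x. \<Sum>(c, y)\<leftarrow>der v j. c * qword q y f x)" using Cons by auto
    also have "q a j * qshuf q a \<dots> x = (\<Sum>(c, y)\<leftarrow>der v j. (c * q a j) * qword q (a # y) f x)"
      unfolding sum by (simp add: sum_list_const_mult[symmetric] case_prod_unfold mult_ac)
    finally show ?case by (simp add: der case_prod_unfold o_def)
  qed
  show ?thesis using assms
  proof (induction u arbitrary: v)
    case (Cons j u)
    have a: "qword q v f (j # (u @ x)) = (\<Sum>(c, y)\<leftarrow>der v j. c * qword q y f (u @ x))"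
      using Cons.prems by (intro main) auto
    have b: "qword q v wsingle (j # u) = (\<Sum>(c, y)\<leftarrow>der v j. c * qword q y wsingle u)"
      by (intro main) (auto simp: wsingle_def)
    have "(\<Sum>(c, y)\<leftarrow>der v j. c * qword q y f (u @ x)) = (\<Sum>(c, y)\<leftarrow>der v j. c * qword q y wsingle u * f x)"
    proof (intro arg_cong[of _ _ sum_list] map_cong refl, clarify)
      fix c y assume "(c, y) \<in> set (der v j)"
      then have "length y = length u" using len[of c y v j] Cons.prems by simp
      then show "c * qword q y f (u @ x) = c * qword q y wsingle u * f x"
        using Cons.IH[of y] Cons.prems by simp
    qed
    then show ?case using a b by (simp add: sum_list_mult_const[symmetric] case_prod_unfold)
  qed (simp add: wsingle_def)
qed

lemma wspan_eval:
  assumes "A \<in> wspan q w" "length u = length w" "\<And>j y. j \<in> set u \<Longrightarrow> f (j # y) = 0"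
  shows "A f (u @ x) = A wsingle u * f x"
  using assms
proof (induction rule: wspan.induct)
  case (word v)
  then show ?case by (metis qword_eval mset_eq_length)
qed (simp add: lcomb_def algebra_simps)

section \<open>Iterated braided commutators\<close>

text \<open>\<open>zop q r [i\<^sub>1, \<dots>, i\<^sub>n]\<close> multiplies by the braided commutator
  \<open>[x(i\<^sub>1), [\<dots>, [x(i\<^sub>n), x(r)]]]\<close>, and \<open>mop\<close> is what the skew derivation for \<open>r\<close> leaves of it.\<close>

fun zop :: "('s \<Rightarrow> 's \<Rightarrow> 'k::field) \<Rightarrow> 's \<Rightarrow> 's list \<Rightarrow> ('s list \<Rightarrow> 'k) \<Rightarrow> 's list \<Rightarrow> 'k" where
  "zop q r [] f = qshuf q r f"
| "zop q r (i # w) f = lcomb 1 (qshuf q i (zop q r w f)) (- inverse (qmul q (w @ [r]) i)) (zop q r w (qshuf q i f))"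

fun mop :: "('s \<Rightarrow> 's \<Rightarrow> 'k::field) \<Rightarrow> 's \<Rightarrow> 's list \<Rightarrow> ('s list \<Rightarrow> 'k) \<Rightarrow> 's list \<Rightarrow> 'k" where
  "mop q r [] f = f"
| "mop q r (i # w) f = lcomb (q i r) (qshuf q i (mop q r w f)) (- inverse (qmul q (w @ [r]) i)) (mop q r w (qshuf q i f))"

lemma qshuf_wspan: "qshuf q i \<in> wspan q [i]"
proof -
  have "qword q [i] = qshuf q i" by (simp add: fun_eq_iff)
  then show ?thesis using wspan.word[of "[i]" "[i]" q] by simp
qed

lemma zop_wspan: "zop q r w \<in> wspan q (w @ [r])"
proof (induction w)
  case Nil
  have "zop q r [] = qshuf q r" by (simp add: fun_eq_iff)
  then show ?case by (simp add: qshuf_wspan)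
next
  case (Cons i w)
  have 1: "(\<lambda>f. qshuf q i (zop q r w f)) \<in> wspan q ((i # w) @ [r])"
    using wspan_comp[OF qshuf_wspan Cons] by simp
  have 2: "(\<lambda>f. zop q r w (qshuf q i f)) \<in> wspan q ((i # w) @ [r])"
    using wspan_comp[OF Cons qshuf_wspan] by (subst wspan_mset[of _ "(w @ [r]) @ [i]"]) auto
  show ?case using wspan.comb[OF 1 2, of 1 "- inverse (qmul q (w @ [r]) i)"] by simp
qed

lemma mop_wspan: "mop q r w \<in> wspan q w"
proof (induction w)
  case Nil
  have "mop q r [] = qword q []" by (simp add: fun_eq_iff)
  then show ?case using wspan.word[of "[]" "[]" q] by metis
next
  case (Cons i w)
  have 1: "(\<lambda>f. qshuf q i (mop q r w f)) \<in> wspan q (i # w)"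
    using wspan_comp[OF qshuf_wspan Cons] by simp
  have 2: "(\<lambda>f. mop q r w (qshuf q i f)) \<in> wspan q (i # w)"
    using wspan_comp[OF Cons qshuf_wspan] by (subst wspan_mset[of _ "w @ [i]"]) auto
  show ?case using wspan.comb[OF 1 2, of "q i r" "- inverse (qmul q (w @ [r]) i)"] by simp
qed

lemma wspan_scale: "A \<in> wspan q w \<Longrightarrow> A (\<lambda>u. c * f u) = (\<lambda>u. c * A f u)"
  using wspan_lcomb[of A q w c f 0 f] by (simp add: lcomb_def)

lemma wspan_add: "A \<in> wspan q w \<Longrightarrow> A (\<lambda>u. f u + h u) = (\<lambda>u. A f u + A h u)"
  using wspan_lcomb[of A q w 1 f 1 h] by (simp add: lcomb_def)

lemma wspan_const0: "A \<in> wspan q w \<Longrightarrow> A (\<lambda>u. 0) = (\<lambda>u. 0)"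
  using wspan_scale[of A q w 0 "\<lambda>u. 0"] by simp

lemmas zop_linear = wspan_scale[OF zop_wspan] wspan_add[OF zop_wspan] wspan_const0[OF zop_wspan]

lemma qshuf_add: "qshuf q i (\<lambda>u. f u + h u) = (\<lambda>u. qshuf q i f u + qshuf q i h u)"
  using qshuf_lcomb[of q i 1 f 1 h] by (simp add: lcomb_def)

lemma dleft_lcomb: "dleft i (lcomb a f b h) = lcomb a (dleft i f) b (dleft i h)"
  by (simp add: dleft_def lcomb_def)

lemma dright_lcomb: "dright i (lcomb a f b h) = lcomb a (dright i f) b (dright i h)"
  by (simp add: dright_def lcomb_def)

context
  fixes q :: "'s \<Rightarrow> 's \<Rightarrow> 'k::field_char_0"
  assumes q_nz: "\<And>i j. q i j \<noteq> 0"
begin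

lemma qmul_nz: "qmul q w j \<noteq> 0"
  by (induction w) (auto simp: q_nz)

text \<open>For \<open>j = i\<close> both summands of the commutator contribute a multiple of
  \<open>zop q r w f\<close>, and the coefficient \<open>- inverse (qmul q (w @ [r]) i)\<close> is
  the one that cancels them. Hence the commutator is felt only by the derivation for
  \<open>r\<close>, although other letters occur in it.\<close>

lemma dleft_zop_other:
  assumes "j \<noteq> r"
  shows "dleft j (zop q r w f) = (\<lambda>u. qmul q (w @ [r]) j * zop q r w (dleft j f) u)"
proof (induction w arbitrary: f)
  case Nil
  then show ?case using assms by (simp add: dleft_qshuf lcomb_def)
next
  case (Cons i w)
  have 1: "dleft j (qshuf q i (zop q r w f)) =
     (\<lambda>u. (if j = i then zop q r w f u else 0) + q i j * qmul q (w @ [r]) j * qshuf q i (zop q r w (dleft j f)) u)"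
    by (simp add: dleft_qshuf Cons.IH qshuf_scale lcomb_def fun_eq_iff)
  have 2: "dleft j (zop q r w (qshuf q i f)) = (\<lambda>u. qmul q (w @ [r]) j * ((if j = i then zop q r w f u else 0) + q i j * zop q r w (qshuf q i (dleft j f)) u))"
    by (auto simp: Cons.IH dleft_qshuf lcomb_def zop_linear fun_eq_iff)
  show ?case unfolding zop.simps dleft_lcomb 1 2 using qmul_nz[of w j] q_nz[of r j]
    by (cases "j = i") (auto simp: zop_linear lcomb_def fun_eq_iff field_simps)
qed

lemma dleft_zop_same:
  assumes "r \<notin> set w"
  shows "dleft r (zop q r w f) = (\<lambda>u. mop q r w f u + qmul q (w @ [r]) r * zop q r w (dleft r f) u)"
  using assms
proof (induction w arbitrary: f)
  case Nil
  then show ?case by (simp add: dleft_qshuf lcomb_def)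
next
  case (Cons i w)
  have ir: "i \<noteq> r" "r \<noteq> i" using Cons.prems by auto
  have IH: "dleft r (zop q r w f) = (\<lambda>u. mop q r w f u + qmul q (w @ [r]) r * zop q r w (dleft r f) u)" for f
    using Cons by simp
  have 1: "dleft r (qshuf q i (zop q r w f)) =
     (\<lambda>u. q i r * (qshuf q i (mop q r w f) u + qmul q (w @ [r]) r * qshuf q i (zop q r w (dleft r f)) u))"
    using ir by (simp add: dleft_qshuf IH qshuf_scale qshuf_add lcomb_def fun_eq_iff)
  have 2: "dleft r (zop q r w (qshuf q i f)) = (\<lambda>u. mop q r w (qshuf q i f) u + qmul q (w @ [r]) r * (q i r * zop q r w (qshuf q i (dleft r f)) u))"
    using ir by (auto simp: IH dleft_qshuf lcomb_def zop_linear fun_eq_iff)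
  show ?case unfolding zop.simps mop.simps dleft_lcomb 1 2
    by (auto simp: lcomb_def fun_eq_iff algebra_simps)
qed

lemma dleft_wsingle [simp]: "dleft j wsingle = (\<lambda>u. 0)"
  by (simp add: dleft_def wsingle_def)

lemma dright_wsingle [simp]: "dright j wsingle = (\<lambda>u. 0)"
  by (simp add: dright_def wsingle_def)

lemma torus_wsingle [simp]: "torus q j wsingle = wsingle"
  by (auto simp: torus_def wsingle_def)

lemma wspan_Nil: "A \<in> wspan q w \<Longrightarrow> w \<noteq> [] \<Longrightarrow> A wsingle [] = 0"
  using wspan_support[of A q w "[]"] by auto

text \<open>A function that vanishes at the empty word is determined by its left derivatives, and of
  these only the one for \<open>r\<close> can be non-zero.\<close>

lemma zop_nonzero_iff:
  assumes "r \<notin> set w"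
  shows "zop q r w wsingle \<noteq> (\<lambda>u. 0) \<longleftrightarrow> mop q r w wsingle \<noteq> (\<lambda>u. 0)"
proof -
  have *: "dleft r (zop q r w wsingle) = mop q r w wsingle"
    using dleft_zop_same[OF assms, of wsingle] by (simp add: zop_linear)
  have **: "j \<noteq> r \<Longrightarrow> dleft j (zop q r w wsingle) = (\<lambda>u. 0)" for j
    using dleft_zop_other[of j r w wsingle] by (simp add: zop_linear)
  show ?thesis
  proof
    assume "zop q r w wsingle \<noteq> (\<lambda>u. 0)"
    then obtain u where u: "zop q r w wsingle u \<noteq> 0" by auto
    then obtain j v where "u = j # v" using wspan_Nil[OF zop_wspan, of w r] by (cases u) auto
    with u have "dleft j (zop q r w wsingle) \<noteq> (\<lambda>u. 0)" by (auto simp: dleft_def fun_eq_iff)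
    then show "mop q r w wsingle \<noteq> (\<lambda>u. 0)" using * ** by metis
  next
    assume "mop q r w wsingle \<noteq> (\<lambda>u. 0)"
    then show "zop q r w wsingle \<noteq> (\<lambda>u. 0)" using * by (auto simp: dleft_def)
  qed
qed

lemma zop_nonzero_Nil: "zop q r [] wsingle \<noteq> (\<lambda>u. 0)"
proof -
  have "zop q r [] wsingle [r] = 1" by (simp add: wsingle_def)
  then show ?thesis by (metis zero_neq_one)
qed

text \<open>Apply the derivation for the new letter \<open>i\<close> to the \<open>mop\<close> part:
  the factors of the letters of \<open>w\<close> cancel, which leaves
  \<open>q i r - inverse (q r i)\<close> times the old value. This is why the test involves the
  innermost letter only.\<close>

lemma zop_nonzero_Cons_left:
  assumes "r \<notin> set w" "i \<notin> set w" "i \<noteq> r" "q i r * q r i \<noteq> 1"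
    and "zop q r w wsingle \<noteq> (\<lambda>u. 0)"
  shows "zop q r (i # w) wsingle \<noteq> (\<lambda>u. 0)"
proof -
  have r: "r \<notin> set (i # w)" using assms by simp
  have 1: "dleft i (qshuf q i (mop q r w wsingle)) = mop q r w wsingle"
    using dleft_wspan[OF mop_wspan assms(2), of q r wsingle] by (simp add: dleft_qshuf lcomb_def wspan_const0[OF mop_wspan])
  have 2: "dleft i (mop q r w (qshuf q i wsingle)) = (\<lambda>u. qmul q w i * mop q r w wsingle u)"
    using dleft_wspan[OF mop_wspan assms(2), where f = "qshuf q i wsingle"] by (simp add: dleft_qshuf lcomb_def)
  have "dleft i (mop q r (i # w) wsingle) = (\<lambda>u. (q i r - inverse (q r i)) * mop q r w wsingle u)"
    using qmul_nz[of w i] q_nz[of r i] unfolding mop.simps dleft_lcomb 1 2 by (simp add: lcomb_def fun_eq_iff field_simps)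
  moreover have "q i r - inverse (q r i) \<noteq> 0"
    using assms(4) q_nz[of r i] by (auto simp: field_simps)
  moreover have "mop q r w wsingle \<noteq> (\<lambda>u. 0)"
    using zop_nonzero_iff[OF assms(1)] assms(5) by blast
  ultimately have "dleft i (mop q r (i # w) wsingle) \<noteq> (\<lambda>u. 0)" by (auto simp: fun_eq_iff)
  then have "mop q r (i # w) wsingle \<noteq> (\<lambda>u. 0)" by (metis dleft_def)
  then show ?thesis using zop_nonzero_iff[OF r] by blast
qed

text \<open>The factor by which the right skew derivation for \<open>i\<close> lowers the number of leading letters \<open>i\<close>
  from \<open>e\<close> to \<open>e - 1\<close>.\<close>

definition rcoef :: "'s \<Rightarrow> 's \<Rightarrow> 's list \<Rightarrow> nat \<Rightarrow> 'k" where
  "rcoef i r w e = (\<Sum>j<e. qmulr q i (w @ [r]) * q i i ^ j - inverse (qmul q (w @ [r]) i * q i i ^ j))"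

text \<open>Each further commutator with \<open>i\<close> adds the factor with which the torus
  passes the inner commutator, minus the coefficient of the second summand. These differences
  accumulate to \<open>rcoef\<close>.\<close>

lemma dright_zop:
  assumes "i \<notin> set w" "i \<noteq> r"
  shows "dright i (zop q r (replicate e i @ w) f) =
     lcomb 1 (zop q r (replicate e i @ w) (dright i f)) (rcoef i r w e) (zop q r (replicate (e - 1) i @ w) (torus q i f))"
proof (induction e arbitrary: f)
  case 0
  have "i \<notin> set (w @ [r])" using assms by simp
  from dright_wspan[OF zop_wspan this] show ?case by (simp add: rcoef_def lcomb_def)
next
  case (Suc e)
  let ?w = "replicate e i @ w"
  have qm: "qmul q (?w @ [r]) i = q i i ^ e * qmul q (w @ [r]) i" "qmulr q i (?w @ [r]) = q i i ^ e * qmulr q i (w @ [r])"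
    by (induction e) (auto simp: algebra_simps)
  have 1: "dright i (qshuf q i (zop q r ?w f)) u = qshuf q i (zop q r ?w (dright i f)) u
      + rcoef i r w e * qshuf q i (zop q r (replicate (e - 1) i @ w) (torus q i f)) u
      + qmulr q i (?w @ [r]) * zop q r ?w (torus q i f) u" for u
    by (simp only: dright_qshuf Suc.IH qshuf_lcomb torus_wspan[OF zop_wspan]) (simp add: lcomb_def)
  have 2: "dright i (zop q r ?w (qshuf q i f)) u = zop q r ?w (qshuf q i (dright i f)) u
      + zop q r ?w (torus q i f) u
      + rcoef i r w e * q i i * zop q r (replicate (e - 1) i @ w) (qshuf q i (torus q i f)) u" for u
    by (simp add: Suc.IH dright_qshuf torus_qshuf lcomb_def zop_linear)
  \<comment> \<open>This unfolds the outermost commutator. The factor \<open>rcoef i r w e\<close>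
    covers \<open>e = 0\<close>, where there is nothing to unfold and the factor is zero.\<close>
  have 3: "rcoef i r w e * zop q r ?w g u = rcoef i r w e * (qshuf q i (zop q r (replicate (e - 1) i @ w) g) u
      - inverse (qmul q (?w @ [r]) i) * q i i * zop q r (replicate (e - 1) i @ w) (qshuf q i g) u)" for g u
  proof (cases e)
    case 0 then show ?thesis by (simp add: rcoef_def)
  next
    case (Suc d)
    have qm': "qmul q ((replicate d i @ w) @ [r]) i = q i i ^ d * qmul q (w @ [r]) i"
      by (induction d) (auto simp: algebra_simps)
    show ?thesis unfolding qm using Suc q_nz[of i i] qmul_nz[of w i] qmul_nz[of "w @ [r]" i] qm'
      by (simp add: lcomb_def field_simps del: qmul_append)
  qed
  have 4: "rcoef i r w (Suc e) = rcoef i r w e + qmulr q i (?w @ [r]) - inverse (qmul q (?w @ [r]) i)"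
    unfolding qm by (simp add: rcoef_def algebra_simps)
  have 5: "zop q r (replicate (Suc e) i @ w) g = lcomb 1 (qshuf q i (zop q r ?w g)) (- inverse (qmul q (?w @ [r]) i)) (zop q r ?w (qshuf q i g))" for g
    by simp
  have 6: "replicate (Suc e - 1) i @ w = ?w" by simp
  have alg: "A + c * B + m * C + - k * (A' + C + c * Q * B') = (A + - k * A') + (c + m - k) * C"
    if "c * C = c * (B - k * Q * B')" for A A' B B' C c k m Q :: 'k
    using that by (simp add: algebra_simps)
  show ?case
    unfolding 4 6 5 dright_lcomb fun_eq_iff
    unfolding lcomb_def mult_1_left 1 2
    by (intro allI alg 3)
qed

text \<open>At \<open>wsingle\<close> the first summand of \<open>dright_zop\<close> vanishes, so
  each right derivation removes one \<open>i\<close> at the cost of a factor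
  \<open>rcoef\<close>.\<close>

lemma zop_nonzero_replicate:
  assumes "i \<notin> set w" "i \<noteq> r" "zop q r w wsingle \<noteq> (\<lambda>u. 0)"
    and "\<And>k. 1 \<le> k \<Longrightarrow> k \<le> e \<Longrightarrow> rcoef i r w k \<noteq> 0"
  shows "zop q r (replicate e i @ w) wsingle \<noteq> (\<lambda>u. 0)"
  using assms(4)
proof (induction e)
  case 0 then show ?case using assms(3) by simp
next
  case (Suc e)
  have "dright i (zop q r (replicate (Suc e) i @ w) wsingle) = (\<lambda>u. rcoef i r w (Suc e) * zop q r (replicate e i @ w) wsingle u)"
    using dright_zop[OF assms(1,2), of "Suc e" wsingle] by (simp add: zop_linear lcomb_def)
  moreover have "zop q r (replicate e i @ w) wsingle \<noteq> (\<lambda>u. 0)" "rcoef i r w (Suc e) \<noteq> 0" using Suc by auto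
  ultimately have "dright i (zop q r (replicate (Suc e) i @ w) wsingle) \<noteq> (\<lambda>u. 0)" by (auto simp: fun_eq_iff)
  then show ?case by (metis dright_def)
qed

text \<open>For a single copy of \<open>i\<close>, \<open>rcoef\<close> is zero precisely if the
  double braiding of \<open>i\<close> with the product of all letters so far is trivial.\<close>

lemma zop_nonzero_Cons_right:
  assumes "i \<notin> set w" "i \<noteq> r" "qmul q (w @ [r]) i * qmulr q i (w @ [r]) \<noteq> 1"
    and "zop q r w wsingle \<noteq> (\<lambda>u. 0)"
  shows "zop q r (i # w) wsingle \<noteq> (\<lambda>u. 0)"
proof -
  have "rcoef i r w 1 \<noteq> 0"
    using assms(3) qmul_nz[of "w @ [r]" i] by (auto simp: rcoef_def field_simps simp del: qmul_append qmulr_def)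
  then have "zop q r (replicate 1 i @ w) wsingle \<noteq> (\<lambda>u. 0)"
    by (intro zop_nonzero_replicate assms) (metis le_antisym)
  then show ?thesis by simp
qed

text \<open>By \<open>one\<close>, a derivation that strips all letters of the commutator passes a
  further copy of it with factor 1. So the \<open>k\<close> copies in the \<open>k\<close>-th power
  contribute equal terms, and their sum is non-zero in characteristic 0.\<close>

lemma zop_zero:
  assumes r: "r \<notin> set w" and one: "prod_list (map (qmul q (w @ [r])) (w @ [r])) = 1"
    and vanish: "\<And>v. set v \<subseteq> set (w @ [r]) \<Longrightarrow> N \<le> length v \<Longrightarrow> qword q v wsingle = (\<lambda>u. 0)"
  shows "zop q r w wsingle = (\<lambda>u. 0)"
proof (rule ccontr)
  assume "zop q r w wsingle \<noteq> (\<lambda>u. 0)"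
  then obtain u where u: "mop q r w wsingle u \<noteq> 0" using zop_nonzero_iff[OF r] by (auto simp: fun_eq_iff)
  have mu: "mset u = mset w" by (rule wspan_support[OF mop_wspan u])
  then have lu: "length u = length w" and su: "set u = set w" by (auto dest: mset_eq_length mset_eq_setD)
  define Z where "Z k = (zop q r w ^^ k) wsingle" for k
  have Z0: "Z 0 = wsingle" and ZS: "Z (Suc k) = zop q r w (Z k)" for k by (simp_all add: Z_def)
  \<comment> \<open>No power begins with a letter other than \<open>r\<close>. This is what
    \<open>wspan_eval\<close> asks of the factor to the right of \<open>mop q r w\<close>.\<close>
  have other: "Z k (j # y) = 0" if "j \<noteq> r" for k j y
  proof -
    have "dleft j (Z k) = (\<lambda>u. 0)"
      by (induction k) (use that in \<open>simp_all add: Z0 ZS dleft_zop_other zop_linear\<close>)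
    then show ?thesis by (simp add: dleft_def fun_eq_iff)
  qed
  define qq where "qq v = prod_list (map (qmul q (w @ [r])) v)" for v
  have qshift: "zop q r w g (v @ x) = qq v * zop q r w (\<lambda>y. g (v @ y)) x" if "r \<notin> set v" for v g x
    using that
  proof (induction v arbitrary: g)
    case (Cons j v)
    have "zop q r w g (j # (v @ x)) = qmul q (w @ [r]) j * zop q r w (dleft j g) (v @ x)"
      using dleft_zop_other[of j r w g] Cons.prems by (auto simp: dleft_def fun_eq_iff)
    then show ?case using Cons by (simp add: qq_def dleft_def)
  qed (simp add: qq_def)
  have "qq w = qq u" unfolding qq_def prod_mset_prod_list[symmetric] by (simp add: mu)
  with one have quu: "qmul q (w @ [r]) r * qq u = 1" by (simp add: qq_def mult.commute del: qmul_append)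
  define G where "G k x = Z k (r # u @ x)" for k x
  \<comment> \<open>This is the Leibniz rule for the product of the commutator with its
    \<open>k\<close>-th power, after \<open>r\<close> and the word \<open>u\<close> are stripped;
    the twist is the number that \<open>quu\<close> shows to be 1.\<close>
  have G: "G (Suc k) x = mop q r w wsingle u * Z k x + zop q r w (G k) x" for k x
  proof -
    have "G (Suc k) x = dleft r (zop q r w (Z k)) (u @ x)" by (simp add: G_def ZS dleft_def)
    also have "\<dots> = mop q r w (Z k) (u @ x) + qmul q (w @ [r]) r * zop q r w (dleft r (Z k)) (u @ x)"
      by (simp add: dleft_zop_same[OF r])
    also have "mop q r w (Z k) (u @ x) = mop q r w wsingle u * Z k x"
      using r su by (intro wspan_eval[OF mop_wspan lu] other) auto
    also have "zop q r w (dleft r (Z k)) (u @ x) = qq u * zop q r w (G k) x"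
      using r su by (subst qshift) (auto simp: G_def[abs_def] dleft_def)
    finally show ?thesis by (simp only: mult.assoc[symmetric] quu) simp
  qed
  have GZ: "G (Suc k) = (\<lambda>x. of_nat (Suc k) * mop q r w wsingle u * Z k x)" for k
  proof (induction k)
    case 0
    have "G 0 = (\<lambda>x. 0)" by (simp add: G_def Z0 wsingle_def fun_eq_iff)
    then have "zop q r w (G 0) = (\<lambda>x. 0)" by (simp only: zop_linear)
    then show ?case using G[of 0] by (simp add: fun_eq_iff)
  next
    case (Suc k)
    have "zop q r w (G (Suc k)) = (\<lambda>x. of_nat (Suc k) * mop q r w wsingle u * Z (Suc k) x)"
      by (simp only: Suc zop_linear ZS)
    then show ?case using G[of "Suc k"] by (simp add: fun_eq_iff algebra_simps)
  qed
  have nz: "Z k \<noteq> (\<lambda>x. 0)" for k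
  proof (induction k)
    case 0 show ?case by (auto simp: Z0 wsingle_def fun_eq_iff intro!: exI[of _ "[]"])
  next
    case (Suc k)
    then obtain x where "Z k x \<noteq> 0" by auto
    then have "G (Suc k) x \<noteq> 0" using u unfolding GZ by (simp del: of_nat_Suc)
    then show ?case by (auto simp: G_def)
  qed
  \<comment> \<open>The letter content of the \<open>k\<close>-th power. It has at least
    \<open>k\<close> letters, so the \<open>N\<close>-th power falls under
    \<open>vanish\<close>.\<close>
  define b where "b k = concat (replicate k (w @ [r]))" for k
  have "\<exists>A\<in>wspan q (b k). Z k = A wsingle" for k
  proof (induction k)
    case 0
    show ?case by (intro bexI[of _ "qword q []"]) (auto simp: Z0 b_def intro: wspan.word)
  next
    case (Suc k)
    then obtain A where A: "A \<in> wspan q (b k)" "Z k = A wsingle" by blast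
    have "(\<lambda>f. zop q r w (A f)) \<in> wspan q ((w @ [r]) @ b k)" by (rule wspan_comp[OF zop_wspan A(1)])
    then show ?case using A(2) ZS by (intro bexI) (auto simp: b_def)
  qed
  then obtain A where A: "A \<in> wspan q (b N)" "Z N = A wsingle" by blast
  have "length (b k) \<ge> k" "set (b k) \<subseteq> set (w @ [r])" for k by (induction k) (auto simp: b_def)
  then have "A wsingle = (\<lambda>_. 0)"
    by (intro wspan_zero[OF A(1)] vanish) (metis mset_eq_setD, metis mset_eq_length)
  then show False using nz A by metis
qed

end

section \<open>Reduced words\<close>

abbreviation finv :: "('a \<Rightarrow> 'b) \<Rightarrow> 'b \<Rightarrow> 'a" where "finv \<equiv> inv_into UNIV"

definition invs :: "nat \<Rightarrow> (nat \<Rightarrow> nat) \<Rightarrow> (nat \<times> nat) set" where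
  "invs n \<sigma> = {(j, k). j < k \<and> k < n \<and> \<sigma> k < \<sigma> j}"

definition word_perm :: "nat list \<Rightarrow> nat \<Rightarrow> nat" where
  "word_perm is = foldr (\<lambda>i \<tau>. Transposition.transpose i (Suc i) \<circ> \<tau>) is id"

lemma word_perm_simps [simp]: "word_perm [] = id"
  "word_perm (i # is) = Transposition.transpose i (Suc i) \<circ> word_perm is"
  by (simp_all add: word_perm_def)

lemma transp_word_iff: "transp_word n \<sigma> is \<longleftrightarrow> set is \<subseteq> {i. Suc i < n} \<and> \<sigma> = word_perm is"
  by (simp add: transp_word_def word_perm_def)

lemma finite_invs [simp]: "finite (invs n \<sigma>)"
  by (rule finite_subset[of _ "{..<n} \<times> {..<n}"]) (auto simp: invs_def)

text \<open>The swapped values \<open>i\<close> and \<open>Suc i\<close> are adjacent, so no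
  comparison with a third value changes; only the pair of positions that take these two values
  does.\<close>

lemma invs_transpose:
  assumes \<rho>: "\<rho> permutes {..<n}" and i: "Suc i < n" and lt: "finv \<rho> i < finv \<rho> (Suc i)"
  shows "invs n (Transposition.transpose i (Suc i) \<circ> \<rho>) = insert (finv \<rho> i, finv \<rho> (Suc i)) (invs n \<rho>)"
    and "(finv \<rho> i, finv \<rho> (Suc i)) \<notin> invs n \<rho>"
proof -
  have inv: "\<rho> j = x \<longleftrightarrow> j = finv \<rho> x" for j x
    using permutes_inverses[OF \<rho>] by metis
  have ltn: "finv \<rho> (Suc i) < n" using permutes_in_image[OF permutes_inv[OF \<rho>], of "Suc i"] i by auto
  show "(finv \<rho> i, finv \<rho> (Suc i)) \<notin> invs n \<rho>"
    using permutes_inverses[OF \<rho>] by (auto simp: invs_def)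
  have key: "Transposition.transpose i (Suc i) b < Transposition.transpose i (Suc i) a \<longleftrightarrow> (b < a \<and> \<not> (a = Suc i \<and> b = i)) \<or> (a = i \<and> b = Suc i)"
    if "a \<noteq> b" for a b :: nat
    using that by (auto simp: Transposition.transpose_def)
  show "invs n (Transposition.transpose i (Suc i) \<circ> \<rho>) = insert (finv \<rho> i, finv \<rho> (Suc i)) (invs n \<rho>)"
  proof (rule Set.set_eqI, unfold split_paired_all)
    fix j k
    show "(j, k) \<in> invs n (Transposition.transpose i (Suc i) \<circ> \<rho>) \<longleftrightarrow> (j, k) \<in> insert (finv \<rho> i, finv \<rho> (Suc i)) (invs n \<rho>)"
    proof (cases "j = k")
      case True then show ?thesis using lt by (auto simp: invs_def)
    next
      case False
      then have ne: "\<rho> j \<noteq> \<rho> k" using permutes_inj[OF \<rho>] by (auto dest: injD)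
      define a b where "a = finv \<rho> i" and "b = finv \<rho> (Suc i)"
      have e: "\<rho> j = i \<longleftrightarrow> j = a" "\<rho> j = Suc i \<longleftrightarrow> j = b" "\<rho> k = i \<longleftrightarrow> k = a" "\<rho> k = Suc i \<longleftrightarrow> k = b"
        unfolding a_def b_def by (rule inv)+
      have ab: "a < b" "b < n" using lt ltn by (auto simp: a_def b_def)
      have "(j, k) \<in> invs n (Transposition.transpose i (Suc i) \<circ> \<rho>) \<longleftrightarrow>
          j < k \<and> k < n \<and> ((\<rho> k < \<rho> j \<and> \<not> (j = b \<and> k = a)) \<or> (j = a \<and> k = b))"
        unfolding invs_def using key[OF ne] e by simp
      also have "\<dots> \<longleftrightarrow> (j, k) = (a, b) \<or> (j, k) \<in> invs n \<rho>"
        using ab unfolding invs_def by auto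
      finally show ?thesis by (simp add: a_def b_def)
    qed
  qed
qed

lemma word_perm_permutes: "set is \<subseteq> {i. Suc i < n} \<Longrightarrow> word_perm is permutes {..<n}"
proof (induction "is")
  case (Cons i "is")
  then have "Transposition.transpose i (Suc i) permutes {..<n}" by (intro permutes_swap_id) auto
  moreover have "word_perm is permutes {..<n}" using Cons by simp
  ultimately show ?case by (simp only: word_perm_simps permutes_compose)
qed (simp add: permutes_id)

lemma inv_transpose_comp:
  assumes "\<rho> permutes S"
  shows "finv (Transposition.transpose i (Suc i) \<circ> \<rho>) x = finv \<rho> (Transposition.transpose i (Suc i) x)"
  using permutes_bij[OF assms] by (subst o_inv_distrib) (auto simp: )

lemma invs_transpose_down:
  assumes \<rho>: "\<rho> permutes {..<n}" and i: "Suc i < n" and lt: "finv \<rho> (Suc i) < finv \<rho> i"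
  shows "card (invs n \<rho>) = Suc (card (invs n (Transposition.transpose i (Suc i) \<circ> \<rho>)))"
proof -
  let ?\<rho> = "Transposition.transpose i (Suc i) \<circ> \<rho>"
  have p: "?\<rho> permutes {..<n}" using i by (intro permutes_compose[OF \<rho>] permutes_swap_id) auto
  have "finv ?\<rho> i < finv ?\<rho> (Suc i)" using lt by (simp add: inv_transpose_comp[OF \<rho>])
  note up = invs_transpose[OF p i this]
  have "Transposition.transpose i (Suc i) \<circ> ?\<rho> = \<rho>" by (simp add: fun_eq_iff)
  then show ?thesis using arg_cong[OF up(1), of card] card_insert_disjoint[OF finite_invs up(2)] by (simp only:)
qed

lemma inv_neq:
  assumes "\<rho> permutes S" shows "finv \<rho> i < finv \<rho> (Suc i) \<or> finv \<rho> (Suc i) < finv \<rho> i"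
  by (metis assms n_not_Suc_n nat_neq_iff permutes_inverses(1))

text \<open>Bubble sort: while the value \<open>Suc i\<close> stands before \<open>i\<close>, a swap
  removes one inversion. Without such an \<open>i\<close> the inverse permutation is increasing,
  hence the identity.\<close>

lemma exists_word:
  assumes "\<sigma> permutes {..<n}"
  shows "\<exists>is. transp_word n \<sigma> is \<and> length is = card (invs n \<sigma>)"
  using assms
proof (induction "card (invs n \<sigma>)" arbitrary: \<sigma> rule: less_induct)
  case less
  note \<sigma> = less.prems
  show ?case
  proof (cases "\<exists>i. Suc i < n \<and> finv \<sigma> (Suc i) < finv \<sigma> i")
    case True
    then obtain i where i: "Suc i < n" "finv \<sigma> (Suc i) < finv \<sigma> i" by blast
    let ?\<rho> = "Transposition.transpose i (Suc i) \<circ> \<sigma>"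
    have p: "?\<rho> permutes {..<n}" using i by (intro permutes_compose[OF \<sigma>] permutes_swap_id) auto
    from invs_transpose_down[OF \<sigma> i] have c: "card (invs n \<sigma>) = Suc (card (invs n ?\<rho>))" .
    then obtain "is" where "transp_word n ?\<rho> is" "length is = card (invs n ?\<rho>)" using less.hyps[of ?\<rho>] p by auto
    moreover from this have "transp_word n \<sigma> (i # is)"
      using i by (auto simp: transp_word_iff fun_eq_iff) (metis comp_apply transpose_involutory)
    ultimately show ?thesis using c by (intro exI[of _ "i # is"]) auto
  next
    case False
    have "j < n \<Longrightarrow> j \<le> finv \<sigma> j" for j
    proof (induction j)
      case (Suc j)
      then show ?case using False inv_neq[OF \<sigma>, of j] by fastforce
    qed simp
    then have "finv \<sigma> = id" by (intro permutes_natset_ge[OF permutes_inv[OF \<sigma>]]) auto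
    then have "\<sigma> = id" using permutes_inv_inv[OF \<sigma>] by (metis inv_id)
    moreover have "invs n id = {}" by (auto simp: invs_def)
    ultimately show ?thesis by (intro exI[of _ "[]"]) (auto simp: transp_word_iff)
  qed
qed

lemma exists_reduced_expr:
  assumes "\<sigma> permutes {..<n}" shows "\<exists>is. reduced_expr n \<sigma> is"
proof -
  obtain js where "transp_word n \<sigma> js" using exists_word[OF assms] by blast
  from ex_has_least_nat[of "transp_word n \<sigma>", OF this, of length]
  show ?thesis unfolding reduced_expr_def .
qed

text \<open>The scalar that a diagonal braiding picks up along the word \<open>is\<close>. The
  letters are a function of the position, so that a transposition acts by composition.\<close>

fun wcoef :: "('s \<Rightarrow> 's \<Rightarrow> 'k::field) \<Rightarrow> nat list \<Rightarrow> (nat \<Rightarrow> 's) \<Rightarrow> 'k" where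
  "wcoef q [] u = 1"
| "wcoef q (i # is) u = q (u (Suc i)) (u i) * wcoef q is (u \<circ> Transposition.transpose i (Suc i))"

text \<open>Every transposition of a reduced word creates exactly one inversion and contributes the
  factor of that pair. Hence the scalar depends on the permutation only, whatever reduced expression
  \<open>braid_perm\<close> selects.\<close>

lemma wcoef_reduced:
  assumes "reduced_expr n \<sigma> is"
  shows "wcoef q is u = (\<Prod>(j, k)\<in>invs n \<sigma>. q (u (\<sigma> j)) (u (\<sigma> k)))"
  using assms
proof (induction "is" arbitrary: \<sigma> u)
  case Nil
  then show ?case by (auto simp: reduced_expr_def transp_word_iff invs_def intro!: prod.neutral)
next
  case (Cons i "is")
  let ?t = "Transposition.transpose i (Suc i)" and ?\<rho> = "word_perm is"
  have w: "set is \<subseteq> {i. Suc i < n}" "Suc i < n" "\<sigma> = ?t \<circ> ?\<rho>"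
    using Cons.prems by (auto simp: reduced_expr_def transp_word_iff)
  have p: "?\<rho> permutes {..<n}" by (rule word_perm_permutes[OF w(1)])
  have p': "\<sigma> permutes {..<n}" using w by (auto intro!: permutes_compose[OF p] permutes_swap_id)
  have red: "reduced_expr n ?\<rho> is"
    unfolding reduced_expr_def
  proof (intro conjI allI impI)
    show "transp_word n ?\<rho> is" using w by (simp add: transp_word_iff)
    fix js assume "transp_word n ?\<rho> js"
    then have "transp_word n \<sigma> (i # js)" using w by (simp add: transp_word_iff)
    then show "length is \<le> length js" using Cons.prems by (auto simp: reduced_expr_def)
  qed
  \<comment> \<open>Otherwise the transposition would remove an inversion, and sorting \<sigma>
    would give a word shorter than \<open>i # is\<close>.\<close>
  have up: "finv ?\<rho> i < finv ?\<rho> (Suc i)"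
  proof (rule ccontr)
    assume "\<not> ?thesis"
    then have "finv ?\<rho> (Suc i) < finv ?\<rho> i" using inv_neq[OF p, of i] by auto
    from invs_transpose_down[OF p w(2) this] have c: "card (invs n ?\<rho>) = Suc (card (invs n \<sigma>))" by (simp add: w(3))
    obtain js where js: "transp_word n \<sigma> js" "length js = card (invs n \<sigma>)" using exists_word[OF p'] by blast
    obtain ks where ks: "transp_word n ?\<rho> ks" "length ks = card (invs n ?\<rho>)" using exists_word[OF p] by blast
    have "Suc (length is) \<le> length js" using Cons.prems js by (auto simp: reduced_expr_def)
    \<comment> \<open>A word has at least as many letters as its permutation has inversions, since
      one transposition adds at most one.\<close>
    moreover have "card (invs n ?\<rho>) \<le> length is"
      using w(1)
    proof (induction "is")
      case (Cons a "as")
      have p: "word_perm as permutes {..<n}" using Cons.prems by (intro word_perm_permutes) auto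
      have a: "Suc a < n" using Cons.prems by auto
      from inv_neq[OF p, of a] consider "finv (word_perm as) a < finv (word_perm as) (Suc a)" | "finv (word_perm as) (Suc a) < finv (word_perm as) a" by blast
      then show ?case
      proof cases
        case 1
        from invs_transpose[OF p a this] have "card (invs n (word_perm (a # as))) = Suc (card (invs n (word_perm as)))"
          by (metis word_perm_simps(2) card_insert_disjoint finite_invs)
        then show ?thesis using Cons by (simp del: word_perm_simps)
      next
        case 2
        from invs_transpose_down[OF p a this] have "card (invs n (word_perm as)) = Suc (card (invs n (word_perm (a # as))))"
          by (simp only: word_perm_simps)
        then show ?thesis using Cons by (simp del: word_perm_simps)
      qed
    qed (auto simp: invs_def card_eq_0_iff)
    ultimately show False using c js by linarith
  qed
  note inv = invs_transpose[OF p w(2) up]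
  have "wcoef q (i # is) u = q (u (Suc i)) (u i) * (\<Prod>(j, k)\<in>invs n ?\<rho>. q (u (\<sigma> j)) (u (\<sigma> k)))"
    unfolding wcoef.simps Cons.IH[OF red] by (simp only: w(3) comp_apply)
  also have "\<dots> = (\<Prod>(j, k)\<in>insert (finv ?\<rho> i, finv ?\<rho> (Suc i)) (invs n ?\<rho>). q (u (\<sigma> j)) (u (\<sigma> k)))"
    using inv(2) permutes_inverses(1)[OF p] by (simp add: w(3))
  finally show ?case unfolding inv(1)[folded w(3)] .
qed

section \<open>The quantum symmetrizer as a sum over permutations\<close>

text \<open>The inversion product of a permutation given by its list of values. Reading it from the
  head, which is inverted with the smaller values after it, matches the recursion of
  \<open>qword\<close>.\<close>

fun lweight :: "('s \<Rightarrow> 's \<Rightarrow> 'k::field) \<Rightarrow> (nat \<Rightarrow> 's) \<Rightarrow> nat list \<Rightarrow> 'k" where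
  "lweight q u [] = 1"
| "lweight q u (x # xs) = (\<Prod>y\<in>{y \<in> set xs. y < x}. q (u x) (u y)) * lweight q u xs"

lemma lweight_invs:
  assumes "distinct xs"
  shows "lweight q u xs = (\<Prod>(j, k)\<in>invs (length xs) (nth xs). q (u (xs ! j)) (u (xs ! k)))"
  using assms
proof (induction xs)
  case (Cons x xs)
  let ?A = "{k. k < length xs \<and> xs ! k < x}"
  have e: "invs (length (x # xs)) (nth (x # xs)) = (\<lambda>k. (0, Suc k)) ` ?A \<union> (\<lambda>(j, k). (Suc j, Suc k)) ` invs (length xs) (nth xs)"
    (is "?L = ?R")
  proof (rule Set.set_eqI, unfold split_paired_all)
    fix j k
    show "(j, k) \<in> ?L \<longleftrightarrow> (j, k) \<in> ?R"
      by (cases j; cases k) (auto simp: invs_def)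
  qed
  have "(\<Prod>(j, k)\<in>(\<lambda>k. (0, Suc k)) ` ?A. q (u ((x # xs) ! j)) (u ((x # xs) ! k))) = (\<Prod>k\<in>?A. q (u x) (u (xs ! k)))"
    by (subst prod.reindex) (auto simp: inj_on_def)
  also have "\<dots> = (\<Prod>y\<in>{y \<in> set xs. y < x}. q (u x) (u y))"
  proof (rule prod.reindex_bij_betw)
    show "bij_betw (nth xs) ?A {y \<in> set xs. y < x}"
      using Cons.prems by (auto simp: bij_betw_def inj_on_def nth_eq_iff_index_eq in_set_conv_nth)
  qed
  finally have 1: "(\<Prod>(j, k)\<in>(\<lambda>k. (0, Suc k)) ` ?A. q (u ((x # xs) ! j)) (u ((x # xs) ! k))) = \<dots>" .
  have 2: "(\<Prod>(j, k)\<in>(\<lambda>(j, k). (Suc j, Suc k)) ` invs (length xs) (nth xs). q (u ((x # xs) ! j)) (u ((x # xs) ! k))) = lweight q u xs"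
    using Cons by (subst prod.reindex) (auto simp: inj_on_def case_prod_unfold)
  show ?case unfolding e by (subst prod.union_disjoint) (auto simp only: 1 2 lweight.simps, auto)
qed (simp add: invs_def)

text \<open>Repeated letters are kept apart by their positions: \<open>L\<close> lists positions and
  \<open>u\<close> gives their letters. The sum is over the occurrence of \<open>a\<close> that was
  inserted, and the product is over the positions that it has passed.\<close>

lemma qshuf_map:
  fixes L :: "nat list"
  assumes "sorted_wrt (<) L"
  shows "qshuf q a f (map u L) = (\<Sum>x\<in>{x \<in> set L. u x = a}. (\<Prod>y\<in>{y \<in> set L. y < x}. q a (u y)) * f (map u (remove1 x L)))"
  using assms
proof (induction L arbitrary: f)
  case (Cons z L)
  have z: "\<And>y. y \<in> set L \<Longrightarrow> z < y" using Cons.prems by simp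
  have z': "z \<notin> set L" using z[of z] by auto
  have "q a (u z) * qshuf q a (\<lambda>x. f (u z # x)) (map u L)
      = (\<Sum>x\<in>{x \<in> set L. u x = a}. (\<Prod>y\<in>{y \<in> set (z # L). y < x}. q a (u y)) * f (map u (remove1 x (z # L))))"
    unfolding Cons.IH[OF Cons.prems[simplified, THEN conjunct2]] sum_distrib_left
  proof (rule sum.cong[OF refl])
    fix x assume x: "x \<in> {x \<in> set L. u x = a}"
    have "{y \<in> set (z # L). y < x} = insert z {y \<in> set L. y < x}" using x z by auto
    moreover note z'
    ultimately show "q a (u z) * ((\<Prod>y\<in>{y \<in> set L. y < x}. q a (u y)) * f (u z # map u (remove1 x L)))
      = (\<Prod>y\<in>{y \<in> set (z # L). y < x}. q a (u y)) * f (map u (remove1 x (z # L)))"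
      using x z by (auto simp: mult.assoc)
  qed
  moreover have "{x \<in> set (z # L). u x = a} = (if u z = a then insert z else id) {x \<in> set L. u x = a}" by auto
  moreover have "{y \<in> set (z # L). y < z} = {}" using z by force
  then have "(\<Prod>y\<in>{y \<in> set (z # L). y < z}. q a (u y)) = 1" by (simp only: prod.empty)
  ultimately show ?case using z' by auto
qed simp

text \<open>Induction on \<open>v\<close>: the head of \<open>xs\<close> is a position with the
  first letter of \<open>v\<close>, it is inverted with all smaller positions of \<open>A\<close>,
  and the tail permutes the rest.\<close>

lemma sum_permutations_of_set:
  assumes "finite A"
  shows "(\<Sum>xs\<in>permutations_of_set A. if map u xs = v then lweight q u xs else 0)
    = qword q v wsingle (map u (sorted_list_of_set A))"
  using assms
proof (induction v arbitrary: A)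
  case Nil
  show ?case
  proof (cases "A = {}")
    case False
    have "(\<Sum>xs\<in>permutations_of_set A. if map u xs = [] then lweight q u xs else 0) = 0"
      using False by (intro sum.neutral) (auto dest: permutations_of_setD)
    then show ?thesis using False Nil by (simp add: wsingle_def)
  qed (simp add: wsingle_def)
next
  case (Cons a v)
  show ?case
  proof (cases "A = {}")
    case False
    have "(\<Sum>xs\<in>permutations_of_set A. if map u xs = a # v then lweight q u xs else 0)
      = (\<Sum>x\<in>A. \<Sum>xs\<in>(#) x ` permutations_of_set (A - {x}). if map u xs = a # v then lweight q u xs else 0)"
      unfolding permutations_of_set_nonempty[OF False] using Cons.prems
      by (subst sum.UNION_disjoint) auto
    also have "\<dots> = (\<Sum>x\<in>A. \<Sum>xs\<in>permutations_of_set (A - {x}). if u x = a \<and> map u xs = v then lweight q u (x # xs) else 0)"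
      by (subst sum.reindex) auto
    also have "\<dots> = (\<Sum>x\<in>A. if u x = a then (\<Prod>y\<in>{y \<in> A. y < x}. q a (u y)) *
        (\<Sum>xs\<in>permutations_of_set (A - {x}). if map u xs = v then lweight q u xs else 0) else 0)"
    proof (rule sum.cong[OF refl])
      fix x assume "x \<in> A"
      have "{y \<in> set xs. y < x} = {y \<in> A. y < x}" if "xs \<in> permutations_of_set (A - {x})" for xs
        using permutations_of_setD(1)[OF that] by auto
      then show "(\<Sum>xs\<in>permutations_of_set (A - {x}). if u x = a \<and> map u xs = v then lweight q u (x # xs) else 0)
        = (if u x = a then (\<Prod>y\<in>{y \<in> A. y < x}. q a (u y)) *
        (\<Sum>xs\<in>permutations_of_set (A - {x}). if map u xs = v then lweight q u xs else 0) else 0)"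
        by (auto simp: sum_distrib_left intro!: sum.cong)
    qed
    also have "\<dots> = (\<Sum>x\<in>A. if u x = a then (\<Prod>y\<in>{y \<in> A. y < x}. q a (u y)) *
        qword q v wsingle (map u (sorted_list_of_set (A - {x}))) else 0)"
      using Cons by (intro sum.cong) auto
    also have "\<dots> = qshuf q a (qword q v wsingle) (map u (sorted_list_of_set A))"
      using Cons.prems by (subst qshuf_map) (auto simp: sum.inter_filter intro!: sum.cong arg_cong[of _ _ "\<lambda>l. qword q v wsingle (map u l)"] sorted_list_of_set.sorted_key_list_of_set_remove)
    finally show ?thesis by simp
  qed simp
qed

text \<open>Both sides are a matrix entry of the quantum symmetrizer: on the left in the form in
  which its definition delivers it, on the right in the form of quantum shuffles.\<close>

lemma sum_permutes:
  "(\<Sum>\<sigma> | \<sigma> permutes {..<n}. if map (u \<circ> \<sigma>) [0..<n] = v then (\<Prod>(j, k)\<in>invs n \<sigma>. q (u (\<sigma> j)) (u (\<sigma> k))) else 0)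
    = qword q v wsingle (map u [0..<n])"
proof -
  let ?g = "\<lambda>\<sigma>. map \<sigma> [0..<n] :: nat list"
  have inj: "inj_on ?g {\<sigma>. \<sigma> permutes {..<n}}"
  proof (rule inj_onI, clarify)
    fix \<sigma> \<tau> :: "nat \<Rightarrow> nat" assume *: "\<sigma> permutes {..<n}" "\<tau> permutes {..<n}" "map \<sigma> [0..<n] = map \<tau> [0..<n]"
    show "\<sigma> = \<tau>"
    proof
      fix x show "\<sigma> x = \<tau> x" using * by (cases "x < n") (simp_all add: permutes_not_in[of _ "{..<n}"])
    qed
  qed
  have sub: "?g ` {\<sigma>. \<sigma> permutes {..<n}} \<subseteq> permutations_of_set {..<n}"
  proof clarify
    fix \<sigma> :: "nat \<Rightarrow> nat" assume "\<sigma> permutes {..<n}"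
    then have "\<sigma> ` {..<n} = {..<n}" "inj \<sigma>" by (auto simp: permutes_image permutes_inj)
    then show "map \<sigma> [0..<n] \<in> permutations_of_set {..<n}"
      by (intro permutations_of_setI) (auto simp: distinct_map lessThan_atLeast0 intro: inj_on_subset)
  qed
  have bij: "bij_betw ?g {\<sigma>. \<sigma> permutes {..<n}} (permutations_of_set {..<n})"
    unfolding bij_betw_def using inj
  proof
    show "?g ` {\<sigma>. \<sigma> permutes {..<n}} = permutations_of_set {..<n}"
      using sub by (intro card_subset_eq) (auto simp: card_image[OF inj] card_permutations)
  qed
  have "(\<Sum>xs\<in>permutations_of_set {..<n}. if map u xs = v then lweight q u xs else 0)
     = (\<Sum>\<sigma> | \<sigma> permutes {..<n}. if map u (?g \<sigma>) = v then lweight q u (?g \<sigma>) else 0)"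
    by (rule sum.reindex_bij_betw[OF bij, symmetric])
  also have "\<dots> = (\<Sum>\<sigma> | \<sigma> permutes {..<n}. if map (u \<circ> \<sigma>) [0..<n] = v then (\<Prod>(j, k)\<in>invs n \<sigma>. q (u (\<sigma> j)) (u (\<sigma> k))) else 0)"
  proof (rule sum.cong[OF refl])
    fix \<sigma> :: "nat \<Rightarrow> nat" assume "\<sigma> \<in> {\<sigma>. \<sigma> permutes {..<n}}"
    then have "?g \<sigma> \<in> permutations_of_set {..<n}" using sub by blast
    then have "distinct (?g \<sigma>)" by (rule permutations_of_setD)
    moreover have "invs n (nth (?g \<sigma>)) = invs n \<sigma>" by (auto simp: invs_def)
    moreover have "(\<Prod>(j, k)\<in>invs n \<sigma>. q (u (?g \<sigma> ! j)) (u (?g \<sigma> ! k))) = (\<Prod>(j, k)\<in>invs n \<sigma>. q (u (\<sigma> j)) (u (\<sigma> k)))"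
      by (rule prod.cong) (auto simp: invs_def)
    ultimately have "lweight q u (?g \<sigma>) = (\<Prod>(j, k)\<in>invs n \<sigma>. q (u (\<sigma> j)) (u (\<sigma> k)))"
      by (subst lweight_invs) auto
    then show "(if map u (?g \<sigma>) = v then lweight q u (?g \<sigma>) else 0)
      = (if map (u \<circ> \<sigma>) [0..<n] = v then (\<Prod>(j, k)\<in>invs n \<sigma>. q (u (\<sigma> j)) (u (\<sigma> k))) else 0)" by simp
  qed
  finally show ?thesis using sum_permutations_of_set[of "{..<n}" u v q]
    by (simp add: sorted_list_of_set_lessThan_Suc lessThan_atLeast0)
qed

section \<open>Vector spaces, quotients and the tensor algebra\<close>

abbreviation kring :: "'k::field ring" where "kring \<equiv> ring_of_type_algebra"

abbreviation vspace :: "('k::field, 'v, 'm) module_scheme \<Rightarrow> bool" where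
  "vspace M \<equiv> Module.module kring M"

lemma kring_simps [simp]: "carrier kring = UNIV" "x \<otimes>\<^bsub>kring\<^esub> y = x * y" "\<one>\<^bsub>kring\<^esub> = 1"
  "\<zero>\<^bsub>kring\<^esub> = 0" "x \<oplus>\<^bsub>kring\<^esub> y = x + y"
  by (simp_all add: ring_of_type_algebra_def)

lemma vspaceI:
  fixes M (structure)
  assumes "\<And>x y. x \<in> carrier M \<Longrightarrow> y \<in> carrier M \<Longrightarrow> x \<oplus> y \<in> carrier M"
    "\<zero> \<in> carrier M"
    "\<And>x y z. x \<in> carrier M \<Longrightarrow> y \<in> carrier M \<Longrightarrow> z \<in> carrier M \<Longrightarrow> (x \<oplus> y) \<oplus> z = x \<oplus> (y \<oplus> z)"
    "\<And>x y. x \<in> carrier M \<Longrightarrow> y \<in> carrier M \<Longrightarrow> x \<oplus> y = y \<oplus> x"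
    "\<And>x. x \<in> carrier M \<Longrightarrow> \<zero> \<oplus> x = x"
    "\<And>a x. x \<in> carrier M \<Longrightarrow> a \<odot> x \<in> carrier M"
    "\<And>a b x. x \<in> carrier M \<Longrightarrow> (a + b) \<odot> x = a \<odot> x \<oplus> b \<odot> x"
    "\<And>a x y. x \<in> carrier M \<Longrightarrow> y \<in> carrier M \<Longrightarrow> a \<odot> (x \<oplus> y) = a \<odot> x \<oplus> a \<odot> y"
    "\<And>a b x. x \<in> carrier M \<Longrightarrow> (a * b) \<odot> x = a \<odot> (b \<odot> x)"
    "\<And>x. x \<in> carrier M \<Longrightarrow> 1 \<odot> x = x"
    "\<And>x. x \<in> carrier M \<Longrightarrow> 0 \<odot> x = \<zero>"
  shows "vspace M"
proof (rule moduleI)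
  show "abelian_group M"
  proof (rule abelian_groupI)
    fix x assume x: "x \<in> carrier M"
    have "(- 1) \<odot> x \<oplus> 1 \<odot> x = (-1 + 1) \<odot> x" by (rule assms(7)[OF x, symmetric])
    then have "(- 1) \<odot> x \<oplus> x = \<zero>" using assms(10,11)[OF x] by simp
    then show "\<exists>y\<in>carrier M. y \<oplus> x = \<zero>" using assms(6)[OF x] by blast
  qed (use assms in auto)
qed (use assms in \<open>auto intro: cring_from_type_algebra\<close>)

context
  fixes M :: "('k::field, 'v, 'm) module_scheme" (structure)
  assumes M: "vspace M"
begin

interpretation Module.module kring M by (rule M)

lemma vs_closed [simp]: "x \<in> carrier M \<Longrightarrow> y \<in> carrier M \<Longrightarrow> x \<oplus> y \<in> carrier M"
  "\<zero> \<in> carrier M" "x \<in> carrier M \<Longrightarrow> a \<odot> x \<in> carrier M" "x \<in> carrier M \<Longrightarrow> y \<in> carrier M \<Longrightarrow> x \<ominus> y \<in> carrier M"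
  by auto

lemma vs_laws:
  "x \<in> carrier M \<Longrightarrow> (a + b) \<odot> x = a \<odot> x \<oplus> b \<odot> x"
  "x \<in> carrier M \<Longrightarrow> y \<in> carrier M \<Longrightarrow> a \<odot> (x \<oplus> y) = a \<odot> x \<oplus> a \<odot> y"
  "x \<in> carrier M \<Longrightarrow> (a * b) \<odot> x = a \<odot> (b \<odot> x)"
  "x \<in> carrier M \<Longrightarrow> 1 \<odot> x = x"
  "x \<in> carrier M \<Longrightarrow> 0 \<odot> x = \<zero>"
  "a \<odot> \<zero> = \<zero>"
  using smult_l_distr[of a b x] smult_r_distr[of a x y] smult_assoc1[of a b x] smult_one[of x] smult_l_null[of x]
   smult_r_null[of a]
  by auto

lemma vs_minus: "x \<in> carrier M \<Longrightarrow> \<ominus> x = (- 1) \<odot> x"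
proof -
  assume x: "x \<in> carrier M"
  have "(- 1) \<odot> x \<oplus> x = (- 1 + 1) \<odot> x" using x by (simp only: vs_laws)
  then have "(- 1) \<odot> x \<oplus> x = \<zero>" using x by (simp add: vs_laws)
  then show "\<ominus> x = (- 1) \<odot> x" using x M.minus_equality by simp
qed

lemma vs_diff: "x \<in> carrier M \<Longrightarrow> y \<in> carrier M \<Longrightarrow> x \<ominus> y = x \<oplus> (- 1) \<odot> y"
  by (simp add: a_minus_def vs_minus)

lemma submoduleI':
  assumes "N \<subseteq> carrier M" "\<zero> \<in> N" "\<And>x y. x \<in> N \<Longrightarrow> y \<in> N \<Longrightarrow> x \<oplus> y \<in> N" "\<And>a x. x \<in> N \<Longrightarrow> a \<odot> x \<in> N"
  shows "submodule N kring M"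
proof (rule submoduleI)
  fix x assume x: "x \<in> N"
  then have "\<ominus> x = (- 1) \<odot> x" using assms(1) vs_minus by auto
  then show "\<ominus> x \<in> N" using assms(4)[OF x, of "-1"] by simp
qed (use assms in auto)

lemma submoduleD:
  assumes "submodule N kring M"
  shows "N \<subseteq> carrier M" "\<zero> \<in> N" "x \<in> N \<Longrightarrow> y \<in> N \<Longrightarrow> x \<oplus> y \<in> N" "x \<in> N \<Longrightarrow> a \<odot> x \<in> N"
  using submoduleE[OF assms] subgroup.one_closed[OF submodule.axioms(1)[OF assms]] by auto

lemma lin_span_submodule:
  assumes "S \<subseteq> carrier M" shows "submodule (lin_span M S) kring M"
proof (rule submoduleI')
  have "carrier M \<in> {N. submodule N kring M \<and> S \<subseteq> N}" using assms carrier_is_submodule by auto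
  then show "lin_span M S \<subseteq> carrier M" unfolding lin_span_def by blast
qed (auto simp: lin_span_def dest: submoduleD)

lemma lin_span_superset: "S \<subseteq> lin_span M S"
  by (auto simp: lin_span_def)

lemma lin_span_minimal: "submodule N kring M \<Longrightarrow> S \<subseteq> N \<Longrightarrow> lin_span M S \<subseteq> N"
  by (auto simp: lin_span_def)

lemma lin_span_induct [consumes 1, case_names carrier base zero add smult]:
  assumes "x \<in> lin_span M S" "S \<subseteq> carrier M"
    "\<And>x. x \<in> S \<Longrightarrow> P x" "P \<zero>"
    "\<And>x y. x \<in> carrier M \<Longrightarrow> y \<in> carrier M \<Longrightarrow> P x \<Longrightarrow> P y \<Longrightarrow> P (x \<oplus> y)"
    "\<And>a x. x \<in> carrier M \<Longrightarrow> P x \<Longrightarrow> P (a \<odot> x)"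
  shows "P x"
proof -
  have "submodule {x \<in> carrier M. P x} kring M"
    by (rule submoduleI') (use assms in auto)
  from lin_span_minimal[OF this, of S] show ?thesis using assms by auto
qed

subsection \<open>Quotients\<close>

context
  fixes N assumes N: "submodule N kring M"
begin

lemma N_add: "additive_subgroup N M"
  using submodule.axioms(1)[OF N] by (simp add: additive_subgroup_def)

interpretation abelian_subgroup N M
  using N_add by (intro abelian_subgroupI3) (auto intro: M.abelian_group_axioms)

lemma coset_eq_iff: "x \<in> carrier M \<Longrightarrow> y \<in> carrier M \<Longrightarrow> N +> x = N +> y \<longleftrightarrow> x \<ominus> y \<in> N"
proof -
  assume xy: "x \<in> carrier M" "y \<in> carrier M"
  have "N +> x = N +> y \<longleftrightarrow> x \<in> N +> y"
    using a_repr_independence'[of x y] a_rcos_self[of x] xy by metis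
  also have "\<dots> \<longleftrightarrow> x \<oplus> \<ominus> y \<in> N"
    using a_rcos_module[of y x] xy by simp
  finally show ?thesis by (simp add: a_minus_def)
qed

lemma coset_memD: "x \<in> N +> y \<Longrightarrow> y \<in> carrier M \<Longrightarrow> x \<in> carrier M \<and> N +> x = N +> y"
  using a_repr_independence'[of x y] a_elemrcos_carrier[of y x] by auto

lemma coset_self: "x \<in> carrier M \<Longrightarrow> x \<in> N +> x"
  by (rule a_rcos_self)

lemma quot_carrier: "carrier (quot_module M N) = (\<lambda>x. N +> x) ` carrier M"
  by (auto simp: quot_module_def A_RCOSETS_def')

lemma quot_add: "x \<in> carrier M \<Longrightarrow> y \<in> carrier M \<Longrightarrow> (N +> x) \<oplus>\<^bsub>quot_module M N\<^esub> (N +> y) = N +> (x \<oplus> y)"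
  by (simp add: quot_module_def a_rcos_sum)

lemma quot_zero: "\<zero>\<^bsub>quot_module M N\<^esub> = N +> \<zero>"
  using a_coset_add_zero[of N] submoduleD(1)[OF N] by (simp add: quot_module_def)

text \<open>\<open>quot_module\<close> multiplies a coset by a union over its elements; the union
  collapses because all of them give the same coset.\<close>

lemma quot_smult: "x \<in> carrier M \<Longrightarrow> a \<odot>\<^bsub>quot_module M N\<^esub> (N +> x) = N +> (a \<odot> x)"
proof -
  assume x: "x \<in> carrier M"
  have "N +> a \<odot> y = N +> a \<odot> x" if "y \<in> N +> x" for y
  proof -
    have y: "y \<in> carrier M" and "y \<ominus> x \<in> N" using coset_memD[OF that x] x coset_eq_iff[of y x] by auto
    then have "a \<odot> (y \<ominus> x) \<in> N" using submoduleD(4)[OF N] by blast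
    also have "a \<odot> (y \<ominus> x) = a \<odot> y \<ominus> a \<odot> x"
    proof -
      have "a \<odot> ((- 1) \<odot> x) = (- 1) \<odot> (a \<odot> x)" using x by (simp add: vs_laws(3)[symmetric])
      then show ?thesis using x y by (simp add: vs_diff vs_laws(2))
    qed
    finally show ?thesis using x y by (intro coset_eq_iff[THEN iffD2]) simp_all
  qed
  then have "(\<Union>y\<in>N +> x. N +> a \<odot> y) = (\<Union>y\<in>N +> x. N +> a \<odot> x)" by (rule SUP_cong[OF refl])
  also have "\<dots> = N +> a \<odot> x" using coset_self[OF x] by blast
  finally show ?thesis by (simp add: quot_module_def)
qed

lemma quot_vspace: "vspace (quot_module M N)"
proof (rule vspaceI)
  fix C D assume "C \<in> carrier (quot_module M N)" "D \<in> carrier (quot_module M N)"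
  then obtain x y where "x \<in> carrier M" "y \<in> carrier M" "C = N +> x" "D = N +> y" by (auto simp: quot_carrier)
  then show "C \<oplus>\<^bsub>quot_module M N\<^esub> D = D \<oplus>\<^bsub>quot_module M N\<^esub> C"
    using M.a_comm[of x y] by (simp only: quot_add)
qed (auto simp: quot_carrier quot_add quot_zero quot_smult vs_laws M.a_assoc)

end

end

subsection \<open>Free modules\<close>

lemma free_module_simps [simp]:
  "f \<in> carrier (free_module S) \<longleftrightarrow> finite {x. f x \<noteq> 0} \<and> {x. f x \<noteq> 0} \<subseteq> S"
  "\<zero>\<^bsub>free_module S\<^esub> = (\<lambda>x. 0)"
  "f \<oplus>\<^bsub>free_module S\<^esub> h = (\<lambda>x. f x + h x)"
  "a \<odot>\<^bsub>free_module S\<^esub> f = (\<lambda>x. a * f x)"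
  by (simp_all add: free_module_def)

lemma supp_add: "finite {x. f x \<noteq> (0::'k::field)} \<Longrightarrow> finite {x. h x \<noteq> 0} \<Longrightarrow> finite {x. f x + h x \<noteq> 0}"
  by (rule finite_subset[of _ "{x. f x \<noteq> 0} \<union> {x. h x \<noteq> 0}"]) auto

lemma free_module_vspace: "vspace (free_module S)"
  by (rule vspaceI) (auto simp: fun_eq_iff algebra_simps subset_iff intro: supp_add, metis add_0)

lemma single_carrier [simp]: "single s \<in> carrier (free_module S) \<longleftrightarrow> s \<in> S"
  by (simp add: single_def)

lemma single_apply: "single s x = (if x = s then 1 else 0)"
  by (simp add: single_def)

lemma free_module_induct [consumes 1, case_names zero add]:
  assumes "f \<in> carrier (free_module S)" "P (\<lambda>x. 0)"
    "\<And>f s a. f \<in> carrier (free_module S) \<Longrightarrow> s \<in> S \<Longrightarrow> P f \<Longrightarrow> P (\<lambda>x. f x + a * single s x)"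
  shows "P f"
proof -
  have "finite A \<Longrightarrow> A \<subseteq> S \<Longrightarrow> {x. f x \<noteq> 0} \<subseteq> A \<Longrightarrow> P f" for A f
  proof (induction A arbitrary: f rule: finite_induct)
    case empty
    then have "f = (\<lambda>x. 0)" by auto
    then show ?case using assms(2) by simp
  next
    case (insert s A)
    let ?g = "\<lambda>x. if x = s then 0 else f x"
    have "{x. ?g x \<noteq> 0} \<subseteq> A" using insert.prems by auto
    moreover from this have "?g \<in> carrier (free_module S)" using insert by (auto intro: finite_subset)
    ultimately have "P (\<lambda>x. ?g x + f s * single s x)" using insert by (intro assms(3)) auto
    moreover have "(\<lambda>x. ?g x + f s * single s x) = f" by (auto simp: single_apply)
    ultimately show ?case by simp
  qed
  from this[of "{x. f x \<noteq> 0}" f] show ?thesis using assms(1) by auto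
qed

subsection \<open>Linear extension\<close>

definition lext :: "('k::field, 'w, 'n) module_scheme \<Rightarrow> ('s \<Rightarrow> 'w) \<Rightarrow> ('s \<Rightarrow> 'k) \<Rightarrow> 'w" where
  "lext W F f = finsum W (\<lambda>l. f l \<odot>\<^bsub>W\<^esub> F l) {l. f l \<noteq> 0}"

context
  fixes W :: "('k::field, 'w, 'n) module_scheme" (structure) and S :: "'s set" and F
  assumes W: "vspace W" and F: "\<And>s. s \<in> S \<Longrightarrow> F s \<in> carrier W"
begin

interpretation W: Module.module kring W by (rule W)

lemma lext_superset:
  assumes "finite A" "{l. f l \<noteq> 0} \<subseteq> A" "A \<subseteq> S"
  shows "lext W F f = finsum W (\<lambda>l. f l \<odot>\<^bsub>W\<^esub> F l) A"
  unfolding lext_def using assms F W vs_laws(5)[OF W] by (intro W.M.add.finprod_mono_neutral_cong_left) auto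

lemma lext_closed: "f \<in> carrier (free_module S) \<Longrightarrow> lext W F f \<in> carrier W"
  unfolding lext_def using F by (intro W.M.finsum_closed) (auto simp: subset_iff)

lemma lext_add:
  assumes "f \<in> carrier (free_module S)" "h \<in> carrier (free_module S)"
  shows "lext W F (\<lambda>x. f x + h x) = lext W F f \<oplus> lext W F h"
proof -
  let ?A = "{l. f l \<noteq> 0} \<union> {l. h l \<noteq> 0}"
  have A: "finite ?A" "?A \<subseteq> S" using assms by auto
  show ?thesis using A F vs_laws(1)[OF W]
    by (subst (1 2 3) lext_superset[of ?A]) (auto simp flip: W.M.finsum_addf intro!: W.M.finsum_cong' simp: subset_iff)
qed

lemma lext_smult:
  assumes "f \<in> carrier (free_module S)"
  shows "lext W F (\<lambda>x. a * f x) = a \<odot> lext W F f"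
proof -
  let ?A = "{l. f l \<noteq> 0}"
  have A: "finite ?A" "?A \<subseteq> S" using assms by auto
  have "a \<odot> finsum W (\<lambda>l. f l \<odot>\<^bsub>W\<^esub> F l) ?A = finsum W (\<lambda>l. a \<odot> (f l \<odot>\<^bsub>W\<^esub> F l)) ?A"
    using A F by (intro W.finsum_smult_ldistr) (auto simp: subset_iff)
  also have "\<dots> = finsum W (\<lambda>l. (a * f l) \<odot>\<^bsub>W\<^esub> F l) ?A"
    using A F vs_laws(3)[OF W] by (intro W.M.finsum_cong') (auto simp: subset_iff)
  finally show ?thesis using A F
    by (subst (1 2) lext_superset[of ?A]) auto
qed

lemma lext_single: "s \<in> S \<Longrightarrow> lext W F (single s) = F s"
  using F vs_laws(4)[OF W] by (subst lext_superset[of "{s}"]) (auto simp: single_apply)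

end

lemma lext_zero:
  assumes "vspace W" shows "lext W F (\<lambda>x. 0) = \<zero>\<^bsub>W\<^esub>"
proof -
  interpret Module.module kring W by (rule assms)
  show ?thesis by (simp add: lext_def)
qed

subsection \<open>The free algebra\<close>

lemma free_alg_simps [simp]:
  "carrier (free_alg S) = carrier (free_module (lists S))"
  "\<zero>\<^bsub>free_alg S\<^esub> = (\<lambda>x. 0)"
  "f \<oplus>\<^bsub>free_alg S\<^esub> h = (\<lambda>x. f x + h x)"
  "a \<odot>\<^bsub>free_alg S\<^esub> f = (\<lambda>x. a * f x)"
  "f \<otimes>\<^bsub>free_alg S\<^esub> h = (\<lambda>l. \<Sum>i\<le>length l. f (take i l) * h (drop i l))"
  "\<one>\<^bsub>free_alg S\<^esub> = single []"
  by (simp_all add: free_alg_def free_module_def)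

lemma free_alg_vspace:
  fixes S :: "'s set"
  shows "vspace (free_alg S :: ('k::field, 's list \<Rightarrow> 'k) module)"
proof (rule vspaceI)
  note v = free_module_vspace[of "lists S"]
  show "(\<zero>\<^bsub>free_alg S\<^esub> :: 's list \<Rightarrow> 'k) \<in> carrier (free_alg S)" by simp
  fix f h :: "'s list \<Rightarrow> 'k" assume fh: "f \<in> carrier (free_alg S)"
  show "a \<odot>\<^bsub>free_alg S\<^esub> f \<in> carrier (free_alg S)" for a
    using vs_closed(3)[OF v, of f a] fh unfolding free_alg_simps free_module_simps(4) by blast
  assume "h \<in> carrier (free_alg S)"
  then show "f \<oplus>\<^bsub>free_alg S\<^esub> h \<in> carrier (free_alg S)"
    using vs_closed(1)[OF v, of f h] fh unfolding free_alg_simps free_module_simps(3) by blast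
qed (auto simp: fun_eq_iff algebra_simps)

lemma free_alg_ring:
  fixes S :: "'s set"
  shows "ring (free_alg S :: ('k::field, 's list \<Rightarrow> 'k) module)"
proof (rule ringI)
  let ?F = "free_alg S :: ('k, 's list \<Rightarrow> 'k) module"
  interpret Module.module kring ?F by (rule free_alg_vspace)
  show "abelian_group ?F" by (rule M.abelian_group_axioms)
  show "Group.monoid ?F"
  proof (rule monoidI)
    fix f h k :: "'s list \<Rightarrow> 'k"
    assume f: "f \<in> carrier (free_alg S)" and h: "h \<in> carrier (free_alg S)"
    have "{l. (\<Sum>i\<le>length l. f (take i l) * h (drop i l)) \<noteq> 0} \<subseteq> (\<lambda>(a, b). a @ b) ` ({l. f l \<noteq> 0} \<times> {l. h l \<noteq> 0})"
    proof clarify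
      fix l assume "(\<Sum>i\<le>length l. f (take i l) * h (drop i l)) \<noteq> 0"
      then obtain i where "f (take i l) * h (drop i l) \<noteq> 0" by (meson sum.not_neutral_contains_not_neutral)
      then show "l \<in> (\<lambda>(a, b). a @ b) ` ({l. f l \<noteq> 0} \<times> {l. h l \<noteq> 0})"
        by (intro image_eqI[of _ _ "(take i l, drop i l)"]) auto
    qed
    moreover have "finite ((\<lambda>(a, b). a @ b) ` ({l. f l \<noteq> 0} \<times> {l. h l \<noteq> 0}))" using f h by simp
    moreover have "(\<lambda>(a, b). a @ b) ` ({l. f l \<noteq> 0} \<times> {l. h l \<noteq> 0}) \<subseteq> lists S"
    proof (rule image_subsetI)
      fix x assume "x \<in> {l. f l \<noteq> 0} \<times> {l. h l \<noteq> 0}"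
      then have "fst x \<in> lists S" "snd x \<in> lists S" using f h by auto
      then show "(case x of (a, b) \<Rightarrow> a @ b) \<in> lists S" by (simp add: case_prod_unfold)
    qed
    ultimately show "f \<otimes>\<^bsub>free_alg S\<^esub> h \<in> carrier (free_alg S)"
      unfolding free_alg_simps free_module_simps using finite_subset subset_trans by (intro conjI)
    show "\<one>\<^bsub>free_alg S\<^esub> \<otimes>\<^bsub>free_alg S\<^esub> f = f"
    proof
      fix l
      have "(\<Sum>i\<le>length l. single [] (take i l) * f (drop i l)) = (\<Sum>i\<in>{0}. single [] (take i l) * f (drop i l))"
        by (rule sum.mono_neutral_right) (auto simp: single_apply)
      then show "(\<one>\<^bsub>free_alg S\<^esub> \<otimes>\<^bsub>free_alg S\<^esub> f) l = f l" by (simp add: single_apply)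
    qed
    show "f \<otimes>\<^bsub>free_alg S\<^esub> \<one>\<^bsub>free_alg S\<^esub> = f"
    proof
      fix l
      have "(\<Sum>i\<le>length l. f (take i l) * single [] (drop i l)) = (\<Sum>i\<in>{length l}. f (take i l) * single [] (drop i l))"
        by (rule sum.mono_neutral_right) (auto simp: single_apply)
      then show "(f \<otimes>\<^bsub>free_alg S\<^esub> \<one>\<^bsub>free_alg S\<^esub>) l = f l" by (simp add: single_apply)
    qed
    show "(f \<otimes>\<^bsub>free_alg S\<^esub> h) \<otimes>\<^bsub>free_alg S\<^esub> k = f \<otimes>\<^bsub>free_alg S\<^esub> (h \<otimes>\<^bsub>free_alg S\<^esub> k)"
    proof
      fix l :: "'s list"
      let ?n = "length l"
      have "((f \<otimes>\<^bsub>free_alg S\<^esub> h) \<otimes>\<^bsub>free_alg S\<^esub> k) l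
        = (\<Sum>j\<le>?n. \<Sum>i\<le>j. f (take i l) * h (drop i (take j l)) * k (drop j l))"
        unfolding free_alg_simps by (intro sum.cong refl) (simp add: sum_distrib_right min_absorb1 min_absorb2)
      also have "\<dots> = (\<Sum>(j, i)\<in>(SIGMA j:{..?n}. {..j}). f (take i l) * h (drop i (take j l)) * k (drop j l))"
        by (rule sum.Sigma) auto
      \<comment> \<open>Two cuts of \<open>l\<close> at \<open>i \<le> j\<close> are described by
        the lengths \<open>i\<close> and \<open>m = j - i\<close> of the first two pieces.\<close>
      also have "\<dots> = (\<Sum>(i, m)\<in>(SIGMA i:{..?n}. {..?n - i}). f (take i l) * (h (take m (drop i l)) * k (drop m (drop i l))))"
        by (rule sum.reindex_bij_witness[of _ "\<lambda>(i, m). (i + m, i)" "\<lambda>(j, i). (i, j - i)"])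
          (auto simp: drop_take mult.assoc)
      also have "\<dots> = (\<Sum>i\<le>?n. \<Sum>m\<le>?n - i. f (take i l) * (h (take m (drop i l)) * k (drop m (drop i l))))"
        by (rule sum.Sigma[symmetric]) auto
      also have "\<dots> = (f \<otimes>\<^bsub>free_alg S\<^esub> (h \<otimes>\<^bsub>free_alg S\<^esub> k)) l"
        by (simp add: sum_distrib_left)
      finally show "((f \<otimes>\<^bsub>free_alg S\<^esub> h) \<otimes>\<^bsub>free_alg S\<^esub> k) l = (f \<otimes>\<^bsub>free_alg S\<^esub> (h \<otimes>\<^bsub>free_alg S\<^esub> k)) l" .
    qed
  qed (simp add: single_def)
  fix f h k :: "'s list \<Rightarrow> 'k"
  show "(f \<oplus>\<^bsub>?F\<^esub> h) \<otimes>\<^bsub>?F\<^esub> k = f \<otimes>\<^bsub>?F\<^esub> k \<oplus>\<^bsub>?F\<^esub> h \<otimes>\<^bsub>?F\<^esub> k"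
    unfolding free_alg_simps by (simp only: distrib_right sum.distrib)
  show "k \<otimes>\<^bsub>?F\<^esub> (f \<oplus>\<^bsub>?F\<^esub> h) = k \<otimes>\<^bsub>?F\<^esub> f \<oplus>\<^bsub>?F\<^esub> k \<otimes>\<^bsub>?F\<^esub> h"
    unfolding free_alg_simps by (simp only: distrib_left sum.distrib)
qed

lemma single_mult: "single l \<otimes>\<^bsub>free_alg S\<^esub> single l' = single (l @ l')"
proof
  fix x
  have *: "single l (take i x) * single l' (drop i x) = (if i = length l \<and> x = l @ l' then 1 else 0 :: 'b::field)" if "i \<le> length x" for i
  proof -
    have "take i x = l \<and> drop i x = l' \<longleftrightarrow> i = length l \<and> x = l @ l'"
      using that by (metis append_eq_conv_conj append_take_drop_id length_take min.absorb2)
    then show ?thesis by (auto simp: single_apply)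
  qed
  have "(\<Sum>i\<le>length x. single l (take i x) * single l' (drop i x)) = (\<Sum>i\<le>length x. if i = length l \<and> x = l @ l' then 1 else 0 :: 'b)"
    by (rule sum.cong) (use * in auto)
  also have "\<dots> = single (l @ l') x" by (cases "x = l @ l'") (auto simp: single_apply)
  finally show "(single l \<otimes>\<^bsub>free_alg S\<^esub> single l') x = (single (l @ l') x :: 'b)" by simp
qed

lemma free_alg_smult_mult:
  "(a \<odot>\<^bsub>free_alg S\<^esub> f) \<otimes>\<^bsub>free_alg S\<^esub> h = a \<odot>\<^bsub>free_alg S\<^esub> (f \<otimes>\<^bsub>free_alg S\<^esub> h)"
  "f \<otimes>\<^bsub>free_alg S\<^esub> (a \<odot>\<^bsub>free_alg S\<^esub> h) = a \<odot>\<^bsub>free_alg S\<^esub> (f \<otimes>\<^bsub>free_alg S\<^esub> h)"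
  unfolding free_alg_simps by (simp_all only: sum_distrib_left mult.assoc mult.left_commute[of _ a])

subsection \<open>The tensor algebra\<close>

definition multilinear :: "('k::field, 'v, 'm) module_scheme \<Rightarrow> ('k, 'w, 'n) module_scheme \<Rightarrow> ('v list \<Rightarrow> 'w) \<Rightarrow> bool" where
  "multilinear V W F \<longleftrightarrow> (\<forall>l\<in>lists (carrier V). F l \<in> carrier W) \<and>
    (\<forall>l1\<in>lists (carrier V). \<forall>l2\<in>lists (carrier V). \<forall>v\<in>carrier V.
      (\<forall>w\<in>carrier V. F (l1 @ (v \<oplus>\<^bsub>V\<^esub> w) # l2) = F (l1 @ v # l2) \<oplus>\<^bsub>W\<^esub> F (l1 @ w # l2)) \<and>
      (\<forall>a. F (l1 @ (a \<odot>\<^bsub>V\<^esub> v) # l2) = a \<odot>\<^bsub>W\<^esub> F (l1 @ v # l2)))"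

lemma multilinearI:
  assumes "\<And>l. l \<in> lists (carrier V) \<Longrightarrow> F l \<in> carrier W"
    "\<And>l1 l2 v w. l1 \<in> lists (carrier V) \<Longrightarrow> l2 \<in> lists (carrier V) \<Longrightarrow> v \<in> carrier V \<Longrightarrow> w \<in> carrier V \<Longrightarrow>
      F (l1 @ (v \<oplus>\<^bsub>V\<^esub> w) # l2) = F (l1 @ v # l2) \<oplus>\<^bsub>W\<^esub> F (l1 @ w # l2)"
    "\<And>l1 l2 v a. l1 \<in> lists (carrier V) \<Longrightarrow> l2 \<in> lists (carrier V) \<Longrightarrow> v \<in> carrier V \<Longrightarrow>
      F (l1 @ (a \<odot>\<^bsub>V\<^esub> v) # l2) = a \<odot>\<^bsub>W\<^esub> F (l1 @ v # l2)"
  shows "multilinear V W F"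
  unfolding multilinear_def by (intro conjI ballI allI) (erule (3) assms | erule (2) assms | erule assms)+

text \<open>This is \<open>tensor_lift\<close> with an arbitrary target. With target
  \<open>kspace\<close> it yields linear functionals on the tensor algebra, the main tool for
  detecting non-zero tensors.\<close>

definition tlift :: "('k::field, 'v, 'm) module_scheme \<Rightarrow> ('k, 'w, 'n) module_scheme \<Rightarrow> ('v list \<Rightarrow> 'w) \<Rightarrow> ('v list \<Rightarrow> 'k) set \<Rightarrow> 'w" where
  "tlift V W F C = the_elem (lext W F ` C)"

lemma tensor_lift_eq: "tensor_lift V F = tlift V (tensor_alg V) F"
  unfolding tensor_lift_def tlift_def lext_def by (rule refl)

context
  fixes V :: "('k::field, 'v, 'm) module_scheme"
  assumes V: "vspace V"
begin

abbreviation "FA \<equiv> free_alg (carrier V) :: ('k, 'v list \<Rightarrow> 'k) module"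
abbreviation "TI \<equiv> tensor_alg_ideal V"
abbreviation "TA \<equiv> tensor_alg V"

interpretation FA: ring FA by (rule free_alg_ring)
interpretation FM: Module.module kring FA by (rule free_alg_vspace)
interpretation V: Module.module kring V by (rule V)

definition tgens :: "('v list \<Rightarrow> 'k) set" where
  "tgens = {single [v \<oplus>\<^bsub>V\<^esub> w] \<ominus>\<^bsub>FA\<^esub> (single [v] \<oplus>\<^bsub>FA\<^esub> single [w]) | v w. v \<in> carrier V \<and> w \<in> carrier V} \<union>
        {single [r \<odot>\<^bsub>V\<^esub> v] \<ominus>\<^bsub>FA\<^esub> r \<odot>\<^bsub>FA\<^esub> single [v] | r v. v \<in> carrier V}"

lemma tensor_alg_ideal_eq: "TI = Idl\<^bsub>FA\<^esub> tgens"
  by (simp add: tensor_alg_ideal_def tgens_def Let_def)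

lemma FA_single [simp]: "single l \<in> carrier FA \<longleftrightarrow> l \<in> lists (carrier V)"
  using single_carrier[of l "lists (carrier V)"] by (simp only: free_alg_simps)

lemma tgens_carrier: "tgens \<subseteq> carrier FA"
proof -
  have "single [v] \<in> carrier FA" if "v \<in> carrier V" for v using that by (simp del: free_alg_simps)
  then show ?thesis unfolding tgens_def
    by (auto simp del: free_alg_simps intro!: FA.minus_closed FA.a_closed vs_closed(3)[OF free_alg_vspace])
qed

lemma TI_ideal: "ideal TI FA"
  unfolding tensor_alg_ideal_eq by (rule FA.genideal_ideal[OF tgens_carrier])

text \<open>An ideal of the free algebra absorbs scalars, because a scalar multiple is a product
  with a multiple of the unit.\<close>

lemma TI_submodule: "submodule TI kring FA"
proof -
  interpret ideal TI FA by (rule TI_ideal)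
  show ?thesis
  proof (rule submoduleI'[OF free_alg_vspace])
    show "TI \<subseteq> carrier FA" by (rule a_subset)
    show "\<zero>\<^bsub>FA\<^esub> \<in> TI" by (rule zero_closed)
    fix x y assume x: "x \<in> TI"
    show "y \<in> TI \<Longrightarrow> x \<oplus>\<^bsub>FA\<^esub> y \<in> TI" by (rule a_closed[OF x])
    fix a :: 'k
    have xc: "x \<in> carrier FA" using x a_subset by blast
    have "a \<odot>\<^bsub>FA\<^esub> x = a \<odot>\<^bsub>FA\<^esub> (\<one>\<^bsub>FA\<^esub> \<otimes>\<^bsub>FA\<^esub> x)" using FA.l_one[OF xc] by simp
    also have "\<dots> = (a \<odot>\<^bsub>FA\<^esub> \<one>\<^bsub>FA\<^esub>) \<otimes>\<^bsub>FA\<^esub> x" by (rule free_alg_smult_mult(1)[symmetric])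
    also have "\<dots> \<in> TI" by (rule I_l_closed[OF x vs_closed(3)[OF free_alg_vspace FA.one_closed]])
    finally show "a \<odot>\<^bsub>FA\<^esub> x \<in> TI" .
  qed
qed

lemma TA_vspace: "vspace TA"
  unfolding tensor_alg_def by (rule quot_vspace[OF free_alg_vspace TI_submodule])

interpretation T: Module.module kring TA by (rule TA_vspace)

lemmas TA_carrier = quot_carrier[OF free_alg_vspace TI_submodule, folded tensor_alg_def]
lemmas TA_add = quot_add[OF free_alg_vspace TI_submodule, folded tensor_alg_def]
lemmas TA_smult = quot_smult[OF free_alg_vspace TI_submodule, folded tensor_alg_def]
lemmas TA_zero = quot_zero[OF free_alg_vspace TI_submodule, folded tensor_alg_def]
lemmas TA_eq_iff = coset_eq_iff[OF free_alg_vspace TI_submodule]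

lemma TA_mult:
  assumes "f \<in> carrier FA" "h \<in> carrier FA"
  shows "(TI +>\<^bsub>FA\<^esub> f) \<otimes>\<^bsub>TA\<^esub> (TI +>\<^bsub>FA\<^esub> h) = TI +>\<^bsub>FA\<^esub> (f \<otimes>\<^bsub>FA\<^esub> h)"
  using ideal.rcoset_mult_add[OF TI_ideal assms] by (simp add: tensor_alg_def quot_module_def)

lemma TA_one: "\<one>\<^bsub>TA\<^esub> = TI +>\<^bsub>FA\<^esub> \<one>\<^bsub>FA\<^esub>"
  by (simp add: tensor_alg_def quot_module_def)

lemma TA_ring: "ring TA"
proof (rule ringI)
  show "abelian_group TA" ..
  note [simp del] = free_alg_simps
  show "Group.monoid TA"
    by (rule monoidI) (auto simp: TA_carrier TA_mult TA_one FA.m_assoc)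
  show "(x \<oplus>\<^bsub>TA\<^esub> y) \<otimes>\<^bsub>TA\<^esub> z = x \<otimes>\<^bsub>TA\<^esub> z \<oplus>\<^bsub>TA\<^esub> y \<otimes>\<^bsub>TA\<^esub> z"
    "z \<otimes>\<^bsub>TA\<^esub> (x \<oplus>\<^bsub>TA\<^esub> y) = z \<otimes>\<^bsub>TA\<^esub> x \<oplus>\<^bsub>TA\<^esub> z \<otimes>\<^bsub>TA\<^esub> y"
    if "x \<in> carrier TA" "y \<in> carrier TA" "z \<in> carrier TA" for x y z
    using that by (auto simp: TA_carrier TA_mult TA_add FA.l_distr FA.r_distr)
qed

interpretation TR: ring TA by (rule TA_ring)

lemma TA_smult_mult:
  assumes "x \<in> carrier TA" "y \<in> carrier TA"
  shows "(a \<odot>\<^bsub>TA\<^esub> x) \<otimes>\<^bsub>TA\<^esub> y = a \<odot>\<^bsub>TA\<^esub> (x \<otimes>\<^bsub>TA\<^esub> y)"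
    "x \<otimes>\<^bsub>TA\<^esub> (a \<odot>\<^bsub>TA\<^esub> y) = a \<odot>\<^bsub>TA\<^esub> (x \<otimes>\<^bsub>TA\<^esub> y)"
  using assms vs_closed(3)[OF free_alg_vspace[of "carrier V"]]
  by (auto simp: TA_carrier TA_mult TA_smult free_alg_smult_mult simp del: free_alg_simps)

lemma pure_tensor_closed [simp]: "l \<in> lists (carrier V) \<Longrightarrow> pure_tensor V l \<in> carrier TA"
  unfolding pure_tensor_def TA_carrier by (intro imageI) (simp del: free_alg_simps)

lemma pure_tensor_mult:
  assumes "l \<in> lists (carrier V)" "l' \<in> lists (carrier V)"
  shows "pure_tensor V l \<otimes>\<^bsub>TA\<^esub> pure_tensor V l' = pure_tensor V (l @ l')"
  using assms unfolding pure_tensor_def by (subst TA_mult) (simp_all add: single_mult del: free_alg_simps)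

lemma pure_tensor_single_linear:
  assumes "v \<in> carrier V"
  shows "w \<in> carrier V \<Longrightarrow> pure_tensor V [v \<oplus>\<^bsub>V\<^esub> w] = pure_tensor V [v] \<oplus>\<^bsub>TA\<^esub> pure_tensor V [w]"
    "pure_tensor V [a \<odot>\<^bsub>V\<^esub> v] = a \<odot>\<^bsub>TA\<^esub> pure_tensor V [v]"
proof -
  note [simp del] = free_alg_simps
  have s: "single [u] \<in> carrier FA" if "u \<in> carrier V" for u using that by simp
  have av: "a \<odot>\<^bsub>V\<^esub> v \<in> carrier V" by (rule vs_closed(3)[OF V assms])
  have g: "tgens \<subseteq> TI" unfolding tensor_alg_ideal_eq by (rule FA.genideal_self[OF tgens_carrier])
  show "pure_tensor V [v \<oplus>\<^bsub>V\<^esub> w] = pure_tensor V [v] \<oplus>\<^bsub>TA\<^esub> pure_tensor V [w]" if w: "w \<in> carrier V"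
    unfolding pure_tensor_def using s assms w g
    by (subst TA_add) (auto simp: TA_eq_iff tgens_def)
  show "pure_tensor V [a \<odot>\<^bsub>V\<^esub> v] = a \<odot>\<^bsub>TA\<^esub> pure_tensor V [v]"
  proof -
    have "single [a \<odot>\<^bsub>V\<^esub> v] \<ominus>\<^bsub>FA\<^esub> a \<odot>\<^bsub>FA\<^esub> single [v] \<in> tgens"
      using assms unfolding tgens_def by blast
    then have "single [a \<odot>\<^bsub>V\<^esub> v] \<ominus>\<^bsub>FA\<^esub> a \<odot>\<^bsub>FA\<^esub> single [v] \<in> TI" using g by blast
    then show ?thesis unfolding pure_tensor_def TA_smult[OF s[OF assms]]
      by (intro TA_eq_iff[THEN iffD2] s av vs_closed(3)[OF free_alg_vspace] assms)
  qed
qed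

lemma pure_tensor_multilinear: "multilinear V TA (pure_tensor V)"
proof (rule multilinearI)
  fix l1 l2 v assume l: "l1 \<in> lists (carrier V)" "l2 \<in> lists (carrier V)" "v \<in> carrier V"
  have split: "pure_tensor V (l1 @ u # l2) = pure_tensor V l1 \<otimes>\<^bsub>TA\<^esub> (pure_tensor V [u] \<otimes>\<^bsub>TA\<^esub> pure_tensor V l2)"
    if "u \<in> carrier V" for u using that l by (simp add: pure_tensor_mult)
  have p: "pure_tensor V [u] \<in> carrier TA" if "u \<in> carrier V" for u using that by simp
  show "pure_tensor V (l1 @ (a \<odot>\<^bsub>V\<^esub> v) # l2) = a \<odot>\<^bsub>TA\<^esub> pure_tensor V (l1 @ v # l2)" for a
    using l p by (simp add: split pure_tensor_single_linear TA_smult_mult)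
  fix w assume w: "w \<in> carrier V"
  show "pure_tensor V (l1 @ (v \<oplus>\<^bsub>V\<^esub> w) # l2) = pure_tensor V (l1 @ v # l2) \<oplus>\<^bsub>TA\<^esub> pure_tensor V (l1 @ w # l2)"
    using l w p by (simp add: split pure_tensor_single_linear TR.l_distr TR.r_distr)
qed simp

lemma TA_induct [consumes 1, case_names pure add smult]:
  assumes "C \<in> carrier TA" "\<And>l. l \<in> lists (carrier V) \<Longrightarrow> P (pure_tensor V l)"
    "\<And>x y. x \<in> carrier TA \<Longrightarrow> y \<in> carrier TA \<Longrightarrow> P x \<Longrightarrow> P y \<Longrightarrow> P (x \<oplus>\<^bsub>TA\<^esub> y)"
    "\<And>a x. x \<in> carrier TA \<Longrightarrow> P x \<Longrightarrow> P (a \<odot>\<^bsub>TA\<^esub> x)"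
  shows "P C"
proof -
  obtain f where f: "f \<in> carrier (free_module (lists (carrier V)))" "C = TI +>\<^bsub>FA\<^esub> f"
    using assms(1) by (auto simp: TA_carrier)
  from f(1) have "P (TI +>\<^bsub>FA\<^esub> f)"
  proof (induction rule: free_module_induct)
    case zero
    have "P (0 \<odot>\<^bsub>TA\<^esub> pure_tensor V [])" by (intro assms) auto
    also have "0 \<odot>\<^bsub>TA\<^esub> pure_tensor V [] = \<zero>\<^bsub>TA\<^esub>" by (intro vs_laws(5)[OF TA_vspace]) auto
    finally show ?case by (simp add: TA_zero)
  next
    case (add f s a)
    have fc: "f \<in> carrier FA" and sc: "single s \<in> carrier FA"
      using add by (simp_all only: free_alg_simps(1) single_carrier)
    have ac: "a \<odot>\<^bsub>FA\<^esub> single s \<in> carrier FA" by (rule vs_closed(3)[OF free_alg_vspace sc])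
    have eq: "(\<lambda>x. f x + a * single s x) = f \<oplus>\<^bsub>FA\<^esub> (a \<odot>\<^bsub>FA\<^esub> single s)" by simp
    have "TI +>\<^bsub>FA\<^esub> (\<lambda>x. f x + a * single s x) = (TI +>\<^bsub>FA\<^esub> f) \<oplus>\<^bsub>TA\<^esub> (a \<odot>\<^bsub>TA\<^esub> pure_tensor V s)"
      unfolding eq pure_tensor_def TA_smult[OF sc] by (rule TA_add[OF fc ac, symmetric])
    moreover have "TI +>\<^bsub>FA\<^esub> f \<in> carrier TA" using fc unfolding TA_carrier by blast
    moreover note p = pure_tensor_closed[OF add(2)]
    ultimately show ?case using add vs_closed(3)[OF TA_vspace p] assms(4)[OF p assms(2)[OF add(2)]] by (simp add: assms(3))
  qed
  then show ?thesis using f by simp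
qed

context
  fixes W :: "('k, 'w, 'n) module_scheme" and F
  assumes W: "vspace W" and F: "multilinear V W F"
begin

interpretation W: Module.module kring W by (rule W)

lemma F_closed: "l \<in> lists (carrier V) \<Longrightarrow> F l \<in> carrier W"
  using F by (auto simp: multilinear_def)

lemma lext_TI:
  assumes "f \<in> TI" shows "lext W F f = \<zero>\<^bsub>W\<^esub>"
proof -
  let ?L = "lists (carrier V)"
  define G where "G l1 l2 = (\<lambda>l. F (l1 @ l @ l2))" for l1 l2
  have G: "G l1 l2 l \<in> carrier W" if "l1 \<in> ?L" "l2 \<in> ?L" "l \<in> ?L" for l1 l2 l
    using that by (simp add: G_def F_closed)
  \<comment> \<open>The lift of \<open>F\<close> alone has no reason to vanish on an ideal; padding by words on both sides
    makes its kernel one.\<close>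
  define J where "J = {f \<in> carrier FA. \<forall>l1\<in>?L. \<forall>l2\<in>?L. lext W (G l1 l2) f = \<zero>\<^bsub>W\<^esub>}"
  have Jadd: "f \<oplus>\<^bsub>FA\<^esub> h \<in> J" if "f \<in> J" "h \<in> J" for f h
  proof -
    have c: "f \<in> carrier FA" "h \<in> carrier FA" using that by (auto simp: J_def)
    then have "lext W (G l1 l2) (f \<oplus>\<^bsub>FA\<^esub> h) = \<zero>\<^bsub>W\<^esub>" if "l1 \<in> ?L" "l2 \<in> ?L" for l1 l2
      using \<open>f \<in> J\<close> \<open>h \<in> J\<close> lext_add[where S = ?L and F = "G l1 l2" and f = f and h = h, OF W G[OF that]] that by (simp add: J_def)
    then show ?thesis using FA.a_closed[OF c] by (simp add: J_def del: free_alg_simps)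
  qed
  have Jsmult: "a \<odot>\<^bsub>FA\<^esub> f \<in> J" if "f \<in> J" for f a
  proof -
    have c: "f \<in> carrier FA" using that by (auto simp: J_def)
    then have "lext W (G l1 l2) (a \<odot>\<^bsub>FA\<^esub> f) = \<zero>\<^bsub>W\<^esub>" if "l1 \<in> ?L" "l2 \<in> ?L" for l1 l2
      using \<open>f \<in> J\<close> lext_smult[where S = ?L and F = "G l1 l2" and f = f and a = a, OF W G[OF that]] that vs_laws(6)[OF W] by (simp add: J_def)
    then show ?thesis using vs_closed(3)[OF free_alg_vspace c] by (simp add: J_def del: free_alg_simps)
  qed
  have J0: "\<zero>\<^bsub>FA\<^esub> \<in> J" using lext_zero[OF W] by (auto simp: J_def)
  have Jsub: "submodule J kring FA"
    by (rule submoduleI'[OF free_alg_vspace]) (use J0 Jadd Jsmult in \<open>auto simp: J_def simp del: free_alg_simps\<close>)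
  \<comment> \<open>Multiplication by a word moves that word into the padding, which makes
    \<open>J\<close> stable under multiplication.\<close>
  have single_l: "lext W (G l1 l2) (single s \<otimes>\<^bsub>FA\<^esub> f) = lext W (G (l1 @ s) l2) f"
    and single_r: "lext W (G l1 l2) (f \<otimes>\<^bsub>FA\<^esub> single s) = lext W (G l1 (s @ l2)) f"
    if l: "l1 \<in> ?L" "l2 \<in> ?L" "s \<in> ?L" and f: "f \<in> carrier (free_module ?L)" for l1 l2 s f
  proof -
    have g: "(\<lambda>x. f x + a * single t x) = f \<oplus>\<^bsub>FA\<^esub> (a \<odot>\<^bsub>FA\<^esub> single t)" for f :: "'v list \<Rightarrow> 'k" and t a by simp
    have sc: "single s \<in> carrier FA" using l by (simp del: free_alg_simps)
    have GG: "\<And>x. x \<in> ?L \<Longrightarrow> G l1 l2 x \<in> carrier W" "\<And>x. x \<in> ?L \<Longrightarrow> G (l1 @ s) l2 x \<in> carrier W" "\<And>x. x \<in> ?L \<Longrightarrow> G l1 (s @ l2) x \<in> carrier W"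
      using l by (simp_all add: G_def F_closed)
    have LA: "lext W H (f \<oplus>\<^bsub>FA\<^esub> (a \<odot>\<^bsub>FA\<^esub> h)) = lext W H f \<oplus>\<^bsub>W\<^esub> (a \<odot>\<^bsub>W\<^esub> lext W H h)"
      if "f \<in> carrier FA" "h \<in> carrier FA" "\<And>x. x \<in> ?L \<Longrightarrow> H x \<in> carrier W" for f h H a
    proof -
      have "a \<odot>\<^bsub>FA\<^esub> h \<in> carrier FA" by (rule vs_closed(3)[OF free_alg_vspace that(2)])
      then show ?thesis
        using lext_add[OF W, where S = ?L and F = H and f = f and h = "a \<odot>\<^bsub>FA\<^esub> h"] lext_smult[OF W, where S = ?L and F = H and f = h and a = a] that by simp
    qed
    have LS: "lext W H (single t) = H t" if "t \<in> ?L" "\<And>x. x \<in> ?L \<Longrightarrow> H x \<in> carrier W" for t H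
      using that by (intro lext_single[OF W, where S = ?L]) auto
    from f show "lext W (G l1 l2) (single s \<otimes>\<^bsub>FA\<^esub> f) = lext W (G (l1 @ s) l2) f"
    proof (induction rule: free_module_induct)
      case zero
      have "single s \<otimes>\<^bsub>FA\<^esub> (\<lambda>x. 0) = \<zero>\<^bsub>FA\<^esub>" using FA.r_null[OF sc] by simp
      then show ?case by (simp add: lext_zero[OF W] del: free_alg_simps(5))
    next
      case (add f t a)
      have fc: "f \<in> carrier FA" and tc: "single t \<in> carrier FA"
        using add by (simp_all only: free_alg_simps(1) single_carrier)
      have atc: "a \<odot>\<^bsub>FA\<^esub> single t \<in> carrier FA" by (rule vs_closed(3)[OF free_alg_vspace tc])
      have "single s \<otimes>\<^bsub>FA\<^esub> (f \<oplus>\<^bsub>FA\<^esub> (a \<odot>\<^bsub>FA\<^esub> single t)) = (single s \<otimes>\<^bsub>FA\<^esub> f) \<oplus>\<^bsub>FA\<^esub> (a \<odot>\<^bsub>FA\<^esub> single (s @ t))"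
        unfolding FA.r_distr[OF fc atc sc] free_alg_smult_mult(2) single_mult ..
      moreover have "single (s @ t) \<in> carrier FA" using l add by (simp del: free_alg_simps)
      moreover have "G l1 l2 (s @ t) = G (l1 @ s) l2 t" by (simp add: G_def)
      ultimately show ?case unfolding g using add fc tc FA.m_closed[OF sc fc] l
        by (simp add: LA[OF _ _ GG(1)] LA[OF _ _ GG(2)] LS[OF _ GG(1)] LS[OF _ GG(2)] del: free_alg_simps)
    qed
    from f show "lext W (G l1 l2) (f \<otimes>\<^bsub>FA\<^esub> single s) = lext W (G l1 (s @ l2)) f"
    proof (induction rule: free_module_induct)
      case zero
      have "(\<lambda>x. 0) \<otimes>\<^bsub>FA\<^esub> single s = \<zero>\<^bsub>FA\<^esub>" using FA.l_null[OF sc] by simp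
      then show ?case by (simp add: lext_zero[OF W] del: free_alg_simps(5))
    next
      case (add f t a)
      have fc: "f \<in> carrier FA" and tc: "single t \<in> carrier FA"
        using add by (simp_all only: free_alg_simps(1) single_carrier)
      have atc: "a \<odot>\<^bsub>FA\<^esub> single t \<in> carrier FA" by (rule vs_closed(3)[OF free_alg_vspace tc])
      have "(f \<oplus>\<^bsub>FA\<^esub> (a \<odot>\<^bsub>FA\<^esub> single t)) \<otimes>\<^bsub>FA\<^esub> single s = (f \<otimes>\<^bsub>FA\<^esub> single s) \<oplus>\<^bsub>FA\<^esub> (a \<odot>\<^bsub>FA\<^esub> single (t @ s))"
        unfolding FA.l_distr[OF fc atc sc] free_alg_smult_mult(1) single_mult ..
      moreover have "single (t @ s) \<in> carrier FA" using l add by (simp del: free_alg_simps)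
      moreover have "G l1 l2 (t @ s) = G l1 (s @ l2) t" by (simp add: G_def)
      ultimately show ?case unfolding g using add fc tc FA.m_closed[OF fc sc] l
        by (simp add: LA[OF _ _ GG(1)] LA[OF _ _ GG(3)] LS[OF _ GG(1)] LS[OF _ GG(3)] del: free_alg_simps)
    qed
  qed
  have Jmult: "h \<otimes>\<^bsub>FA\<^esub> f \<in> J \<and> f \<otimes>\<^bsub>FA\<^esub> h \<in> J" if fJ: "f \<in> J" and h: "h \<in> carrier (free_module ?L)" for f h
    using h
  proof (induction rule: free_module_induct)
    case zero
    have fc: "f \<in> carrier FA" using fJ by (simp add: J_def)
    have "(\<lambda>x. 0) \<otimes>\<^bsub>FA\<^esub> f = \<zero>\<^bsub>FA\<^esub>" "f \<otimes>\<^bsub>FA\<^esub> (\<lambda>x. 0) = \<zero>\<^bsub>FA\<^esub>" using FA.l_null[OF fc] FA.r_null[OF fc] by simp_all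
    then show ?case using J0 by metis
  next
    case (add h s a)
    have fc: "f \<in> carrier FA" "h \<in> carrier FA" and sc: "single s \<in> carrier FA"
      using fJ add unfolding J_def by (simp_all only: free_alg_simps(1) single_carrier) simp
    have asc: "a \<odot>\<^bsub>FA\<^esub> single s \<in> carrier FA" by (rule vs_closed(3)[OF free_alg_vspace sc])
    have sf: "single s \<otimes>\<^bsub>FA\<^esub> f \<in> J" "f \<otimes>\<^bsub>FA\<^esub> single s \<in> J"
      unfolding J_def using fJ fc FA.m_closed[OF sc fc(1)] FA.m_closed[OF fc(1) sc] add(2)
      by (simp_all add: single_l single_r J_def del: free_alg_simps(2-6))
    have e: "(\<lambda>x. h x + a * single s x) = h \<oplus>\<^bsub>FA\<^esub> (a \<odot>\<^bsub>FA\<^esub> single s)" by simp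
    show ?case
      unfolding e FA.l_distr[OF fc(2) asc fc(1)] FA.r_distr[OF fc(2) asc fc(1)] free_alg_smult_mult
      using add(3) sf by (intro conjI Jadd Jsmult) blast+
  qed
  have "ideal J FA"
  proof (rule idealI)
    show "ring FA" ..
    show "subgroup J (add_monoid FA)" using submodule.axioms(1)[OF Jsub] .
  qed (use Jmult in simp_all)
  moreover have "tgens \<subseteq> J"
  proof
    fix t assume t: "t \<in> tgens"
    have sg: "single [v] \<in> carrier FA" if "v \<in> carrier V" for v using that by (simp del: free_alg_simps)
    have ex: "lext W (G l1 l2) (single [v]) = G l1 l2 [v]" if "l1 \<in> ?L" "l2 \<in> ?L" "v \<in> carrier V" for l1 l2 v
      using that by (intro lext_single[OF W, where S = ?L] G) auto
    have ladd: "lext W (G l1 l2) (f \<oplus>\<^bsub>FA\<^esub> h) = lext W (G l1 l2) f \<oplus>\<^bsub>W\<^esub> lext W (G l1 l2) h"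
      if "l1 \<in> ?L" "l2 \<in> ?L" "f \<in> carrier FA" "h \<in> carrier FA" for l1 l2 f h
      using lext_add[where S = ?L and F = "G l1 l2" and f = f and h = h, OF W G[OF that(1,2)]] that by simp
    have lsm: "lext W (G l1 l2) (a \<odot>\<^bsub>FA\<^esub> f) = a \<odot>\<^bsub>W\<^esub> lext W (G l1 l2) f"
      if "l1 \<in> ?L" "l2 \<in> ?L" "f \<in> carrier FA" for l1 l2 a f
      using lext_smult[where S = ?L and F = "G l1 l2" and f = f and a = a, OF W G[OF that(1,2)]] that by simp
    from t consider v w where "v \<in> carrier V" "w \<in> carrier V" "t = single [v \<oplus>\<^bsub>V\<^esub> w] \<ominus>\<^bsub>FA\<^esub> (single [v] \<oplus>\<^bsub>FA\<^esub> single [w])"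
      | r v where "v \<in> carrier V" "t = single [r \<odot>\<^bsub>V\<^esub> v] \<ominus>\<^bsub>FA\<^esub> r \<odot>\<^bsub>FA\<^esub> single [v]"
      unfolding tgens_def by blast
    then show "t \<in> J"
    proof cases
      case 1
      let ?a = "single [v \<oplus>\<^bsub>V\<^esub> w] :: 'v list \<Rightarrow> 'k" and ?b = "single [v] :: 'v list \<Rightarrow> 'k" and ?c = "single [w] :: 'v list \<Rightarrow> 'k"
      have c: "?a \<in> carrier FA" "?b \<in> carrier FA" "?c \<in> carrier FA" using 1 sg by auto
      have bc: "?b \<oplus>\<^bsub>FA\<^esub> ?c \<in> carrier FA" using c by (rule_tac FA.a_closed)
      have e: "t = ?a \<oplus>\<^bsub>FA\<^esub> ((-1) \<odot>\<^bsub>FA\<^esub> (?b \<oplus>\<^bsub>FA\<^esub> ?c))" using 1 vs_diff[OF free_alg_vspace c(1) bc] by simp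
      have nc: "(-1) \<odot>\<^bsub>FA\<^esub> (?b \<oplus>\<^bsub>FA\<^esub> ?c) \<in> carrier FA" by (rule vs_closed(3)[OF free_alg_vspace bc])
      show ?thesis unfolding J_def
      proof (intro CollectI conjI ballI)
        show "t \<in> carrier FA" unfolding e by (rule FA.a_closed[OF c(1) nc])
        fix l1 l2 assume l: "l1 \<in> ?L" "l2 \<in> ?L"
        have "lext W (G l1 l2) t = lext W (G l1 l2) ?a \<oplus>\<^bsub>W\<^esub> (- 1) \<odot>\<^bsub>W\<^esub> (lext W (G l1 l2) ?b \<oplus>\<^bsub>W\<^esub> lext W (G l1 l2) ?c)"
          unfolding e ladd[OF l c(1) nc] lsm[OF l bc] ladd[OF l c(2,3)] ..
        also have "\<dots> = G l1 l2 [v \<oplus>\<^bsub>V\<^esub> w] \<oplus>\<^bsub>W\<^esub> (- 1) \<odot>\<^bsub>W\<^esub> (G l1 l2 [v] \<oplus>\<^bsub>W\<^esub> G l1 l2 [w])"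
          using ex l 1 by simp
        also have "G l1 l2 [v \<oplus>\<^bsub>V\<^esub> w] = G l1 l2 [v] \<oplus>\<^bsub>W\<^esub> G l1 l2 [w]"
          using F l 1 by (simp add: G_def multilinear_def)
        finally show "lext W (G l1 l2) t = \<zero>\<^bsub>W\<^esub>"
          using l 1 G vs_diff[OF W, of "G l1 l2 [v] \<oplus>\<^bsub>W\<^esub> G l1 l2 [w]" "G l1 l2 [v] \<oplus>\<^bsub>W\<^esub> G l1 l2 [w]"]
          by (simp add: W.M.r_neg a_minus_def)
      qed
    next
      case 2
      let ?a = "single [r \<odot>\<^bsub>V\<^esub> v] :: 'v list \<Rightarrow> 'k" and ?b = "single [v] :: 'v list \<Rightarrow> 'k"
      have c: "?a \<in> carrier FA" "?b \<in> carrier FA" using 2 sg vs_closed(3)[OF V] by auto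
      have bc: "r \<odot>\<^bsub>FA\<^esub> ?b \<in> carrier FA" by (rule vs_closed(3)[OF free_alg_vspace c(2)])
      have e: "t = ?a \<oplus>\<^bsub>FA\<^esub> ((-1) \<odot>\<^bsub>FA\<^esub> (r \<odot>\<^bsub>FA\<^esub> ?b))" using 2 vs_diff[OF free_alg_vspace c(1) bc] by simp
      have nc: "(-1) \<odot>\<^bsub>FA\<^esub> (r \<odot>\<^bsub>FA\<^esub> ?b) \<in> carrier FA" by (rule vs_closed(3)[OF free_alg_vspace bc])
      show ?thesis unfolding J_def
      proof (intro CollectI conjI ballI)
        show "t \<in> carrier FA" unfolding e by (rule FA.a_closed[OF c(1) nc])
        fix l1 l2 assume l: "l1 \<in> ?L" "l2 \<in> ?L"
        have "lext W (G l1 l2) t = lext W (G l1 l2) ?a \<oplus>\<^bsub>W\<^esub> (- 1) \<odot>\<^bsub>W\<^esub> (r \<odot>\<^bsub>W\<^esub> lext W (G l1 l2) ?b)"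
          unfolding e ladd[OF l c(1) nc] lsm[OF l bc] lsm[OF l c(2)] ..
        also have "\<dots> = G l1 l2 [r \<odot>\<^bsub>V\<^esub> v] \<oplus>\<^bsub>W\<^esub> (- 1) \<odot>\<^bsub>W\<^esub> (r \<odot>\<^bsub>W\<^esub> G l1 l2 [v])"
          using ex l 2 vs_closed(3)[OF V] by simp
        also have "G l1 l2 [r \<odot>\<^bsub>V\<^esub> v] = r \<odot>\<^bsub>W\<^esub> G l1 l2 [v]"
          using F l 2 by (simp add: G_def multilinear_def)
        finally show "lext W (G l1 l2) t = \<zero>\<^bsub>W\<^esub>"
          using l 2 G vs_diff[OF W, of "r \<odot>\<^bsub>W\<^esub> G l1 l2 [v]" "r \<odot>\<^bsub>W\<^esub> G l1 l2 [v]"] vs_closed(3)[OF W]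
          by (simp add: W.M.r_neg a_minus_def)
      qed
    qed
  qed
  ultimately have "TI \<subseteq> J" unfolding tensor_alg_ideal_eq by (rule FA.genideal_minimal)
  then have "lext W (G [] []) f = \<zero>\<^bsub>W\<^esub>" using assms by (auto simp: J_def)
  then show ?thesis by (simp add: G_def)
qed

lemma tlift_coset:
  assumes f: "f \<in> carrier FA"
  shows "tlift V W F (TI +>\<^bsub>FA\<^esub> f) = lext W F f"
proof -
  have "lext W F h = lext W F f" if h: "h \<in> TI +>\<^bsub>FA\<^esub> f" for h
  proof -
    from h obtain t where t: "t \<in> TI" "h = t \<oplus>\<^bsub>FA\<^esub> f" unfolding a_r_coset_def' by blast
    have tc: "t \<in> carrier FA" using t(1) submoduleD(1)[OF free_alg_vspace TI_submodule] by blast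
    have "lext W F (t \<oplus>\<^bsub>FA\<^esub> f) = lext W F t \<oplus>\<^bsub>W\<^esub> lext W F f"
      using lext_add[where S = "lists (carrier V)" and F = F and f = t and h = f, OF W F_closed] tc f by simp
    also have "\<dots> = lext W F f"
      unfolding lext_TI[OF t(1)] using lext_closed[where S = "lists (carrier V)" and F = F and f = f, OF W F_closed] f by simp
    finally show ?thesis unfolding t(2) .
  qed
  moreover have "TI +>\<^bsub>FA\<^esub> f \<noteq> {}" using coset_self[OF free_alg_vspace TI_submodule f] by (rule ex_in_conv[THEN iffD1, OF exI])
  ultimately show ?thesis unfolding tlift_def by (intro the_elem_image_unique)
qed

lemma tlift_closed:
  assumes "C \<in> carrier TA" shows "tlift V W F C \<in> carrier W"
proof -
  obtain f where f: "f \<in> carrier FA" "C = TI +>\<^bsub>FA\<^esub> f" using assms unfolding TA_carrier by (elim imageE)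
  have "lext W F f \<in> carrier W"
    using lext_closed[where S = "lists (carrier V)" and F = F and f = f, OF W F_closed] f(1) by simp
  then show ?thesis unfolding f(2) tlift_coset[OF f(1)] .
qed

lemma tlift_add:
  assumes "C \<in> carrier TA" "D \<in> carrier TA"
  shows "tlift V W F (C \<oplus>\<^bsub>TA\<^esub> D) = tlift V W F C \<oplus>\<^bsub>W\<^esub> tlift V W F D"
proof -
  obtain f h where fh: "f \<in> carrier FA" "h \<in> carrier FA" "C = TI +>\<^bsub>FA\<^esub> f" "D = TI +>\<^bsub>FA\<^esub> h"
    using assms unfolding TA_carrier by (elim imageE)
  have "tlift V W F (C \<oplus>\<^bsub>TA\<^esub> D) = lext W F (f \<oplus>\<^bsub>FA\<^esub> h)"
    unfolding fh TA_add[OF fh(1,2)] by (rule tlift_coset[OF FA.a_closed[OF fh(1,2)]])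
  also have "\<dots> = lext W F f \<oplus>\<^bsub>W\<^esub> lext W F h" using lext_add[where S = "lists (carrier V)" and F = F and f = f and h = h, OF W F_closed] fh by simp
  finally show ?thesis unfolding fh(3,4) tlift_coset[OF fh(1)] tlift_coset[OF fh(2)] .
qed

lemma tlift_smult:
  assumes "C \<in> carrier TA"
  shows "tlift V W F (a \<odot>\<^bsub>TA\<^esub> C) = a \<odot>\<^bsub>W\<^esub> tlift V W F C"
proof -
  obtain f where fh: "f \<in> carrier FA" "C = TI +>\<^bsub>FA\<^esub> f" using assms unfolding TA_carrier by (elim imageE)
  have "tlift V W F (a \<odot>\<^bsub>TA\<^esub> C) = lext W F (a \<odot>\<^bsub>FA\<^esub> f)"
    unfolding fh TA_smult[OF fh(1)] by (rule tlift_coset[OF vs_closed(3)[OF free_alg_vspace fh(1)]])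
  also have "\<dots> = a \<odot>\<^bsub>W\<^esub> lext W F f" using lext_smult[where S = "lists (carrier V)" and F = F and f = f and a = a, OF W F_closed] fh by simp
  finally show ?thesis unfolding fh(2) tlift_coset[OF fh(1)] .
qed

lemma tlift_pure:
  assumes "l \<in> lists (carrier V)"
  shows "tlift V W F (pure_tensor V l) = F l"
  unfolding pure_tensor_def using assms lext_single[where S = "lists (carrier V)" and F = F, OF W F_closed assms]
  by (subst tlift_coset) (simp_all del: free_alg_simps)

end

end

section \<open>Braidings of diagonal type on a part of the space\<close>

definition kspace :: "('k::field, 'k) module" where
  "kspace = \<lparr>carrier = UNIV, mult = (*), one = 1, ring.zero = 0, add = (+), module.smult = (*)\<rparr>"

lemma kspace_simps [simp]: "carrier kspace = UNIV" "\<zero>\<^bsub>kspace\<^esub> = 0" "x \<oplus>\<^bsub>kspace\<^esub> y = x + y" "a \<odot>\<^bsub>kspace\<^esub> x = a * x"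
  by (simp_all add: kspace_def)

lemma kspace_vspace: "vspace kspace"
  by (rule vspaceI) (simp_all add: algebra_simps)

text \<open>The functional descends to the quotient and vanishes there on a spanning set. Instead of
  a descended functional, the induction speaks of all representatives of a coset.\<close>

lemma quot_functional_zero:
  fixes M :: "('k::field, 'v, 'm) module_scheme" and \<Theta> :: "'v \<Rightarrow> 'k"
  assumes M: "vspace M" and N: "submodule N kring M"
    and Tadd: "\<And>x y. x \<in> carrier M \<Longrightarrow> y \<in> carrier M \<Longrightarrow> \<Theta> (x \<oplus>\<^bsub>M\<^esub> y) = \<Theta> x + \<Theta> y"
    and Tsmult: "\<And>a x. x \<in> carrier M \<Longrightarrow> \<Theta> (a \<odot>\<^bsub>M\<^esub> x) = a * \<Theta> x"
    and kill: "\<And>x. x \<in> N \<Longrightarrow> \<Theta> x = 0"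
    and span: "lin_span (quot_module M N) B = carrier (quot_module M N)" and B: "B \<subseteq> carrier (quot_module M N)"
    and Tzero: "\<And>x. x \<in> carrier M \<Longrightarrow> N +>\<^bsub>M\<^esub> x \<in> B \<Longrightarrow> \<exists>y\<in>carrier M. N +>\<^bsub>M\<^esub> x = N +>\<^bsub>M\<^esub> y \<and> \<Theta> y = 0"
    and x: "x \<in> carrier M"
  shows "\<Theta> x = 0"
proof -
  have eq: "\<Theta> x = \<Theta> y" if "N +>\<^bsub>M\<^esub> x = N +>\<^bsub>M\<^esub> y" "x \<in> carrier M" "y \<in> carrier M" for x y
  proof -
    have "x \<oplus>\<^bsub>M\<^esub> (- 1) \<odot>\<^bsub>M\<^esub> y \<in> N" using coset_eq_iff[OF M N that(2,3)] that vs_diff[OF M that(2,3)] by simp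
    from kill[OF this] show ?thesis using that vs_closed(3)[OF M] by (simp add: Tadd Tsmult)
  qed
  have Q: "vspace (quot_module M N)" by (rule quot_vspace[OF M N])
  have "N +>\<^bsub>M\<^esub> x \<in> lin_span (quot_module M N) B" using x span quot_carrier[OF M N] by blast
  then have "\<forall>y\<in>carrier M. N +>\<^bsub>M\<^esub> x = N +>\<^bsub>M\<^esub> y \<longrightarrow> \<Theta> y = 0"
  proof (induction rule: lin_span_induct[OF Q, consumes 1, case_names carrier base zero add smult])
    case (base D)
    then show ?case using Tzero eq by metis
  next
    case zero
    show ?case
    proof (intro ballI impI)
      fix y assume y: "y \<in> carrier M" "\<zero>\<^bsub>quot_module M N\<^esub> = N +>\<^bsub>M\<^esub> y"
      then have "N +>\<^bsub>M\<^esub> y = N +>\<^bsub>M\<^esub> \<zero>\<^bsub>M\<^esub>" using quot_zero[OF M N] by simp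
      then have "\<Theta> y = \<Theta> \<zero>\<^bsub>M\<^esub>" using y vs_closed(2)[OF M] by (intro eq)
      also have "\<dots> = 0" by (rule kill) (rule submoduleD(2)[OF M N])
      finally show "\<Theta> y = 0" .
    qed
  next
    case (add D D')
    then obtain z z' where z: "z \<in> carrier M" "z' \<in> carrier M" "D = N +>\<^bsub>M\<^esub> z" "D' = N +>\<^bsub>M\<^esub> z'"
      unfolding quot_carrier[OF M N] by blast
    then have t: "\<Theta> z = 0" "\<Theta> z' = 0" using add by auto
    show ?case
    proof (intro ballI impI)
      fix y assume y: "y \<in> carrier M" "D \<oplus>\<^bsub>quot_module M N\<^esub> D' = N +>\<^bsub>M\<^esub> y"
      then have "N +>\<^bsub>M\<^esub> y = N +>\<^bsub>M\<^esub> (z \<oplus>\<^bsub>M\<^esub> z')" using quot_add[OF M N z(1,2)] z by simp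
      then have "\<Theta> y = \<Theta> (z \<oplus>\<^bsub>M\<^esub> z')" using y z vs_closed(1)[OF M] by (intro eq)
      then show "\<Theta> y = 0" using z t by (simp add: Tadd)
    qed
  next
    case (smult a D)
    then obtain z where z: "z \<in> carrier M" "D = N +>\<^bsub>M\<^esub> z"
      unfolding quot_carrier[OF M N] by blast
    then have t: "\<Theta> z = 0" using smult by auto
    show ?case
    proof (intro ballI impI)
      fix y assume y: "y \<in> carrier M" "a \<odot>\<^bsub>quot_module M N\<^esub> D = N +>\<^bsub>M\<^esub> y"
      then have "N +>\<^bsub>M\<^esub> y = N +>\<^bsub>M\<^esub> (a \<odot>\<^bsub>M\<^esub> z)" using quot_smult[OF M N z(1)] z by simp
      then have "\<Theta> y = \<Theta> (a \<odot>\<^bsub>M\<^esub> z)" using y z vs_closed(3)[OF M] by (intro eq)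
      then show "\<Theta> y = 0" using z t by (simp add: Tsmult)
    qed
  qed (rule B)
  then show ?thesis using x by blast
qed

text \<open>The tensor product of the functionals named by \<open>u\<close>, extended by zero to the
  other degrees so that it is defined on the whole tensor algebra.\<close>

definition coord :: "('s \<Rightarrow> 'v \<Rightarrow> 'k::field) \<Rightarrow> 's list \<Rightarrow> 'v list \<Rightarrow> 'k" where
  "coord \<xi> u l = (if length l = length u then prod_list (map2 \<xi> u l) else 0)"

lemma coord_simps [simp]: "coord \<xi> [] [] = 1" "coord \<xi> (a # u) (v # l) = \<xi> a v * coord \<xi> u l"
  "coord \<xi> [] (v # l) = 0" "coord \<xi> (a # u) [] = 0"
  by (simp_all add: coord_def)

lemma coord_append: "length u1 = length l1 \<Longrightarrow> coord \<xi> (u1 @ u2) (l1 @ l2) = coord \<xi> u1 l1 * coord \<xi> u2 l2"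
  by (induction u1 l1 rule: list_induct2) (simp_all add: mult.assoc)

lemma coord_length: "length u \<noteq> length l \<Longrightarrow> coord \<xi> u l = 0"
  by (simp add: coord_def)

lemma coord_middle:
  assumes "u \<in> lists A"
  shows "(\<exists>a\<in>A. \<exists>k. \<forall>w. coord \<xi> u (l1 @ w # l2) = k * \<xi> a w) \<or> (\<forall>w. coord \<xi> u (l1 @ w # l2) = 0)"
proof (cases "length u = Suc (length l1 + length l2)")
  case True
  define u1 a u2 where "u1 = take (length l1) u" and "a = u ! length l1" and "u2 = drop (Suc (length l1)) u"
  have us: "u = u1 @ a # u2" using True unfolding u1_def a_def u2_def by (simp add: id_take_nth_drop)
  have l1: "length u1 = length l1" using True by (simp add: u1_def)
  have "\<forall>w. coord \<xi> u (l1 @ w # l2) = (coord \<xi> u1 l1 * coord \<xi> u2 l2) * \<xi> a w"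
    unfolding us by (simp add: coord_append[OF l1])
  moreover have "a \<in> A" using assms unfolding us by simp
  ultimately show ?thesis by blast
next
  case False then show ?thesis by (auto intro: coord_length)
qed

lemma coord_multilinear:
  fixes V :: "('k::field, 'v, 'm) module_scheme"
  assumes u: "u \<in> lists A"
    and add: "\<And>s v w. s \<in> A \<Longrightarrow> v \<in> carrier V \<Longrightarrow> w \<in> carrier V \<Longrightarrow> \<xi> s (v \<oplus>\<^bsub>V\<^esub> w) = \<xi> s v + \<xi> s w"
    and smult: "\<And>s a v. s \<in> A \<Longrightarrow> v \<in> carrier V \<Longrightarrow> \<xi> s (a \<odot>\<^bsub>V\<^esub> v) = a * \<xi> s v"
  shows "multilinear V kspace (coord \<xi> u)"
proof (rule multilinearI)
  fix l1 l2 v assume v: "v \<in> carrier V"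
  note * = coord_middle[OF u, of \<xi> l1 l2]
  show "coord \<xi> u (l1 @ (a \<odot>\<^bsub>V\<^esub> v) # l2) = a \<odot>\<^bsub>kspace\<^esub> coord \<xi> u (l1 @ v # l2)" for a
    using * v by (auto simp: smult)
  fix w assume "w \<in> carrier V"
  then show "coord \<xi> u (l1 @ (v \<oplus>\<^bsub>V\<^esub> w) # l2) = coord \<xi> u (l1 @ v # l2) \<oplus>\<^bsub>kspace\<^esub> coord \<xi> u (l1 @ w # l2)"
    using * v by (auto simp: add algebra_simps)
qed simp

text \<open>Diagonality is assumed in dual form: by \<open>c_diag\<close> the functionals \<xi> are
  diagonal for \<open>c\<close> on all of \<open>V\<close>, not only on the span of the vectors
  \<open>x s\<close>. This is what makes statements about the Nichols algebra of \<open>V\<close>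
  itself accessible. Words \<open>us\<close> of other lengths give zero since \<open>c\<close> stays
  in degree two.\<close>

locale diag_braiding =
  fixes V :: "('k::field, 'v, 'm) module_scheme" and c :: "('v list \<Rightarrow> 'k) set \<Rightarrow> ('v list \<Rightarrow> 'k) set"
    and A :: "'s set" and \<xi> :: "'s \<Rightarrow> 'v \<Rightarrow> 'k" and x :: "'s \<Rightarrow> 'v" and q :: "'s \<Rightarrow> 's \<Rightarrow> 'k"
  assumes V: "vspace V"
    and c_closed: "v \<in> carrier V \<Longrightarrow> w \<in> carrier V \<Longrightarrow> c (pure_tensor V [v, w]) \<in> carrier (tensor_alg V)"
    and c_add1: "u \<in> carrier V \<Longrightarrow> v \<in> carrier V \<Longrightarrow> w \<in> carrier V \<Longrightarrow>
      c (pure_tensor V [u \<oplus>\<^bsub>V\<^esub> v, w]) = c (pure_tensor V [u, w]) \<oplus>\<^bsub>tensor_alg V\<^esub> c (pure_tensor V [v, w])"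
    and c_add2: "u \<in> carrier V \<Longrightarrow> v \<in> carrier V \<Longrightarrow> w \<in> carrier V \<Longrightarrow>
      c (pure_tensor V [w, u \<oplus>\<^bsub>V\<^esub> v]) = c (pure_tensor V [w, u]) \<oplus>\<^bsub>tensor_alg V\<^esub> c (pure_tensor V [w, v])"
    and c_smult1: "v \<in> carrier V \<Longrightarrow> w \<in> carrier V \<Longrightarrow>
      c (pure_tensor V [a \<odot>\<^bsub>V\<^esub> v, w]) = a \<odot>\<^bsub>tensor_alg V\<^esub> c (pure_tensor V [v, w])"
    and c_smult2: "v \<in> carrier V \<Longrightarrow> w \<in> carrier V \<Longrightarrow>
      c (pure_tensor V [w, a \<odot>\<^bsub>V\<^esub> v]) = a \<odot>\<^bsub>tensor_alg V\<^esub> c (pure_tensor V [w, v])"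
    and \<xi>_add: "s \<in> A \<Longrightarrow> v \<in> carrier V \<Longrightarrow> w \<in> carrier V \<Longrightarrow> \<xi> s (v \<oplus>\<^bsub>V\<^esub> w) = \<xi> s v + \<xi> s w"
    and \<xi>_smult: "s \<in> A \<Longrightarrow> v \<in> carrier V \<Longrightarrow> \<xi> s (a \<odot>\<^bsub>V\<^esub> v) = a * \<xi> s v"
    and x_closed: "s \<in> A \<Longrightarrow> x s \<in> carrier V"
    and \<xi>_x: "s \<in> A \<Longrightarrow> t \<in> A \<Longrightarrow> \<xi> s (x t) = (if s = t then 1 else 0)"
    and c_diag: "us \<in> lists A \<Longrightarrow> v \<in> carrier V \<Longrightarrow> w \<in> carrier V \<Longrightarrow>
      tlift V kspace (coord \<xi> us) (c (pure_tensor V [v, w])) = (case us of [a, b] \<Rightarrow> q b a * \<xi> a w * \<xi> b v | _ \<Rightarrow> 0)"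
begin

abbreviation T where "T \<equiv> tensor_alg V"
abbreviation pt where "pt \<equiv> pure_tensor V"
abbreviation "L \<equiv> lists (carrier V)"

interpretation T: Module.module kring T by (rule TA_vspace[OF V])
interpretation TR: ring T by (rule TA_ring[OF V])

section \<open>Functionals on the tensor algebra indexed by words\<close>

definition \<Psi> where "\<Psi> u = tlift V kspace (coord \<xi> u)"

lemma \<xi>_multilinear: "u \<in> lists A \<Longrightarrow> multilinear V kspace (coord \<xi> u)"
  by (rule coord_multilinear[OF _ \<xi>_add \<xi>_smult])

lemma \<Psi>_add: "u \<in> lists A \<Longrightarrow> C \<in> carrier T \<Longrightarrow> D \<in> carrier T \<Longrightarrow> \<Psi> u (C \<oplus>\<^bsub>T\<^esub> D) = \<Psi> u C + \<Psi> u D"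
  using tlift_add[OF V kspace_vspace \<xi>_multilinear] by (simp add: \<Psi>_def)

lemma \<Psi>_smult: "u \<in> lists A \<Longrightarrow> C \<in> carrier T \<Longrightarrow> \<Psi> u (a \<odot>\<^bsub>T\<^esub> C) = a * \<Psi> u C"
  using tlift_smult[OF V kspace_vspace \<xi>_multilinear] by (simp add: \<Psi>_def)

lemma \<Psi>_pure: "u \<in> lists A \<Longrightarrow> l \<in> L \<Longrightarrow> \<Psi> u (pt l) = coord \<xi> u l"
  using tlift_pure[OF V kspace_vspace \<xi>_multilinear] by (simp add: \<Psi>_def)

lemma \<Psi>_zero: "u \<in> lists A \<Longrightarrow> \<Psi> u \<zero>\<^bsub>T\<^esub> = 0"
  using \<Psi>_smult[of u "\<zero>\<^bsub>T\<^esub>" 0] vs_laws(6)[OF TA_vspace[OF V]] by simp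

lemma \<Psi>_finsum:
  assumes "u \<in> lists A" "finite I" "\<And>i. i \<in> I \<Longrightarrow> F i \<in> carrier T"
  shows "\<Psi> u (finsum T F I) = (\<Sum>i\<in>I. \<Psi> u (F i))"
  using assms(2,3)
proof (induction I rule: finite_induct)
  case empty then show ?case using \<Psi>_zero[OF assms(1)] by simp
next
  case (insert i I)
  have "finsum T F (insert i I) = F i \<oplus>\<^bsub>T\<^esub> finsum T F I"
    using insert by (intro T.M.finsum_insert) auto
  moreover have "finsum T F I \<in> carrier T" using insert by (intro T.M.finsum_closed) auto
  ultimately show ?case using insert \<Psi>_add[OF assms(1)] by simp
qed

text \<open>The functional of a word splits along the factors, and the length of \<open>u\<close>
  decides which degree \<open>m\<close> of \<open>C\<close> it meets. The second claim is for words
  too short to leave room for any \<open>m\<close>.\<close>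

lemma \<Psi>_mult:
  assumes "u \<in> lists A" "l1 \<in> L" "l2 \<in> L" "C \<in> carrier T"
  shows "length u = length l1 + m + length l2 \<Longrightarrow>
      \<Psi> u (pt l1 \<otimes>\<^bsub>T\<^esub> C \<otimes>\<^bsub>T\<^esub> pt l2) = coord \<xi> (take (length l1) u) l1 * \<Psi> (take m (drop (length l1) u)) C * coord \<xi> (drop (length l1 + m) u) l2"
    and "length u < length l1 + length l2 \<Longrightarrow> \<Psi> u (pt l1 \<otimes>\<^bsub>T\<^esub> C \<otimes>\<^bsub>T\<^esub> pt l2) = 0"
proof -
  have p: "pt l1 \<in> carrier T" "pt l2 \<in> carrier T" using assms pure_tensor_closed[OF V] by auto
  have u: "take m (drop (length l1) u) \<in> lists A"
    using assms(1) by (auto dest: in_set_takeD in_set_dropD)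
  show "\<Psi> u (pt l1 \<otimes>\<^bsub>T\<^esub> C \<otimes>\<^bsub>T\<^esub> pt l2) = coord \<xi> (take (length l1) u) l1 * \<Psi> (take m (drop (length l1) u)) C * coord \<xi> (drop (length l1 + m) u) l2"
    if len: "length u = length l1 + m + length l2"
    using assms(4)
  proof (induction rule: TA_induct[OF V, consumes 1, case_names pure add smult])
    case (pure l)
    define u1 u2 u3 where "u1 = take (length l1) u" and "u2 = take m (drop (length l1) u)" and "u3 = drop (length l1 + m) u"
    have us: "u = u1 @ u2 @ u3" unfolding u1_def u2_def u3_def by (metis append_take_drop_id drop_drop add.commute)
    have ul: "length u1 = length l1" "length u2 = m" "length u3 = length l2" using len by (auto simp: u1_def u2_def u3_def)
    have "\<Psi> u (pt l1 \<otimes>\<^bsub>T\<^esub> pt l \<otimes>\<^bsub>T\<^esub> pt l2) = coord \<xi> u (l1 @ l @ l2)"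
      using assms pure by (simp add: pure_tensor_mult[OF V] \<Psi>_pure)
    also have "\<dots> = coord \<xi> u1 l1 * coord \<xi> u2 l * coord \<xi> u3 l2"
    proof (cases "length l = m")
      case True then show ?thesis unfolding us using ul by (simp add: coord_append)
    next
      case False
      then have "length u \<noteq> length (l1 @ l @ l2)" using len by simp
      then show ?thesis using False ul by (simp add: coord_length)
    qed
    finally show ?case using pure u \<Psi>_pure[OF u, of l] by (simp add: u1_def u2_def u3_def)
  next
    case (add C D)
    have "pt l1 \<otimes>\<^bsub>T\<^esub> (C \<oplus>\<^bsub>T\<^esub> D) \<otimes>\<^bsub>T\<^esub> pt l2 = (pt l1 \<otimes>\<^bsub>T\<^esub> C \<otimes>\<^bsub>T\<^esub> pt l2) \<oplus>\<^bsub>T\<^esub> (pt l1 \<otimes>\<^bsub>T\<^esub> D \<otimes>\<^bsub>T\<^esub> pt l2)"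
      using p add by (simp add: TR.l_distr TR.r_distr)
    then show ?case using add p \<Psi>_add[OF assms(1)] \<Psi>_add[OF u] by (simp add: algebra_simps)
  next
    case (smult a C)
    have "pt l1 \<otimes>\<^bsub>T\<^esub> (a \<odot>\<^bsub>T\<^esub> C) \<otimes>\<^bsub>T\<^esub> pt l2 = a \<odot>\<^bsub>T\<^esub> (pt l1 \<otimes>\<^bsub>T\<^esub> C \<otimes>\<^bsub>T\<^esub> pt l2)"
      using p smult by (simp add: TA_smult_mult[OF V])
    then show ?case using smult p \<Psi>_smult[OF assms(1)] \<Psi>_smult[OF u] by simp
  qed
  show "\<Psi> u (pt l1 \<otimes>\<^bsub>T\<^esub> C \<otimes>\<^bsub>T\<^esub> pt l2) = 0" if len: "length u < length l1 + length l2"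
    using assms(4)
  proof (induction rule: TA_induct[OF V, consumes 1, case_names pure add smult])
    case (pure l)
    then show ?case using assms len by (simp add: pure_tensor_mult[OF V] \<Psi>_pure coord_length)
  next
    case (add C D)
    have "pt l1 \<otimes>\<^bsub>T\<^esub> (C \<oplus>\<^bsub>T\<^esub> D) \<otimes>\<^bsub>T\<^esub> pt l2 = (pt l1 \<otimes>\<^bsub>T\<^esub> C \<otimes>\<^bsub>T\<^esub> pt l2) \<oplus>\<^bsub>T\<^esub> (pt l1 \<otimes>\<^bsub>T\<^esub> D \<otimes>\<^bsub>T\<^esub> pt l2)"
      using p add by (simp add: TR.l_distr TR.r_distr)
    then show ?case using add p \<Psi>_add[OF assms(1)] by simp
  next
    case (smult a C)
    have "pt l1 \<otimes>\<^bsub>T\<^esub> (a \<odot>\<^bsub>T\<^esub> C) \<otimes>\<^bsub>T\<^esub> pt l2 = a \<odot>\<^bsub>T\<^esub> (pt l1 \<otimes>\<^bsub>T\<^esub> C \<otimes>\<^bsub>T\<^esub> pt l2)"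
      using p smult by (simp add: TA_smult_mult[OF V])
    then show ?case using smult p \<Psi>_smult[OF assms(1)] by simp
  qed
qed

section \<open>Braiding two adjacent tensor factors\<close>

definition bfun where
  "bfun i l = (if Suc i < length l
       then pt (take i l) \<otimes>\<^bsub>T\<^esub> c (pt [l ! i, l ! Suc i]) \<otimes>\<^bsub>T\<^esub> pt (drop (i + 2) l)
       else \<zero>\<^bsub>T\<^esub>)"

lemma bfun_append:
  "length t = i \<Longrightarrow> bfun i (t @ y # z # d) = pt t \<otimes>\<^bsub>T\<^esub> c (pt [y, z]) \<otimes>\<^bsub>T\<^esub> pt d"
  by (auto simp: bfun_def nth_append)

lemma split_at:
  assumes "Suc i < length l" obtains t y z d where "l = t @ y # z # d" "length t = i"
proof -
  have "l = take i l @ l ! i # l ! Suc i # drop (Suc (Suc i)) l"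
    using assms by (metis Cons_nth_drop_Suc Suc_lessD append_take_drop_id)
  then show ?thesis using that assms by (metis Suc_lessD length_take min.absorb4)
qed

lemma braid_at_eq: "braid_at V c i = tlift V T (bfun i)"
  unfolding braid_at_def tensor_lift_eq bfun_def ..

lemma bfun_closed: "l \<in> L \<Longrightarrow> bfun i l \<in> carrier T"
proof (cases "Suc i < length l")
  case True
  assume l: "l \<in> L"
  obtain t y z d where s: "l = t @ y # z # d" "length t = i" using split_at[OF True] .
  then have "t \<in> L" "d \<in> L" "y \<in> carrier V" "z \<in> carrier V" using l by auto
  then show ?thesis unfolding s(1) bfun_append[OF s(2)] by (intro TR.m_closed pure_tensor_closed[OF V] c_closed)
qed (simp add: bfun_def)

lemma pt_lin:
  assumes "l1 \<in> L" "l2 \<in> L" "v \<in> carrier V"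
  shows "w \<in> carrier V \<Longrightarrow> pt (l1 @ (v \<oplus>\<^bsub>V\<^esub> w) # l2) = pt (l1 @ v # l2) \<oplus>\<^bsub>T\<^esub> pt (l1 @ w # l2)"
    "pt (l1 @ (a \<odot>\<^bsub>V\<^esub> v) # l2) = a \<odot>\<^bsub>T\<^esub> pt (l1 @ v # l2)"
  using pure_tensor_multilinear[OF V] assms by (auto simp: multilinear_def)

text \<open>The varying slot lies left or right of the braided pair, or is one of its two members,
  or the word is too short. Linearity then comes from the pure tensors, from the bilinearity of
  \<open>c\<close>, or is trivial.\<close>

lemma bfun_multilinear: "multilinear V T (bfun i)"
proof (rule multilinearI)
  fix l1 l2 v assume l: "l1 \<in> L" "l2 \<in> L" and v: "v \<in> carrier V"
  have "(\<exists>D. \<exists>t d. D \<in> carrier T \<and> t \<in> L \<and> d \<in> L \<and> (\<forall>w. bfun i (l1 @ w # l2) = pt (l1 @ w # t) \<otimes>\<^bsub>T\<^esub> D \<otimes>\<^bsub>T\<^esub> pt d))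
     \<or> (\<exists>D. \<exists>t d. D \<in> carrier T \<and> t \<in> L \<and> d \<in> L \<and> (\<forall>w. bfun i (l1 @ w # l2) = pt t \<otimes>\<^bsub>T\<^esub> D \<otimes>\<^bsub>T\<^esub> pt (d @ w # l2)))
     \<or> (\<exists>y\<in>carrier V. \<exists>t d. t \<in> L \<and> d \<in> L \<and> (\<forall>w. bfun i (l1 @ w # l2) = pt t \<otimes>\<^bsub>T\<^esub> c (pt [w, y]) \<otimes>\<^bsub>T\<^esub> pt d))
     \<or> (\<exists>y\<in>carrier V. \<exists>t d. t \<in> L \<and> d \<in> L \<and> (\<forall>w. bfun i (l1 @ w # l2) = pt t \<otimes>\<^bsub>T\<^esub> c (pt [y, w]) \<otimes>\<^bsub>T\<^esub> pt d))
     \<or> (\<forall>w. bfun i (l1 @ w # l2) = \<zero>\<^bsub>T\<^esub>)" (is "?a \<or> ?b \<or> ?c \<or> ?d \<or> ?e")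
  proof (cases "Suc i < length (l1 @ v # l2)")
    case False
    then show ?thesis by (simp add: bfun_def)
  next
    case True
    consider "length l1 < i" | "length l1 = i" | "length l1 = Suc i" | "Suc i < length l1" by linarith
    then show ?thesis
    proof cases
      case 1
      then have "Suc (i - Suc (length l1)) < length l2" using True by auto
      from split_at[OF this] obtain t y z d where s: "l2 = t @ y # z # d" "length t = i - Suc (length l1)" .
      have "bfun i (l1 @ w # l2) = pt (l1 @ w # t) \<otimes>\<^bsub>T\<^esub> c (pt [y, z]) \<otimes>\<^bsub>T\<^esub> pt d" for w
        using bfun_append[of "l1 @ w # t" i y z d] s 1 by simp
      moreover have "c (pt [y, z]) \<in> carrier T" "t \<in> L" "d \<in> L" using l s by (auto intro: c_closed)
      ultimately have ?a by blast
      then show ?thesis by blast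
    next
      case 2
      then obtain y d where s: "l2 = y # d" using True by (cases l2) auto
      have "bfun i (l1 @ w # l2) = pt l1 \<otimes>\<^bsub>T\<^esub> c (pt [w, y]) \<otimes>\<^bsub>T\<^esub> pt d" for w
        using bfun_append[of l1 i w y d] s 2 by simp
      then have ?c using l s by auto
      then show ?thesis by blast
    next
      case 3
      then obtain t y where s: "l1 = t @ [y]" "length t = i" by (cases l1 rule: rev_cases) auto
      have "bfun i (l1 @ w # l2) = pt t \<otimes>\<^bsub>T\<^esub> c (pt [y, w]) \<otimes>\<^bsub>T\<^esub> pt l2" for w
        using bfun_append[of t i y w l2] s by simp
      then have ?d using l s by auto
      then show ?thesis by blast
    next
      case 4
      from split_at[OF this] obtain t y z d where s: "l1 = t @ y # z # d" "length t = i" .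
      have "bfun i (l1 @ w # l2) = pt t \<otimes>\<^bsub>T\<^esub> c (pt [y, z]) \<otimes>\<^bsub>T\<^esub> pt (d @ w # l2)" for w
        using bfun_append[of t i y z "d @ w # l2"] s by simp
      moreover have "c (pt [y, z]) \<in> carrier T" "t \<in> L" "d \<in> L" using l s by (auto intro: c_closed)
      ultimately have ?b by blast
      then show ?thesis by blast
    qed
  qed
  note cases = this
  have ptc: "pt t \<in> carrier T" if "t \<in> L" for t using pure_tensor_closed[OF V that] .
  have pt1: "pt (t @ w # d) \<in> carrier T" if "t \<in> L" "d \<in> L" "w \<in> carrier V" for t d w using that by (intro ptc) auto
  note sm = TA_smult_mult[OF V]
  note smc = vs_closed(3)[OF TA_vspace[OF V]]
  show "bfun i (l1 @ (a \<odot>\<^bsub>V\<^esub> v) # l2) = a \<odot>\<^bsub>T\<^esub> bfun i (l1 @ v # l2)" for a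
    using cases
  proof (elim disjE exE conjE bexE)
    fix D t d assume *: "D \<in> carrier T" "t \<in> L" "d \<in> L" "\<forall>w. bfun i (l1 @ w # l2) = pt (l1 @ w # t) \<otimes>\<^bsub>T\<^esub> D \<otimes>\<^bsub>T\<^esub> pt d"
    show ?thesis using * l v by (simp add: pt_lin sm ptc pt1 del: in_lists_conv_set)
  next
    fix D t d assume *: "D \<in> carrier T" "t \<in> L" "d \<in> L" "\<forall>w. bfun i (l1 @ w # l2) = pt t \<otimes>\<^bsub>T\<^esub> D \<otimes>\<^bsub>T\<^esub> pt (d @ w # l2)"
    show ?thesis using * l v by (simp add: pt_lin sm ptc pt1 del: in_lists_conv_set)
  next
    fix y t d assume *: "y \<in> carrier V" "t \<in> L" "d \<in> L" "\<forall>w. bfun i (l1 @ w # l2) = pt t \<otimes>\<^bsub>T\<^esub> c (pt [w, y]) \<otimes>\<^bsub>T\<^esub> pt d"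
    show ?thesis using * l v by (simp add: c_smult1 c_closed sm ptc del: in_lists_conv_set)
  next
    fix y t d assume *: "y \<in> carrier V" "t \<in> L" "d \<in> L" "\<forall>w. bfun i (l1 @ w # l2) = pt t \<otimes>\<^bsub>T\<^esub> c (pt [y, w]) \<otimes>\<^bsub>T\<^esub> pt d"
    show ?thesis using * l v by (simp add: c_smult2 c_closed sm ptc del: in_lists_conv_set)
  next
    assume "\<forall>w. bfun i (l1 @ w # l2) = \<zero>\<^bsub>T\<^esub>"
    then show ?thesis using vs_laws(6)[OF TA_vspace[OF V]] by simp
  qed
  fix v' assume v': "v' \<in> carrier V"
  show "bfun i (l1 @ (v \<oplus>\<^bsub>V\<^esub> v') # l2) = bfun i (l1 @ v # l2) \<oplus>\<^bsub>T\<^esub> bfun i (l1 @ v' # l2)"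
    using cases
  proof (elim disjE exE conjE bexE)
    fix D t d assume *: "D \<in> carrier T" "t \<in> L" "d \<in> L" "\<forall>w. bfun i (l1 @ w # l2) = pt (l1 @ w # t) \<otimes>\<^bsub>T\<^esub> D \<otimes>\<^bsub>T\<^esub> pt d"
    show ?thesis using * l v v' by (simp add: pt_lin TR.l_distr TR.r_distr ptc pt1 del: in_lists_conv_set)
  next
    fix D t d assume *: "D \<in> carrier T" "t \<in> L" "d \<in> L" "\<forall>w. bfun i (l1 @ w # l2) = pt t \<otimes>\<^bsub>T\<^esub> D \<otimes>\<^bsub>T\<^esub> pt (d @ w # l2)"
    show ?thesis using * l v v' by (simp add: pt_lin TR.l_distr TR.r_distr ptc pt1 del: in_lists_conv_set)
  next
    fix y t d assume *: "y \<in> carrier V" "t \<in> L" "d \<in> L" "\<forall>w. bfun i (l1 @ w # l2) = pt t \<otimes>\<^bsub>T\<^esub> c (pt [w, y]) \<otimes>\<^bsub>T\<^esub> pt d"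
    show ?thesis using * l v v' by (simp add: c_add1 c_closed TR.l_distr TR.r_distr ptc del: in_lists_conv_set)
  next
    fix y t d assume *: "y \<in> carrier V" "t \<in> L" "d \<in> L" "\<forall>w. bfun i (l1 @ w # l2) = pt t \<otimes>\<^bsub>T\<^esub> c (pt [y, w]) \<otimes>\<^bsub>T\<^esub> pt d"
    show ?thesis using * l v v' by (simp add: c_add2 c_closed TR.l_distr TR.r_distr ptc del: in_lists_conv_set)
  next
    assume "\<forall>w. bfun i (l1 @ w # l2) = \<zero>\<^bsub>T\<^esub>"
    then show ?thesis by simp
  qed
qed (rule bfun_closed)

lemmas braid_at_closed = tlift_closed[OF V TA_vspace[OF V] bfun_multilinear, folded braid_at_eq]
lemmas braid_at_add = tlift_add[OF V TA_vspace[OF V] bfun_multilinear, folded braid_at_eq]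
lemmas braid_at_smult = tlift_smult[OF V TA_vspace[OF V] bfun_multilinear, folded braid_at_eq]
lemmas braid_at_pure = tlift_pure[OF V TA_vspace[OF V] bfun_multilinear, folded braid_at_eq]

lemma map_transpose:
  assumes "Suc i < n"
  shows "map f [0..<n] = map f [0..<i] @ f i # f (Suc i) # map f [Suc (Suc i)..<n]"
    and "map (f \<circ> Transposition.transpose i (Suc i)) [0..<n] = map f [0..<i] @ f (Suc i) # f i # map f [Suc (Suc i)..<n]"
proof -
  have s: "[0..<n] = [0..<i] @ i # Suc i # [Suc (Suc i)..<n]"
    using assms upt_add_eq_append[of 0 i "n - i"] by (simp add: upt_conv_Cons)
  show "map f [0..<n] = map f [0..<i] @ f i # f (Suc i) # map f [Suc (Suc i)..<n]"
    unfolding s by simp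
  show "map (f \<circ> Transposition.transpose i (Suc i)) [0..<n] = map f [0..<i] @ f (Suc i) # f i # map f [Suc (Suc i)..<n]"
    unfolding s by (auto simp: Transposition.transpose_def)
qed

text \<open>Transposed to functionals, the braiding swaps two letters of the word and multiplies by
  a scalar. By linearity pure tensors suffice, and those of length other than \<open>n\<close> give
  zero on both sides.\<close>

lemma \<Psi>_braid_at:
  assumes "f ` {..<n} \<subseteq> A" "Suc i < n" "C \<in> carrier T"
  shows "\<Psi> (map f [0..<n]) (braid_at V c i C) = q (f (Suc i)) (f i) * \<Psi> (map (f \<circ> Transposition.transpose i (Suc i)) [0..<n]) C"
proof -
  let ?u = "map f [0..<n]" and ?u' = "map (f \<circ> Transposition.transpose i (Suc i)) [0..<n]"
  have u: "?u \<in> lists A" using assms(1) by (auto simp: image_subset_iff)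
  have fi: "f i \<in> A" "f (Suc i) \<in> A" and "set (map f [0..<i]) \<subseteq> A" "set (map f [Suc (Suc i)..<n]) \<subseteq> A"
    using assms by auto
  with fi have u': "?u' \<in> lists A" unfolding map_transpose(2)[OF assms(2)] by auto
  from assms(3) show ?thesis
  proof (induction rule: TA_induct[OF V, consumes 1, case_names pure add smult])
    case (pure l)
    have lhs: "\<Psi> ?u (braid_at V c i (pt l)) = \<Psi> ?u (bfun i l)" by (simp add: braid_at_pure[OF pure])
    show ?case
    proof (cases "Suc i < length l")
      case False
      then have "length ?u' \<noteq> length l" using assms(2) by auto
      then have c0: "coord \<xi> ?u' l = 0" by (rule coord_length)
      have b0: "bfun i l = \<zero>\<^bsub>T\<^esub>" using False by (simp add: bfun_def)
      show ?thesis unfolding lhs b0 \<Psi>_zero[OF u] \<Psi>_pure[OF u' pure] c0 by simp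
    next
      case True
      obtain t y z d where s: "l = t @ y # z # d" "length t = i" using split_at[OF True] .
      have tl: "t \<in> L" "d \<in> L" "y \<in> carrier V" "z \<in> carrier V" using pure s by auto
      have cl: "c (pt [y, z]) \<in> carrier T" using tl by (intro c_closed)
      show ?thesis
      proof (cases "length l = n")
        case True
        have *: "\<Psi> ?u (bfun i l) = coord \<xi> (take (length t) ?u) t * \<Psi> (take 2 (drop (length t) ?u)) (c (pt [y, z])) * coord \<xi> (drop (length t + 2) ?u) d"
          unfolding s(1) bfun_append[OF s(2)] using True s by (intro \<Psi>_mult(1)[OF u tl(1,2) cl]) simp
        have tk: "take (length t) ?u = map f [0..<i]" "take 2 (drop (length t) ?u) = [f i, f (Suc i)]" "drop (length t + 2) ?u = map f [Suc (Suc i)..<n]"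
          unfolding map_transpose(1)[OF assms(2)] using s(2) by simp_all
        have "\<Psi> [f i, f (Suc i)] (c (pt [y, z])) = q (f (Suc i)) (f i) * \<xi> (f i) z * \<xi> (f (Suc i)) y"
          unfolding \<Psi>_def using c_diag[of "[f i, f (Suc i)]" y z] tl fi by simp
        then have "\<Psi> ?u (bfun i l) = q (f (Suc i)) (f i) * coord \<xi> ?u' l"
          unfolding * tk unfolding map_transpose(2)[OF assms(2)] s(1) using s(2) by (simp add: coord_append)
        then show ?thesis unfolding lhs \<Psi>_pure[OF u' pure] .
      next
        case False
        have "\<Psi> ?u (bfun i l) = 0"
        proof (cases "n < length t + length d")
          case True
          then show ?thesis unfolding s(1) bfun_append[OF s(2)] using \<Psi>_mult(2)[OF u tl(1,2) cl] by simp
        next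
          case F: False
          define m where "m = n - (length t + length d)"
          have m: "m \<noteq> 2" "length ?u = length t + m + length d" using False F s by (auto simp: m_def)
          have len: "length (take m (drop (length t) ?u)) = m" using m by simp
          have "take m (drop (length t) ?u) \<in> lists A" using u by (auto dest: in_set_takeD in_set_dropD)
          moreover have "\<Psi> w (c (pt [y, z])) = 0" if "w \<in> lists A" "length w \<noteq> 2" for w
            unfolding \<Psi>_def using c_diag[of w y z] tl that by (auto split: list.splits)
          ultimately have "\<Psi> (take m (drop (length t) ?u)) (c (pt [y, z])) = 0"
            using len m(1) by metis
          then show ?thesis unfolding s(1) bfun_append[OF s(2)] \<Psi>_mult(1)[OF u tl(1,2) cl m(2)] by simp
        qed
        moreover have "coord \<xi> ?u' l = 0" using False by (intro coord_length) simp
        ultimately show ?thesis unfolding lhs \<Psi>_pure[OF u' pure] by simp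
      qed
    qed
  next
    case (add C D)
    show ?case
      by (simp only: braid_at_add[OF add(1,2)] \<Psi>_add[OF u braid_at_closed[OF add(1)] braid_at_closed[OF add(2)]]
        \<Psi>_add[OF u' add(1,2)] add(3,4) distrib_left)
  next
    case (smult a C)
    show ?case
      by (simp only: braid_at_smult[OF smult(1)] \<Psi>_smult[OF u braid_at_closed[OF smult(1)]]
        \<Psi>_smult[OF u' smult(1)] smult(2) mult.left_commute)
  qed
qed

lemma foldr_braid_at:
  assumes "C \<in> carrier T" "set is \<subseteq> {i. Suc i < n}"
  shows "foldr (\<lambda>i \<tau>. braid_at V c i \<circ> \<tau>) is id C \<in> carrier T"
    and "f ` {..<n} \<subseteq> A \<Longrightarrow> \<Psi> (map f [0..<n]) (foldr (\<lambda>i \<tau>. braid_at V c i \<circ> \<tau>) is id C) = wcoef q is f * \<Psi> (map (f \<circ> word_perm is) [0..<n]) C"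
proof -
  have cl: "foldr (\<lambda>i \<tau>. braid_at V c i \<circ> \<tau>) is id C \<in> carrier T" for "is"
    using assms(1) by (induction "is") (auto intro: braid_at_closed)
  then show "foldr (\<lambda>i \<tau>. braid_at V c i \<circ> \<tau>) is id C \<in> carrier T" .
  show "f ` {..<n} \<subseteq> A \<Longrightarrow> \<Psi> (map f [0..<n]) (foldr (\<lambda>i \<tau>. braid_at V c i \<circ> \<tau>) is id C) = wcoef q is f * \<Psi> (map (f \<circ> word_perm is) [0..<n]) C"
    using assms(2)
  proof (induction "is" arbitrary: f)
    case (Cons i "is")
    have i: "Suc i < n" using Cons.prems by simp
    have f': "(f \<circ> Transposition.transpose i (Suc i)) ` {..<n} \<subseteq> A"
      using Cons.prems(1) i by (auto simp: Transposition.transpose_def)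
    have "\<Psi> (map f [0..<n]) (foldr (\<lambda>i \<tau>. braid_at V c i \<circ> \<tau>) (i # is) id C)
      = q (f (Suc i)) (f i) * \<Psi> (map (f \<circ> Transposition.transpose i (Suc i)) [0..<n]) (foldr (\<lambda>i \<tau>. braid_at V c i \<circ> \<tau>) is id C)"
      using \<Psi>_braid_at[OF Cons.prems(1) i cl] by simp
    also have "\<dots> = q (f (Suc i)) (f i) * (wcoef q is (f \<circ> Transposition.transpose i (Suc i)) * \<Psi> (map ((f \<circ> Transposition.transpose i (Suc i)) \<circ> word_perm is) [0..<n]) C)"
      using Cons.prems(2) by (subst Cons.IH[OF f']) simp_all
    finally show ?case by (simp only: wcoef.simps word_perm_simps comp_assoc mult.assoc)
  qed simp
qed

lemma braid_perm_reduced: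
  assumes "\<sigma> permutes {..<n}" "C \<in> carrier T"
  shows "braid_perm V c n \<sigma> C \<in> carrier T"
    and "f ` {..<n} \<subseteq> A \<Longrightarrow> \<Psi> (map f [0..<n]) (braid_perm V c n \<sigma> C) = (\<Prod>(j, k)\<in>invs n \<sigma>. q (f (\<sigma> j)) (f (\<sigma> k))) * \<Psi> (map (f \<circ> \<sigma>) [0..<n]) C"
proof -
  define "is" where "is = (SOME is. reduced_expr n \<sigma> is)"
  have red: "reduced_expr n \<sigma> is" unfolding is_def using exists_reduced_expr[OF assms(1)] by (rule someI_ex)
  then have "set is \<subseteq> {i. Suc i < n}" "\<sigma> = word_perm is" by (auto simp: reduced_expr_def transp_word_iff)
  note * = foldr_braid_at[OF assms(2) this(1)] this(2)
  show "braid_perm V c n \<sigma> C \<in> carrier T" unfolding braid_perm_def is_def[symmetric] by (rule *(1))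
  show "f ` {..<n} \<subseteq> A \<Longrightarrow> \<Psi> (map f [0..<n]) (braid_perm V c n \<sigma> C) = (\<Prod>(j, k)\<in>invs n \<sigma>. q (f (\<sigma> j)) (f (\<sigma> k))) * \<Psi> (map (f \<circ> \<sigma>) [0..<n]) C"
    unfolding braid_perm_def is_def[symmetric] wcoef_reduced[OF red, symmetric] unfolding *(3) by (rule *(2))
qed

section \<open>Functionals and the defining ideal of the Nichols algebra\<close>

lemma \<Psi>_symmetrizer:
  assumes "C \<in> carrier T" "f ` {..<n} \<subseteq> A"
  shows "\<Psi> (map f [0..<n]) (quantum_symmetrizer V c n C)
    = (\<Sum>\<sigma> | \<sigma> permutes {..<n}. (\<Prod>(j, k)\<in>invs n \<sigma>. q (f (\<sigma> j)) (f (\<sigma> k))) * \<Psi> (map (f \<circ> \<sigma>) [0..<n]) C)"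
proof -
  have u: "map f [0..<n] \<in> lists A" using assms(2) by (auto simp: image_subset_iff)
  show ?thesis unfolding quantum_symmetrizer_def
    using assms by (subst \<Psi>_finsum[OF u]) (auto intro!: sum.cong simp: braid_perm_reduced finite_permutations)
qed

lemma permutes_lists: "\<sigma> permutes {..<n} \<Longrightarrow> f ` {..<n} \<subseteq> A \<Longrightarrow> map (f \<circ> \<sigma>) [0..<n] \<in> lists A"
  using permutes_in_image[of \<sigma> "{..<n}"] by (auto simp: image_subset_iff)

text \<open>A tensor has components in finitely many degrees only. Applied to a finite spanning set,
  this turns finite dimension into a bound on the length of words.\<close>

lemma \<Psi>_bounded:
  assumes "C \<in> carrier T"
  shows "\<exists>N. \<forall>u\<in>lists A. N \<le> length u \<longrightarrow> \<Psi> u C = 0"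
  using assms
proof (induction rule: TA_induct[OF V, consumes 1, case_names pure add smult])
  case (pure l)
  then show ?case by (intro exI[of _ "Suc (length l)"]) (auto simp: \<Psi>_pure coord_length simp del: in_lists_conv_set)
next
  case (add C D)
  then obtain N N' where "\<forall>u\<in>lists A. N \<le> length u \<longrightarrow> \<Psi> u C = 0" "\<forall>u\<in>lists A. N' \<le> length u \<longrightarrow> \<Psi> u D = 0" by blast
  then show ?case using add by (intro exI[of _ "max N N'"]) (simp add: \<Psi>_add del: in_lists_conv_set)
next
  case (smult a C)
  then show ?case by (auto simp: \<Psi>_smult simp del: in_lists_conv_set)
qed

lemma tensor_power_\<Psi>:
  assumes "C \<in> tensor_power V m" "u \<in> lists A" "length u \<noteq> m"
  shows "\<Psi> u C = 0"
  using assms(1) unfolding tensor_power_def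
proof (induction rule: lin_span_induct[OF TA_vspace[OF V], consumes 1, case_names carrier base zero add smult])
  case carrier show ?case using pure_tensor_closed[OF V] by auto
next
  case (base D)
  then obtain l where "l \<in> L" "length l = m" "D = pt l" by auto
  then show ?case using \<Psi>_pure[OF assms(2)] assms(3) by (simp add: coord_length del: in_lists_conv_set)
qed (use \<Psi>_zero[OF assms(2)] \<Psi>_add[OF assms(2)] \<Psi>_smult[OF assms(2)] in simp_all)

lemma tensor_power_closed: "tensor_power V m \<subseteq> carrier T"
  unfolding tensor_power_def using pure_tensor_closed[OF V]
  by (intro submoduleD(1)[OF TA_vspace[OF V] lin_span_submodule[OF TA_vspace[OF V]]]) auto

text \<open>Compose the functional of a word \<open>u\<close> of length \<open>n\<close> with the
  \<open>n\<close>-th quantum symmetrizer. The result kills the ideal and, once \<open>n\<close>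
  exceeds the degrees of representatives of a spanning set, those representatives too; so it is
  zero. Its value at the product of the vectors \<open>x s\<close> along \<open>v\<close> is
  \<open>qword q v wsingle u\<close>.\<close>

theorem qword_vanish:
  assumes "fin_dim (nichols_algebra V c)"
  shows "\<exists>N. \<forall>v\<in>lists A. N \<le> length v \<longrightarrow> qword q v wsingle = (\<lambda>u. 0)"
proof -
  define J where "J = nichols_ideal V c"
  define gens where "gens = (\<Union>n\<in>{2..}. {C \<in> tensor_power V n. quantum_symmetrizer V c n C = \<zero>\<^bsub>T\<^esub>})"
  have gens: "gens \<subseteq> carrier T" using tensor_power_closed by (auto simp: gens_def)
  have J: "J = lin_span T gens" by (simp add: J_def nichols_ideal_def gens_def)
  have Jsub: "submodule J kring T" unfolding J by (rule lin_span_submodule[OF TA_vspace[OF V] gens])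
  obtain B where B: "finite B" "B \<subseteq> carrier (quot_module T J)" "lin_span (quot_module T J) B = carrier (quot_module T J)"
    using assms unfolding fin_dim_def nichols_algebra_def J_def by blast
  have "\<forall>D\<in>B. \<exists>C. C \<in> carrier T \<and> D = J +>\<^bsub>T\<^esub> C"
    using B(2) unfolding quot_carrier[OF TA_vspace[OF V] Jsub] by blast
  then obtain rep where rep: "\<And>D. D \<in> B \<Longrightarrow> rep D \<in> carrier T \<and> D = J +>\<^bsub>T\<^esub> rep D" by metis
  have "\<forall>D\<in>B. \<exists>N. \<forall>u\<in>lists A. N \<le> length u \<longrightarrow> \<Psi> u (rep D) = 0" using rep \<Psi>_bounded by blast
  then obtain bd where bd: "\<And>D u. D \<in> B \<Longrightarrow> u \<in> lists A \<Longrightarrow> bd D \<le> length u \<Longrightarrow> \<Psi> u (rep D) = 0" by metis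
  define N where "N = (\<Sum>D\<in>B. bd D)"
  have N: "bd D \<le> N" if "D \<in> B" for D unfolding N_def using B(1) that by (simp add: member_le_sum)
  have "qword q v wsingle u = 0" if v: "v \<in> lists A" "N \<le> length v" for v u
  proof (rule ccontr)
    assume nz: "qword q v wsingle u \<noteq> 0"
    then have "mset u = mset v" by (rule qword_support)
    then have len: "length u = length v" and uA: "set u \<subseteq> A" using v(1) by (auto dest: mset_eq_length mset_eq_setD)
    define n where "n = length v"
    define f where "f = nth u"
    have u: "u = map f [0..<n]" by (simp add: f_def n_def flip: len) (simp add: map_nth)
    have fA: "f ` {..<n} \<subseteq> A" using uA by (auto simp: f_def n_def simp flip: len)
    \<comment> \<open>Written as a sum over permutations of functionals, this is linear in
      \<open>C\<close> at once, and it vanishes on tensor powers of degree other than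
      \<open>n\<close>.\<close>
    define \<Theta> where "\<Theta> C = (\<Sum>\<sigma> | \<sigma> permutes {..<n}. (\<Prod>(j, k)\<in>invs n \<sigma>. q (f (\<sigma> j)) (f (\<sigma> k))) * \<Psi> (map (f \<circ> \<sigma>) [0..<n]) C)" for C
    have pA: "\<And>\<sigma>. \<sigma> \<in> {\<sigma>. \<sigma> permutes {..<n}} \<Longrightarrow> map (f \<circ> \<sigma>) [0..<n] \<in> lists A" using permutes_lists[OF _ fA] by blast
    have lin: "\<Theta> (C \<oplus>\<^bsub>T\<^esub> D) = \<Theta> C + \<Theta> D" "\<Theta> (a \<odot>\<^bsub>T\<^esub> C) = a * \<Theta> C" if "C \<in> carrier T" "D \<in> carrier T" for C D a
    proof -
      show "\<Theta> (C \<oplus>\<^bsub>T\<^esub> D) = \<Theta> C + \<Theta> D"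
        unfolding \<Theta>_def sum.distrib[symmetric] using pA that by (intro sum.cong refl) (simp only: \<Psi>_add distrib_left)
      show "\<Theta> (a \<odot>\<^bsub>T\<^esub> C) = a * \<Theta> C"
        unfolding \<Theta>_def sum_distrib_left using pA that by (intro sum.cong refl) (simp only: \<Psi>_smult mult.left_commute)
    qed
    have kill: "\<Theta> C = 0" if "C \<in> J" for C
      using that unfolding J
    proof (induction rule: lin_span_induct[OF TA_vspace[OF V], consumes 1, case_names carrier base zero add smult])
      case carrier show ?case by (rule gens)
    next
      case (base C)
      then obtain m where m: "C \<in> tensor_power V m" "quantum_symmetrizer V c m C = \<zero>\<^bsub>T\<^esub>" by (auto simp: gens_def)
      show ?case
      proof (cases "m = n")
        case True
        then have "\<Theta> C = \<Psi> (map f [0..<n]) (quantum_symmetrizer V c m C)"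
          unfolding \<Theta>_def using base gens fA by (subst True, subst \<Psi>_symmetrizer) auto
        then show ?thesis using m(2) \<Psi>_zero[of "map f [0..<n]"] \<open>u = map f [0..<n]\<close> uA by (simp add: in_listsI subset_iff)
      next
        case False
        then have "\<Psi> (map (f \<circ> \<sigma>) [0..<n]) C = 0" if "\<sigma> \<in> {\<sigma>. \<sigma> permutes {..<n}}" for \<sigma>
          using tensor_power_\<Psi>[OF m(1) pA[OF that]] by simp
        then show ?thesis unfolding \<Theta>_def by (intro sum.neutral) simp
      qed
    next
      case zero
      show ?case using lin(2)[of "\<zero>\<^bsub>T\<^esub>" "\<zero>\<^bsub>T\<^esub>" 0] vs_laws(6)[OF TA_vspace[OF V]] by simp
    qed (use lin in simp_all)
    have xv: "map x v \<in> L" using v(1) x_closed by auto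
    have "\<Theta> (pt (map x v)) = 0"
    proof (rule quot_functional_zero[OF TA_vspace[OF V] Jsub lin(1) lin(2)[OF _ T.M.zero_closed] kill B(3,2)])
      fix C assume C: "C \<in> carrier T" "J +>\<^bsub>T\<^esub> C \<in> B"
      let ?D = "J +>\<^bsub>T\<^esub> C"
      have "\<Psi> (map (f \<circ> \<sigma>) [0..<n]) (rep ?D) = 0" if "\<sigma> \<in> {\<sigma>. \<sigma> permutes {..<n}}" for \<sigma>
        using bd[OF C(2) pA[OF that]] N[OF C(2)] v(2) by (simp add: n_def)
      then have "\<Theta> (rep ?D) = 0" unfolding \<Theta>_def by (intro sum.neutral) simp
      then show "\<exists>y\<in>carrier T. ?D = J +>\<^bsub>T\<^esub> y \<and> \<Theta> y = 0" using rep[OF C(2)] by blast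
    next
      show "pt (map x v) \<in> carrier T" by (rule pure_tensor_closed[OF V xv])
    qed
    moreover have "\<Theta> (pt (map x v)) = qword q v wsingle u"
    proof -
      have co: "coord \<xi> w (map x v) = (if w = v then 1 else 0)" if "w \<in> lists A" for w
        using that v(1)
      proof (induction w arbitrary: v)
        case Nil then show ?case by (cases v) auto
      next
        case (Cons a w)
        then show ?case by (cases v) (auto simp: \<xi>_x)
      qed
      have "\<Theta> (pt (map x v)) = (\<Sum>\<sigma> | \<sigma> permutes {..<n}. if map (f \<circ> \<sigma>) [0..<n] = v then (\<Prod>(j, k)\<in>invs n \<sigma>. q (f (\<sigma> j)) (f (\<sigma> k))) else 0)"
        unfolding \<Theta>_def using pA by (intro sum.cong refl) (simp only: \<Psi>_pure xv co, simp)
      then show ?thesis unfolding sum_permutes u[symmetric] .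
    qed
    ultimately show False using nz by simp
  qed
  then show ?thesis by blast
qed

end

section \<open>The Yetter-Drinfeld modules \<open>V(g, chi)\<close>\<close>

definition ulift :: "('k::field, 'w, 'n) module_scheme \<Rightarrow> ('s \<Rightarrow> 'w) \<Rightarrow> ('s \<Rightarrow> 'k) set \<Rightarrow> 'w" where
  "ulift W F C = the_elem (lext W F ` C)"

lemma qlift_coset:
  assumes W: "vspace W" and F: "\<And>s. s \<in> S \<Longrightarrow> F s \<in> carrier W"
    and N: "submodule N kring (free_module S)" and kill: "\<And>f. f \<in> N \<Longrightarrow> lext W F f = \<zero>\<^bsub>W\<^esub>"
    and f: "f \<in> carrier (free_module S)"
  shows "the_elem (lext W F ` (N +>\<^bsub>free_module S\<^esub> f)) = lext W F f"
proof -
  interpret W: Module.module kring W by (rule W)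
  have "lext W F h = lext W F f" if h: "h \<in> N +>\<^bsub>free_module S\<^esub> f" for h
  proof -
    from h obtain t where t: "t \<in> N" "h = t \<oplus>\<^bsub>free_module S\<^esub> f" unfolding a_r_coset_def' by blast
    have tc: "t \<in> carrier (free_module S)" using t(1) submoduleD(1)[OF free_module_vspace N] by blast
    have "lext W F (t \<oplus>\<^bsub>free_module S\<^esub> f) = lext W F t \<oplus>\<^bsub>W\<^esub> lext W F f"
      unfolding free_module_simps(3) by (rule lext_add[where S = S, OF W F tc f])
    also have "\<dots> = lext W F f" unfolding kill[OF t(1)] using lext_closed[where S = S, OF W F f] by simp
    finally show ?thesis unfolding t(2) .
  qed
  moreover have "N +>\<^bsub>free_module S\<^esub> f \<noteq> {}"
    using coset_self[OF free_module_vspace N f] by (rule ex_in_conv[THEN iffD1, OF exI])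
  ultimately show ?thesis by (intro the_elem_image_unique)
qed

lemma free_map_eval:
  assumes "finite Y" "{x. f x \<noteq> 0} \<subseteq> Y"
  shows "free_map \<phi> f y = (\<Sum>x\<in>Y. if \<phi> x = y then f x else 0)"
  unfolding free_map_def using assms by (subst sum.inter_filter[symmetric]) (auto intro!: sum.mono_neutral_left)

lemma free_map_add:
  assumes "finite {x. f x \<noteq> 0}" "finite {x. h x \<noteq> (0::'k::field)}"
  shows "free_map \<phi> (\<lambda>x. f x + h x) = (\<lambda>y. free_map \<phi> f y + free_map \<phi> h y)"
proof
  fix y
  let ?Y = "{x. f x \<noteq> 0} \<union> {x. h x \<noteq> 0}"
  have Y: "finite ?Y" using assms by simp
  show "free_map \<phi> (\<lambda>x. f x + h x) y = free_map \<phi> f y + free_map \<phi> h y"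
    by (subst (1 2 3) free_map_eval[OF Y]) (auto simp: sum.distrib[symmetric] intro!: sum.cong)
qed

lemma free_map_smult:
  assumes "finite {x. f x \<noteq> (0::'k::field)}"
  shows "free_map \<phi> (\<lambda>x. a * f x) = (\<lambda>y. a * free_map \<phi> f y)"
proof
  fix y
  show "free_map \<phi> (\<lambda>x. a * f x) y = a * free_map \<phi> f y"
    by (subst (1 2) free_map_eval[OF assms]) (auto simp: sum_distrib_left intro!: sum.cong)
qed

lemma free_map_single [simp]: "free_map \<phi> (single s) = single (\<phi> s)"
  by (rule ext, subst free_map_eval[of "{s}"]) (auto simp: single_apply)

lemma free_map_zero [simp]: "free_map \<phi> (\<lambda>x. 0) = (\<lambda>x. 0)"
  by (simp add: free_map_def)

lemma free_map_closed:
  assumes "f \<in> carrier (free_module S)" "\<phi> ` S \<subseteq> S'"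
  shows "free_map \<phi> f \<in> carrier (free_module S')"
proof -
  have "{y. free_map \<phi> f y \<noteq> 0} \<subseteq> \<phi> ` {x. f x \<noteq> 0}"
  proof clarify
    fix y assume "free_map \<phi> f y \<noteq> 0"
    then obtain x where "x \<in> {x. f x \<noteq> 0 \<and> \<phi> x = y}" unfolding free_map_def by (meson sum.not_neutral_contains_not_neutral)
    then show "y \<in> \<phi> ` {x. f x \<noteq> 0}" by blast
  qed
  then show ?thesis using assms by (auto intro: finite_subset finite_imageI)
qed

lemma free_map_comp:
  assumes "finite {x. f x \<noteq> (0::'k::field)}"
  shows "free_map \<psi> (free_map \<phi> f) = free_map (\<psi> \<circ> \<phi>) f"
proof -
  have "f \<in> carrier (free_module UNIV)" using assms by simp
  then show ?thesis
  proof (induction rule: free_module_induct)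
    case (add f s a)
    have s: "finite {x. single s x \<noteq> (0::'k)}" "finite {x. f x \<noteq> 0}" "finite {x. a * single s x \<noteq> (0::'k)}"
      using add(1) by (auto simp: single_apply)
    have f: "finite {y. free_map \<phi> f y \<noteq> 0}" using free_map_closed[OF add(1), of \<phi> UNIV] by simp
    have s': "finite {x. a * single (\<phi> s) x \<noteq> (0::'k)}" by (simp add: single_apply)
    have s'': "finite {x. single (\<phi> s) x \<noteq> (0::'k)}" by (simp add: single_apply)
    show ?case using add(3) s s' s'' f
      by (simp add: free_map_add free_map_smult)
  qed simp
qed

lemma free_map_eval_inj:
  assumes "finite {x. f x \<noteq> 0}" "\<And>x. f x \<noteq> 0 \<Longrightarrow> \<phi> x = y \<longleftrightarrow> x = x0"
  shows "free_map \<phi> f y = f x0"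
proof -
  have "(\<Sum>x\<in>{x. f x \<noteq> 0}. if \<phi> x = y then f x else 0) = (\<Sum>x\<in>{x. f x \<noteq> 0}. if x = x0 then f x else 0)"
    using assms(2) by (intro sum.cong) auto
  also have "\<dots> = f x0" using assms(1) by simp
  finally show ?thesis using free_map_eval[OF assms(1) subset_refl, of \<phi> y] by simp
qed

locale induced_yd = group G for G (structure) +
  fixes g :: 'a and chi :: "'a \<Rightarrow> 'k::field"
  assumes finG: "finite (carrier G)" and g: "g \<in> carrier G"
    and chi_mult: "\<And>x y. x \<in> centralizer G g \<Longrightarrow> y \<in> centralizer G g \<Longrightarrow> chi (x \<otimes> y) = chi x * chi y"
    and chi_nz: "\<And>x. x \<in> centralizer G g \<Longrightarrow> chi x \<noteq> 0"
begin

abbreviation "H \<equiv> centralizer G g"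
abbreviation "FG \<equiv> free_module (carrier G) :: ('k, 'a \<Rightarrow> 'k) module"
abbreviation "TG \<equiv> tensor_gens G :: ('k, ('a \<Rightarrow> 'k) \<times> 'k \<Rightarrow> 'k) module"
abbreviation "R \<equiv> tensor_rels G H chi"
abbreviation "V \<equiv> yd_V G g chi"

lemma H_sub: "z \<in> H \<Longrightarrow> z \<in> carrier G"
  by (simp add: centralizer_def)

lemma H_one: "\<one> \<in> H"
  using g by (simp add: centralizer_def)

lemma H_mult: "x \<in> H \<Longrightarrow> y \<in> H \<Longrightarrow> x \<otimes> y \<in> H"
  using g by (simp add: centralizer_def) (metis m_assoc)

lemma H_inv: "x \<in> H \<Longrightarrow> inv x \<in> H"
  using g by (simp add: centralizer_def) (metis inv_solve_left inv_solve_right m_assoc m_closed inv_closed)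

lemma finH: "finite H"
  using finG by (rule rev_finite_subset) (auto simp: centralizer_def)

lemma chi_one: "chi \<one> = 1"
  using chi_mult[OF H_one H_one] chi_nz[OF H_one] by simp

definition rgens :: "(('a \<Rightarrow> 'k) \<times> 'k \<Rightarrow> 'k) set" where
  "rgens = {single (a \<oplus>\<^bsub>FG\<^esub> b, w) \<ominus>\<^bsub>TG\<^esub> (single (a, w) \<oplus>\<^bsub>TG\<^esub> single (b, w)) | a b w.
           a \<in> carrier FG \<and> b \<in> carrier FG} \<union>
        {single (a, v + w) \<ominus>\<^bsub>TG\<^esub> (single (a, v) \<oplus>\<^bsub>TG\<^esub> single (a, w)) | a v w. a \<in> carrier FG} \<union>
        {single (r \<odot>\<^bsub>FG\<^esub> a, w) \<ominus>\<^bsub>TG\<^esub> r \<odot>\<^bsub>TG\<^esub> single (a, w) | r a w. a \<in> carrier FG} \<union>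
        {single (a, r * w) \<ominus>\<^bsub>TG\<^esub> r \<odot>\<^bsub>TG\<^esub> single (a, w) | r a w. a \<in> carrier FG} \<union>
        {single (free_map (\<lambda>y. y \<otimes> z) a, w) \<ominus>\<^bsub>TG\<^esub> single (a, chi z * w) | a z w.
           a \<in> carrier FG \<and> z \<in> H}"

lemma R_eq: "R = lin_span TG rgens"
  by (simp add: tensor_rels_def rgens_def Let_def)

lemma TG_eq: "TG = free_module (carrier FG \<times> UNIV)"
  by (simp add: tensor_gens_def)

lemma TG_vspace: "vspace TG"
  unfolding TG_eq by (rule free_module_vspace)

lemma FG_vspace: "vspace FG"
  by (rule free_module_vspace)

lemma TG_single: "single (a, w) \<in> carrier TG \<longleftrightarrow> a \<in> carrier FG"
  unfolding TG_eq single_carrier by (simp del: free_module_simps)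

lemma mult_free_map_closed:
  "a \<in> carrier FG \<Longrightarrow> z \<in> carrier G \<Longrightarrow> free_map (\<lambda>y. y \<otimes> z) a \<in> carrier FG"
  "a \<in> carrier FG \<Longrightarrow> z \<in> carrier G \<Longrightarrow> free_map (\<lambda>y. z \<otimes> y) a \<in> carrier FG"
  by (erule free_map_closed, blast)+

text \<open>The generators are written as \<open>\<Sum> c\<^sub>i (a\<^sub>i, w\<^sub>i)\<close> so that linear maps are evaluated on them uniformly.\<close>

lemma rgens_cases:
  assumes "f \<in> rgens"
  obtains (add1) a b w where "a \<in> carrier FG" "b \<in> carrier FG"
      "f = single (a \<oplus>\<^bsub>FG\<^esub> b, w) \<oplus>\<^bsub>TG\<^esub> (- 1) \<odot>\<^bsub>TG\<^esub> (single (a, w) \<oplus>\<^bsub>TG\<^esub> single (b, w))"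
    | (add2) a v w where "a \<in> carrier FG"
      "f = single (a, v + w) \<oplus>\<^bsub>TG\<^esub> (- 1) \<odot>\<^bsub>TG\<^esub> (single (a, v) \<oplus>\<^bsub>TG\<^esub> single (a, w))"
    | (sm1) r a w where "a \<in> carrier FG" "f = single (r \<odot>\<^bsub>FG\<^esub> a, w) \<oplus>\<^bsub>TG\<^esub> (- 1) \<odot>\<^bsub>TG\<^esub> (r \<odot>\<^bsub>TG\<^esub> single (a, w))"
    | (sm2) r a w where "a \<in> carrier FG" "f = single (a, r * w) \<oplus>\<^bsub>TG\<^esub> (- 1) \<odot>\<^bsub>TG\<^esub> (r \<odot>\<^bsub>TG\<^esub> single (a, w))"
    | (bal) a z w where "a \<in> carrier FG" "z \<in> H"
      "f = single (free_map (\<lambda>y. y \<otimes> z) a, w) \<oplus>\<^bsub>TG\<^esub> (- 1) \<odot>\<^bsub>TG\<^esub> single (a, chi z * w)"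
proof -
  note d = vs_diff[OF TG_vspace]
  note ac = vs_closed(1)[OF TG_vspace] and sc = vs_closed(3)[OF TG_vspace]
    and fac = vs_closed(1)[OF FG_vspace] and fsc = vs_closed(3)[OF FG_vspace]
  note s = TG_single[THEN iffD2]
  from assms consider
      (1) a b w where "a \<in> carrier FG" "b \<in> carrier FG" "f = single (a \<oplus>\<^bsub>FG\<^esub> b, w) \<ominus>\<^bsub>TG\<^esub> (single (a, w) \<oplus>\<^bsub>TG\<^esub> single (b, w))"
    | (2) a v w where "a \<in> carrier FG" "f = single (a, v + w) \<ominus>\<^bsub>TG\<^esub> (single (a, v) \<oplus>\<^bsub>TG\<^esub> single (a, w))"
    | (3) r a w where "a \<in> carrier FG" "f = single (r \<odot>\<^bsub>FG\<^esub> a, w) \<ominus>\<^bsub>TG\<^esub> r \<odot>\<^bsub>TG\<^esub> single (a, w)"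
    | (4) r a w where "a \<in> carrier FG" "f = single (a, r * w) \<ominus>\<^bsub>TG\<^esub> r \<odot>\<^bsub>TG\<^esub> single (a, w)"
    | (5) a z w where "a \<in> carrier FG" "z \<in> H" "f = single (free_map (\<lambda>y. y \<otimes> z) a, w) \<ominus>\<^bsub>TG\<^esub> single (a, chi z * w)"
    unfolding rgens_def Un_iff mem_Collect_eq by blast
  then show thesis
  proof cases
    case 1
    show ?thesis by (rule add1[OF 1(1,2), of w]) (unfold 1(3), intro d s ac fac 1)
  next
    case 2
    show ?thesis by (rule add2[OF 2(1), of v w]) (unfold 2(2), intro d s ac 2)
  next
    case 3
    show ?thesis by (rule sm1[OF 3(1), of r w]) (unfold 3(2), intro d s sc fsc 3)
  next
    case 4
    show ?thesis by (rule sm2[OF 4(1), of r w]) (unfold 4(2), intro d s sc 4)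
  next
    case 5
    show ?thesis by (rule bal[OF 5(1,2), of w]) (unfold 5(3), intro d s mult_free_map_closed H_sub 5)
  qed
qed

lemma rgens_closed: "rgens \<subseteq> carrier TG"
proof
  note ac = vs_closed(1)[OF TG_vspace] and sc = vs_closed(3)[OF TG_vspace]
    and fac = vs_closed(1)[OF FG_vspace] and fsc = vs_closed(3)[OF FG_vspace]
  note s = TG_single[THEN iffD2]
  fix f assume "f \<in> rgens"
  then show "f \<in> carrier TG"
  proof (cases rule: rgens_cases)
    case (add1 a b w) then show ?thesis by (simp only:) (intro ac sc s fac)
  next
    case (add2 a v w) then show ?thesis by (simp only:) (intro ac sc s)
  next
    case (sm1 r a w) then show ?thesis by (simp only:) (intro ac sc s fsc)
  next
    case (sm2 r a w) then show ?thesis by (simp only:) (intro ac sc s)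
  next
    case (bal a z w) then show ?thesis by (simp only:) (intro ac sc s mult_free_map_closed H_sub)
  qed
qed

lemma R_sub: "submodule R kring TG"
  unfolding R_eq by (rule lin_span_submodule[OF TG_vspace rgens_closed])

lemma V_simps:
  "carrier V = carrier (quot_module TG R)" "\<zero>\<^bsub>V\<^esub> = \<zero>\<^bsub>quot_module TG R\<^esub>"
  "(\<oplus>\<^bsub>V\<^esub>) = (\<oplus>\<^bsub>quot_module TG R\<^esub>)" "(\<odot>\<^bsub>V\<^esub>) = (\<odot>\<^bsub>quot_module TG R\<^esub>)"
  "act V = induced_act G H chi"
  by (simp_all add: yd_V_def induced_module_def Let_def)

lemma Q_vspace: "vspace (quot_module TG R)"
  by (rule quot_vspace[OF TG_vspace R_sub])

text \<open>\<open>yd_V\<close> copies the quotient module into a larger record, so the module laws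
  are transported field by field.\<close>

lemma V_vspace: "vspace V"
proof -
  interpret Q: Module.module kring "quot_module TG R" by (rule Q_vspace)
  show ?thesis
  proof (rule vspaceI, unfold V_simps)
    fix x y assume "x \<in> carrier (quot_module TG R)" "y \<in> carrier (quot_module TG R)"
    then show "x \<oplus>\<^bsub>quot_module TG R\<^esub> y = y \<oplus>\<^bsub>quot_module TG R\<^esub> x" by (rule Q.M.a_comm)
  qed (simp_all add: vs_laws[OF Q_vspace] Q.M.a_assoc)
qed

interpretation V: Module.module kring V by (rule V_vspace)

lemma V_carrier: "carrier V = (\<lambda>f. R +>\<^bsub>TG\<^esub> f) ` carrier TG"
  unfolding V_simps by (rule quot_carrier[OF TG_vspace R_sub])

lemma V_add: "f \<in> carrier TG \<Longrightarrow> h \<in> carrier TG \<Longrightarrow> (R +>\<^bsub>TG\<^esub> f) \<oplus>\<^bsub>V\<^esub> (R +>\<^bsub>TG\<^esub> h) = R +>\<^bsub>TG\<^esub> (f \<oplus>\<^bsub>TG\<^esub> h)"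
  unfolding V_simps by (rule quot_add[OF TG_vspace R_sub])

lemma V_smult: "f \<in> carrier TG \<Longrightarrow> a \<odot>\<^bsub>V\<^esub> (R +>\<^bsub>TG\<^esub> f) = R +>\<^bsub>TG\<^esub> (a \<odot>\<^bsub>TG\<^esub> f)"
  unfolding V_simps by (rule quot_smult[OF TG_vspace R_sub])

lemma V_zero: "\<zero>\<^bsub>V\<^esub> = R +>\<^bsub>TG\<^esub> \<zero>\<^bsub>TG\<^esub>"
  unfolding V_simps by (rule quot_zero[OF TG_vspace R_sub])

abbreviation \<pi> where "\<pi> \<equiv> induced_tensor G H chi"

lemma \<pi>_closed: "a \<in> carrier FG \<Longrightarrow> \<pi> a w \<in> carrier V"
  unfolding induced_tensor_def V_carrier by (intro imageI TG_single[THEN iffD2])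

lemma rel_eq:
  assumes "f \<ominus>\<^bsub>TG\<^esub> h \<in> rgens" "f \<in> carrier TG" "h \<in> carrier TG"
  shows "R +>\<^bsub>TG\<^esub> f = R +>\<^bsub>TG\<^esub> h"
  using lin_span_superset[OF TG_vspace, of rgens] assms(1) unfolding R_eq[symmetric]
  by (intro coset_eq_iff[OF TG_vspace R_sub assms(2,3), THEN iffD2]) blast

lemma \<pi>_add1:
  assumes "a \<in> carrier FG" "b \<in> carrier FG"
  shows "\<pi> (a \<oplus>\<^bsub>FG\<^esub> b) w = \<pi> a w \<oplus>\<^bsub>V\<^esub> \<pi> b w"
proof -
  have c: "single (a, w) \<in> carrier TG" "single (b, w) \<in> carrier TG" "single (a \<oplus>\<^bsub>FG\<^esub> b, w) \<in> carrier TG"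
    using assms vs_closed(1)[OF FG_vspace assms] by (simp_all only: TG_single)
  have "single (a \<oplus>\<^bsub>FG\<^esub> b, w) \<ominus>\<^bsub>TG\<^esub> (single (a, w) \<oplus>\<^bsub>TG\<^esub> single (b, w)) \<in> rgens"
    using assms unfolding rgens_def by blast
  from rel_eq[OF this c(3) vs_closed(1)[OF TG_vspace c(1,2)]] show ?thesis
    unfolding induced_tensor_def V_add[OF c(1,2)] .
qed

lemma \<pi>_add2:
  assumes "a \<in> carrier FG"
  shows "\<pi> a (v + w) = \<pi> a v \<oplus>\<^bsub>V\<^esub> \<pi> a w"
proof -
  have c: "single (a, w) \<in> carrier TG" "single (a, v) \<in> carrier TG" "single (a, v + w) \<in> carrier TG"
    using assms by (simp_all only: TG_single)
  have "single (a, v + w) \<ominus>\<^bsub>TG\<^esub> (single (a, v) \<oplus>\<^bsub>TG\<^esub> single (a, w)) \<in> rgens"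
    using assms unfolding rgens_def by blast
  from rel_eq[OF this c(3) vs_closed(1)[OF TG_vspace c(2,1)]] show ?thesis
    unfolding induced_tensor_def V_add[OF c(2,1)] .
qed

lemma \<pi>_smult1:
  assumes "a \<in> carrier FG"
  shows "\<pi> (r \<odot>\<^bsub>FG\<^esub> a) w = r \<odot>\<^bsub>V\<^esub> \<pi> a w"
proof -
  have c: "single (a, w) \<in> carrier TG" "single (r \<odot>\<^bsub>FG\<^esub> a, w) \<in> carrier TG"
    using assms vs_closed(3)[OF FG_vspace assms] by (simp_all only: TG_single)
  have "single (r \<odot>\<^bsub>FG\<^esub> a, w) \<ominus>\<^bsub>TG\<^esub> r \<odot>\<^bsub>TG\<^esub> single (a, w) \<in> rgens"
    using assms unfolding rgens_def by blast
  from rel_eq[OF this c(2) vs_closed(3)[OF TG_vspace c(1)]] show ?thesis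
    unfolding induced_tensor_def V_smult[OF c(1)] .
qed

lemma \<pi>_smult2:
  assumes "a \<in> carrier FG"
  shows "\<pi> a (r * w) = r \<odot>\<^bsub>V\<^esub> \<pi> a w"
proof -
  have c: "single (a, w) \<in> carrier TG" "single (a, r * w) \<in> carrier TG"
    using assms by (simp_all only: TG_single)
  have "single (a, r * w) \<ominus>\<^bsub>TG\<^esub> r \<odot>\<^bsub>TG\<^esub> single (a, w) \<in> rgens"
    using assms unfolding rgens_def by blast
  from rel_eq[OF this c(2) vs_closed(3)[OF TG_vspace c(1)]] show ?thesis
    unfolding induced_tensor_def V_smult[OF c(1)] .
qed

lemma \<pi>_bal:
  assumes "a \<in> carrier FG" "z \<in> H"
  shows "\<pi> (free_map (\<lambda>y. y \<otimes> z) a) w = \<pi> a (chi z * w)"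
proof -
  have c: "single (free_map (\<lambda>y. y \<otimes> z) a, w) \<in> carrier TG" "single (a, chi z * w) \<in> carrier TG"
    using assms mult_free_map_closed(1)[OF assms(1) H_sub[OF assms(2)]] by (simp_all only: TG_single)
  have "single (free_map (\<lambda>y. y \<otimes> z) a, w) \<ominus>\<^bsub>TG\<^esub> single (a, chi z * w) \<in> rgens"
    using assms unfolding rgens_def by blast
  from rel_eq[OF this c] show ?thesis unfolding induced_tensor_def .
qed

abbreviation e where "e h w \<equiv> \<pi> (single h) w"

lemma e_closed: "h \<in> carrier G \<Longrightarrow> e h w \<in> carrier V"
  by (intro \<pi>_closed) (simp only: single_carrier)

lemma V_induct [consumes 1, case_names e add smult]:
  assumes "v \<in> carrier V" "\<And>h w. h \<in> carrier G \<Longrightarrow> P (e h w)"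
    "\<And>v w. v \<in> carrier V \<Longrightarrow> w \<in> carrier V \<Longrightarrow> P v \<Longrightarrow> P w \<Longrightarrow> P (v \<oplus>\<^bsub>V\<^esub> w)"
    "\<And>a v. v \<in> carrier V \<Longrightarrow> P v \<Longrightarrow> P (a \<odot>\<^bsub>V\<^esub> v)"
  shows "P v"
proof -
  have "P (0 \<odot>\<^bsub>V\<^esub> e \<one> 0)" by (intro assms(4,2) e_closed) simp_all
  then have P0: "P \<zero>\<^bsub>V\<^esub>" using vs_laws(5)[OF V_vspace e_closed] by simp
  have P\<pi>: "P (\<pi> a w)" if "a \<in> carrier FG" for a w
    using that
  proof (induction rule: free_module_induct)
    case zero
    have s: "single \<one> \<in> carrier FG" by (simp only: single_carrier one_closed)
    have "\<pi> (0 \<odot>\<^bsub>FG\<^esub> single \<one>) w = 0 \<odot>\<^bsub>V\<^esub> \<pi> (single \<one>) w" by (rule \<pi>_smult1[OF s])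
    then have "\<pi> (\<lambda>x. 0) w = \<zero>\<^bsub>V\<^esub>" using vs_laws(5)[OF V_vspace \<pi>_closed[OF s]] by simp
    then show ?case using P0 by simp
  next
    case (add a h r)
    have s: "single h \<in> carrier FG" using add by (simp only: single_carrier)
    have rs: "r \<odot>\<^bsub>FG\<^esub> single h \<in> carrier FG" by (rule vs_closed(3)[OF FG_vspace s])
    have "(\<lambda>x. a x + r * single h x) = a \<oplus>\<^bsub>FG\<^esub> (r \<odot>\<^bsub>FG\<^esub> single h)" by simp
    then have "\<pi> (\<lambda>x. a x + r * single h x) w = \<pi> a w \<oplus>\<^bsub>V\<^esub> (r \<odot>\<^bsub>V\<^esub> e h w)"
      using \<pi>_add1[OF add(1) rs] \<pi>_smult1[OF s] by simp
    then show ?case using add(3) assms(2)[OF add(2)] \<pi>_closed[OF add(1)] \<pi>_closed[OF s] vs_closed(3)[OF V_vspace]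
      by (simp only:) (intro assms(3,4) vs_closed(3)[OF V_vspace])
  qed
  obtain f where f: "f \<in> carrier TG" "v = R +>\<^bsub>TG\<^esub> f" using assms(1) unfolding V_carrier by blast
  have "f \<in> carrier (free_module (carrier FG \<times> UNIV))" using f(1) unfolding TG_eq .
  then have "P (R +>\<^bsub>TG\<^esub> f)"
  proof (induction rule: free_module_induct)
    case zero
    have "\<zero>\<^bsub>TG\<^esub> = (\<lambda>x. 0)" by (simp add: TG_eq)
    then show ?case using P0 unfolding V_zero by simp
  next
    case (add f s r)
    obtain a w where s: "s = (a, w)" "a \<in> carrier FG" using add(2) by blast
    have sc: "single s \<in> carrier TG" unfolding s(1) TG_single by (rule s(2))
    have fc: "f \<in> carrier TG" using add(1) unfolding TG_eq .
    have rs: "r \<odot>\<^bsub>TG\<^esub> single s \<in> carrier TG" by (rule vs_closed(3)[OF TG_vspace sc])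
    have "(\<lambda>x. f x + r * single s x) = f \<oplus>\<^bsub>TG\<^esub> (r \<odot>\<^bsub>TG\<^esub> single s)" by (simp add: TG_eq)
    then have "R +>\<^bsub>TG\<^esub> (\<lambda>x. f x + r * single s x) = (R +>\<^bsub>TG\<^esub> f) \<oplus>\<^bsub>V\<^esub> (r \<odot>\<^bsub>V\<^esub> \<pi> a w)"
      using V_add[OF fc rs] V_smult[OF sc] s(1) by (simp add: induced_tensor_def)
    moreover have "R +>\<^bsub>TG\<^esub> f \<in> carrier V" using fc unfolding V_carrier by blast
    ultimately show ?case using add(3) P\<pi>[OF s(2)] \<pi>_closed[OF s(2)] vs_closed(3)[OF V_vspace]
      by (simp only:) (intro assms(3,4) vs_closed(3)[OF V_vspace])
  qed
  then show ?thesis using f by simp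
qed

section \<open>The universal property of the tensor product over the group algebra of the
  centralizer\<close>

definition balanced :: "('k, 'w, 'n) module_scheme \<Rightarrow> (('a \<Rightarrow> 'k) \<times> 'k \<Rightarrow> 'w) \<Rightarrow> bool" where
  "balanced W F \<longleftrightarrow> vspace W \<and> (\<forall>a\<in>carrier FG. \<forall>w. F (a, w) \<in> carrier W) \<and>
    (\<forall>a\<in>carrier FG. \<forall>b\<in>carrier FG. \<forall>w. F (a \<oplus>\<^bsub>FG\<^esub> b, w) = F (a, w) \<oplus>\<^bsub>W\<^esub> F (b, w)) \<and>
    (\<forall>a\<in>carrier FG. \<forall>v w. F (a, v + w) = F (a, v) \<oplus>\<^bsub>W\<^esub> F (a, w)) \<and>
    (\<forall>a\<in>carrier FG. \<forall>r w. F (r \<odot>\<^bsub>FG\<^esub> a, w) = r \<odot>\<^bsub>W\<^esub> F (a, w) \<and> F (a, r * w) = r \<odot>\<^bsub>W\<^esub> F (a, w)) \<and>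
    (\<forall>a\<in>carrier FG. \<forall>z\<in>H. \<forall>w. F (free_map (\<lambda>y. y \<otimes> z) a, w) = F (a, chi z * w))"

context
  fixes W :: "('k, 'w, 'n) module_scheme" and F
  assumes bal: "balanced W F"
begin

lemma W_vspace: "vspace W"
  using bal by (simp add: balanced_def)

interpretation W: Module.module kring W by (rule W_vspace)

lemma F_closed': "s \<in> carrier FG \<times> UNIV \<Longrightarrow> F s \<in> carrier W"
  using bal unfolding balanced_def by blast

lemma lext_TG:
  "f \<in> carrier TG \<Longrightarrow> lext W F f \<in> carrier W"
  "f \<in> carrier TG \<Longrightarrow> h \<in> carrier TG \<Longrightarrow> lext W F (f \<oplus>\<^bsub>TG\<^esub> h) = lext W F f \<oplus>\<^bsub>W\<^esub> lext W F h"
  "f \<in> carrier TG \<Longrightarrow> lext W F (a \<odot>\<^bsub>TG\<^esub> f) = a \<odot>\<^bsub>W\<^esub> lext W F f"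
  "b \<in> carrier FG \<Longrightarrow> lext W F (single (b, w)) = F (b, w)"
proof -
  show "f \<in> carrier TG \<Longrightarrow> lext W F f \<in> carrier W"
    unfolding TG_eq by (rule lext_closed[where S = "carrier FG \<times> UNIV", OF W_vspace F_closed'])
  show "f \<in> carrier TG \<Longrightarrow> h \<in> carrier TG \<Longrightarrow> lext W F (f \<oplus>\<^bsub>TG\<^esub> h) = lext W F f \<oplus>\<^bsub>W\<^esub> lext W F h"
    unfolding TG_eq free_module_simps(3) by (rule lext_add[where S = "carrier FG \<times> UNIV", OF W_vspace F_closed'])
  show "f \<in> carrier TG \<Longrightarrow> lext W F (a \<odot>\<^bsub>TG\<^esub> f) = a \<odot>\<^bsub>W\<^esub> lext W F f"
    unfolding TG_eq free_module_simps(4) by (rule lext_smult[where S = "carrier FG \<times> UNIV", OF W_vspace F_closed'])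
  show "b \<in> carrier FG \<Longrightarrow> lext W F (single (b, w)) = F (b, w)"
  proof -
    assume "b \<in> carrier FG"
    then have "(b, w) \<in> carrier FG \<times> UNIV" by (rule SigmaI) (rule UNIV_I)
    then have *: "(b, w) \<in> carrier FG \<times> UNIV" .
    show ?thesis by (rule lext_single[where S = "carrier FG \<times> UNIV", OF W_vspace F_closed']) (assumption | rule *)+
  qed
qed

lemma lext_R:
  assumes "f \<in> R" shows "lext W F f = \<zero>\<^bsub>W\<^esub>"
  using assms unfolding R_eq
proof (induction rule: lin_span_induct[OF TG_vspace, consumes 1, case_names carrier base zero add smult])
  case carrier show ?case by (rule rgens_closed)
next
  case zero
  have "\<zero>\<^bsub>TG\<^esub> = (\<lambda>x. 0)" by (simp add: TG_eq)
  then show ?case using lext_zero[OF W_vspace] by simp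
next
  case (add f h)
  then show ?case by (simp add: lext_TG(2))
next
  case (smult a f)
  then show ?case using vs_laws(6)[OF W_vspace] by (simp add: lext_TG(3))
next
  case (base f)
  note ac = vs_closed(1)[OF TG_vspace] and sc = vs_closed(3)[OF TG_vspace]
    and fac = vs_closed(1)[OF FG_vspace] and fsc = vs_closed(3)[OF FG_vspace]
  note s = TG_single[THEN iffD2]
  have neg: "x \<oplus>\<^bsub>W\<^esub> (- 1) \<odot>\<^bsub>W\<^esub> x = \<zero>\<^bsub>W\<^esub>" if "x \<in> carrier W" for x
    using that vs_diff[OF W_vspace that that] by (simp add: a_minus_def W.M.r_neg)
  have Fc: "F (a, w) \<in> carrier W" if "a \<in> carrier FG" for a w using F_closed' that by blast
  from base show ?case
  proof (cases rule: rgens_cases)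
    case (add1 a b w)
    have "lext W F f = F (a \<oplus>\<^bsub>FG\<^esub> b, w) \<oplus>\<^bsub>W\<^esub> (- 1) \<odot>\<^bsub>W\<^esub> (F (a, w) \<oplus>\<^bsub>W\<^esub> F (b, w))"
      unfolding add1(3) by (simp only: lext_TG s ac sc fac add1(1,2))
    also have "F (a \<oplus>\<^bsub>FG\<^esub> b, w) = F (a, w) \<oplus>\<^bsub>W\<^esub> F (b, w)" using bal add1 unfolding balanced_def by blast
    finally show ?thesis using neg[OF vs_closed(1)[OF W_vspace Fc Fc]] add1 by simp
  next
    case (add2 a v w)
    have "lext W F f = F (a, v + w) \<oplus>\<^bsub>W\<^esub> (- 1) \<odot>\<^bsub>W\<^esub> (F (a, v) \<oplus>\<^bsub>W\<^esub> F (a, w))"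
      unfolding add2(2) by (simp only: lext_TG s ac sc add2(1))
    also have "F (a, v + w) = F (a, v) \<oplus>\<^bsub>W\<^esub> F (a, w)" using bal add2 unfolding balanced_def by blast
    finally show ?thesis using neg[OF vs_closed(1)[OF W_vspace Fc Fc]] add2 by simp
  next
    case (sm1 r a w)
    have "lext W F f = F (r \<odot>\<^bsub>FG\<^esub> a, w) \<oplus>\<^bsub>W\<^esub> (- 1) \<odot>\<^bsub>W\<^esub> (r \<odot>\<^bsub>W\<^esub> F (a, w))"
      unfolding sm1(2) by (simp only: lext_TG s ac sc fsc sm1(1))
    also have "F (r \<odot>\<^bsub>FG\<^esub> a, w) = r \<odot>\<^bsub>W\<^esub> F (a, w)" using bal sm1 unfolding balanced_def by blast
    finally show ?thesis using neg[OF vs_closed(3)[OF W_vspace Fc]] sm1 by simp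
  next
    case (sm2 r a w)
    have "lext W F f = F (a, r * w) \<oplus>\<^bsub>W\<^esub> (- 1) \<odot>\<^bsub>W\<^esub> (r \<odot>\<^bsub>W\<^esub> F (a, w))"
      unfolding sm2(2) by (simp only: lext_TG s ac sc sm2(1))
    also have "F (a, r * w) = r \<odot>\<^bsub>W\<^esub> F (a, w)" using bal sm2 unfolding balanced_def by blast
    finally show ?thesis using neg[OF vs_closed(3)[OF W_vspace Fc]] sm2 by simp
  next
    case (bal a z w)
    have "lext W F f = F (free_map (\<lambda>y. y \<otimes> z) a, w) \<oplus>\<^bsub>W\<^esub> (- 1) \<odot>\<^bsub>W\<^esub> F (a, chi z * w)"
      unfolding bal(3) by (simp only: lext_TG s ac sc mult_free_map_closed(1) H_sub bal(1,2))
    also have "F (free_map (\<lambda>y. y \<otimes> z) a, w) = F (a, chi z * w)" using \<open>balanced W F\<close> bal unfolding balanced_def by blast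
    finally show ?thesis using neg[OF Fc] bal by simp
  qed
qed

lemma ulift_coset: "f \<in> carrier TG \<Longrightarrow> ulift W F (R +>\<^bsub>TG\<^esub> f) = lext W F f"
  unfolding ulift_def using R_sub lext_R unfolding TG_eq
  by (intro qlift_coset[where S = "carrier FG \<times> UNIV", OF W_vspace F_closed'])

lemma ulift_closed: "v \<in> carrier V \<Longrightarrow> ulift W F v \<in> carrier W"
  unfolding V_carrier by (elim imageE) (simp only: ulift_coset lext_TG)

lemma ulift_add: "v \<in> carrier V \<Longrightarrow> w \<in> carrier V \<Longrightarrow> ulift W F (v \<oplus>\<^bsub>V\<^esub> w) = ulift W F v \<oplus>\<^bsub>W\<^esub> ulift W F w"
  unfolding V_carrier by (elim imageE) (simp only: V_add ulift_coset lext_TG vs_closed[OF TG_vspace])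

lemma ulift_smult: "v \<in> carrier V \<Longrightarrow> ulift W F (a \<odot>\<^bsub>V\<^esub> v) = a \<odot>\<^bsub>W\<^esub> ulift W F v"
  unfolding V_carrier by (elim imageE) (simp only: V_smult ulift_coset lext_TG vs_closed[OF TG_vspace])

lemma ulift_\<pi>: "a \<in> carrier FG \<Longrightarrow> ulift W F (\<pi> a w) = F (a, w)"
  unfolding induced_tensor_def by (simp only: ulift_coset TG_single lext_TG)

end

subsection \<open>Coordinates, action and grading\<close>

text \<open>The coordinate at the vector \<open>e x 1\<close>. Summing over the coset of
  \<open>x\<close> with the weights \<open>chi z\<close> makes the formula respect the balancing
  relation, hence descend to the tensor product.\<close>

definition \<Phi> :: "'a \<Rightarrow> (('a \<Rightarrow> 'k) \<times> 'k \<Rightarrow> 'k) set \<Rightarrow> 'k" where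
  "\<Phi> x = ulift kspace (\<lambda>(a, w). \<Sum>z\<in>H. a (x \<otimes> z) * chi z * w)"

lemma free_map_mult_right:
  assumes "a \<in> carrier FG" "z \<in> carrier G" "y \<in> carrier G"
  shows "free_map (\<lambda>y. y \<otimes> z) a y = a (y \<otimes> inv z)"
proof (rule free_map_eval_inj)
  show "finite {x. a x \<noteq> 0}" using assms by simp
  fix x assume "a x \<noteq> 0"
  then have "x \<in> carrier G" using assms(1) by auto
  then show "(x \<otimes> z = y) = (x = y \<otimes> inv z)" using assms inv_solve_right by metis
qed

lemma \<Phi>_balanced:
  assumes x: "x \<in> carrier G"
  shows "balanced kspace (\<lambda>(a, w). \<Sum>z\<in>H. a (x \<otimes> z) * chi z * w)"
proof -
  have "(\<Sum>z'\<in>H. free_map (\<lambda>y. y \<otimes> z) a (x \<otimes> z') * chi z' * w) = (\<Sum>z'\<in>H. a (x \<otimes> z') * chi z' * (chi z * w))"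
    if a: "a \<in> carrier FG" and z: "z \<in> H" for a z w
  proof -
    have "(\<Sum>z'\<in>H. free_map (\<lambda>y. y \<otimes> z) a (x \<otimes> z') * chi z' * w) = (\<Sum>z'\<in>H. a (x \<otimes> (z' \<otimes> inv z)) * chi z' * w)"
      using x z H_sub by (intro sum.cong refl) (simp add: free_map_mult_right[OF a] m_assoc)
    \<comment> \<open>The substitution \<open>z' \<mapsto> z' \<otimes> z\<close> moves
      \<open>z\<close> from the argument of \<open>a\<close> into that of
      \<open>chi\<close>.\<close>
    also have "\<dots> = (\<Sum>z'\<in>H. a (x \<otimes> z') * chi (z' \<otimes> z) * w)"
      by (rule sum.reindex_bij_witness[of _ "\<lambda>y. y \<otimes> z" "\<lambda>y. y \<otimes> inv z"])
        (use z H_sub H_mult H_inv in \<open>auto simp: m_assoc\<close>)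
    also have "\<dots> = (\<Sum>z'\<in>H. a (x \<otimes> z') * chi z' * (chi z * w))"
      using z by (intro sum.cong refl) (simp add: chi_mult mult.assoc)
    finally show ?thesis .
  qed
  then show ?thesis
    unfolding balanced_def case_prod_conv kspace_simps free_module_simps(3,4)
    by (intro conjI ballI allI kspace_vspace UNIV_I)
      (simp_all only: sum.distrib[symmetric] sum_distrib_left distrib_left distrib_right mult.assoc mult.left_commute[of _ "r::'k" for r])
qed

lemmas \<Phi>_add = ulift_add[OF \<Phi>_balanced, folded \<Phi>_def, unfolded kspace_simps]
lemmas \<Phi>_smult = ulift_smult[OF \<Phi>_balanced, folded \<Phi>_def, unfolded kspace_simps]
lemmas \<Phi>_\<pi> = ulift_\<pi>[OF \<Phi>_balanced, folded \<Phi>_def, unfolded case_prod_conv]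

lemma \<Phi>_e:
  assumes "x \<in> carrier G" "h \<in> carrier G"
  shows "\<Phi> x (e h w) = (if inv x \<otimes> h \<in> H then chi (inv x \<otimes> h) * w else 0)"
proof -
  have s: "single h \<in> carrier FG" using assms(2) by (simp only: single_carrier)
  have "\<Phi> x (e h w) = (\<Sum>z\<in>H. if z = inv x \<otimes> h then chi z * w else 0)"
    unfolding \<Phi>_\<pi>[OF assms(1) s]
  proof (rule sum.cong[OF refl])
    fix z assume "z \<in> H"
    then have "x \<otimes> z = h \<longleftrightarrow> z = inv x \<otimes> h" using assms H_sub inv_solve_left by metis
    then show "single h (x \<otimes> z) * chi z * w = (if z = inv x \<otimes> h then chi z * w else 0)"
      by (simp add: single_apply)
  qed
  then show ?thesis using finH by simp
qed

text \<open>Left multiplication by \<open>y\<close> descends because it commutes with right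
  multiplication by the centralizer.\<close>

lemma act_balanced:
  assumes y: "y \<in> carrier G"
  shows "balanced V (\<lambda>(a, w). \<pi> (free_map (\<lambda>x. y \<otimes> x) a) w)"
proof -
  note mc = mult_free_map_closed(2)[OF _ y]
  have fin: "finite {x. a x \<noteq> 0}" if "a \<in> carrier FG" for a using that by simp
  have add: "free_map (\<lambda>x. y \<otimes> x) (a \<oplus>\<^bsub>FG\<^esub> b) = free_map (\<lambda>x. y \<otimes> x) a \<oplus>\<^bsub>FG\<^esub> free_map (\<lambda>x. y \<otimes> x) b"
    if "a \<in> carrier FG" "b \<in> carrier FG" for a b
    unfolding free_module_simps(3) by (rule free_map_add[OF fin[OF that(1)] fin[OF that(2)]])
  have smult: "free_map (\<lambda>x. y \<otimes> x) (r \<odot>\<^bsub>FG\<^esub> a) = r \<odot>\<^bsub>FG\<^esub> free_map (\<lambda>x. y \<otimes> x) a"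
    if "a \<in> carrier FG" for a r
    unfolding free_module_simps(4) by (rule free_map_smult[OF fin[OF that]])
  have comm: "free_map (\<lambda>x. y \<otimes> x) (free_map (\<lambda>x. x \<otimes> z) a) = free_map (\<lambda>x. x \<otimes> z) (free_map (\<lambda>x. y \<otimes> x) a)"
    if a: "a \<in> carrier FG" and z: "z \<in> H" for a z
  proof -
    have "free_map ((\<lambda>x. y \<otimes> x) \<circ> (\<lambda>x. x \<otimes> z)) a = free_map ((\<lambda>x. x \<otimes> z) \<circ> (\<lambda>x. y \<otimes> x)) a"
      unfolding free_map_def
    proof (intro ext sum.cong refl Collect_cong conj_cong)
      fix x t assume "a x \<noteq> 0"
      then have "x \<in> carrier G" using a by auto
      then show "(((\<lambda>x. y \<otimes> x) \<circ> (\<lambda>x. x \<otimes> z)) x = t) = (((\<lambda>x. x \<otimes> z) \<circ> (\<lambda>x. y \<otimes> x)) x = t)"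
        using y z H_sub by (simp add: m_assoc)
    qed
    then show ?thesis by (simp only: free_map_comp[OF fin[OF a]])
  qed
  show ?thesis
    unfolding balanced_def case_prod_conv
    by (intro conjI ballI allI V_vspace)
      (simp_all only: add smult comm mc \<pi>_closed \<pi>_add1 \<pi>_add2 \<pi>_smult1 \<pi>_smult2 \<pi>_bal)
qed

text \<open>\<open>induced_act\<close> is a union over all representatives of a coset. Identified
  with a lift, it is a single coset and linear.\<close>

lemma act_eq:
  assumes y: "y \<in> carrier G" and v: "v \<in> carrier V"
  shows "act V y v = ulift V (\<lambda>(a, w). \<pi> (free_map (\<lambda>x. y \<otimes> x) a) w) v"
proof -
  let ?F = "\<lambda>(a, w). \<pi> (free_map (\<lambda>x. y \<otimes> x) a) w"
  let ?\<theta> = "\<lambda>(a, w). (free_map (\<lambda>x. y \<otimes> x) a, w)"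
  note bal = act_balanced[OF y]
  have key: "R +>\<^bsub>TG\<^esub> free_map ?\<theta> f = lext V ?F f" if "f \<in> carrier TG" for f
  proof -
    have "f \<in> carrier (free_module (carrier FG \<times> UNIV))" using that unfolding TG_eq .
    then show ?thesis
    proof (induction rule: free_module_induct)
      case zero
      have "\<zero>\<^bsub>TG\<^esub> = (\<lambda>x. 0)" by (simp add: TG_eq)
      then show ?case using lext_zero[OF V_vspace, of ?F] unfolding V_zero by simp
    next
      case (add f s r)
      obtain a w where s: "s = (a, w)" "a \<in> carrier FG" using add(2) by blast
      have ya: "free_map (\<lambda>x. y \<otimes> x) a \<in> carrier FG" by (rule mult_free_map_closed(2)[OF s(2) y])
      have sc: "single s \<in> carrier TG" "single (?\<theta> s) \<in> carrier TG" unfolding s(1) case_prod_conv TG_single by (rule s(2), rule ya)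
      have fc: "f \<in> carrier TG" using add(1) unfolding TG_eq .
      have im: "?\<theta> ` (carrier FG \<times> UNIV) \<subseteq> carrier FG \<times> UNIV" using mult_free_map_closed(2)[OF _ y] by auto
      have fmc: "free_map ?\<theta> f \<in> carrier TG" using free_map_closed[OF add(1) im] unfolding TG_eq .
      have rs: "r \<odot>\<^bsub>TG\<^esub> single s \<in> carrier TG" "r \<odot>\<^bsub>TG\<^esub> single (?\<theta> s) \<in> carrier TG" by (rule vs_closed(3)[OF TG_vspace sc(1)], rule vs_closed(3)[OF TG_vspace sc(2)])
      have eq: "(\<lambda>x. f x + r * single s x) = f \<oplus>\<^bsub>TG\<^esub> (r \<odot>\<^bsub>TG\<^esub> single s)" by (simp add: TG_eq)
      have fin: "finite {x. f x \<noteq> 0}" "finite {x. r * single s x \<noteq> (0::'k)}" "finite {x. single s x \<noteq> (0::'k)}"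
        using add(1) by (auto simp: single_apply)
      have "free_map ?\<theta> (\<lambda>x. f x + r * single s x) = free_map ?\<theta> f \<oplus>\<^bsub>TG\<^esub> (r \<odot>\<^bsub>TG\<^esub> single (?\<theta> s))"
        unfolding free_map_add[OF fin(1,2)] free_map_smult[OF fin(3)] free_map_single by (simp add: TG_eq)
      then have "R +>\<^bsub>TG\<^esub> free_map ?\<theta> (\<lambda>x. f x + r * single s x) = (R +>\<^bsub>TG\<^esub> free_map ?\<theta> f) \<oplus>\<^bsub>V\<^esub> (r \<odot>\<^bsub>V\<^esub> (R +>\<^bsub>TG\<^esub> single (?\<theta> s)))"
        by (simp only: V_add[OF fmc rs(2)] V_smult[OF sc(2)])
      also have "R +>\<^bsub>TG\<^esub> single (?\<theta> s) = ?F s" unfolding s(1) case_prod_conv induced_tensor_def ..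
      also have "(R +>\<^bsub>TG\<^esub> free_map ?\<theta> f) \<oplus>\<^bsub>V\<^esub> (r \<odot>\<^bsub>V\<^esub> ?F s) = lext V ?F (\<lambda>x. f x + r * single s x)"
        unfolding add(3) eq lext_TG(2)[OF bal fc rs(1)] lext_TG(3)[OF bal sc(1)]
        unfolding s(1) lext_TG(4)[OF bal s(2)] ..
      finally show ?case .
    qed
  qed
  obtain f where f: "f \<in> carrier TG" "v = R +>\<^bsub>TG\<^esub> f" using v unfolding V_carrier by blast
  have "act V y v = (\<Union>f'\<in>v. R +>\<^bsub>TG\<^esub> free_map ?\<theta> f')"
    by (simp only: V_simps induced_act_def)
  also have "\<dots> = (\<Union>f'\<in>v. lext V ?F f)"
  proof (rule SUP_cong[OF refl])
    fix f' assume "f' \<in> v"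
    then have f': "f' \<in> carrier TG" "R +>\<^bsub>TG\<^esub> f' = R +>\<^bsub>TG\<^esub> f"
      using coset_memD[OF TG_vspace R_sub, of f' f] f by auto
    then show "R +>\<^bsub>TG\<^esub> free_map ?\<theta> f' = lext V ?F f"
      using key[OF f'(1)] ulift_coset[OF bal f'(1)] ulift_coset[OF bal f(1)] by (simp only:)
  qed
  also have "\<dots> = lext V ?F f" using coset_self[OF TG_vspace R_sub f(1)] f(2) by blast
  finally show ?thesis unfolding f(2) ulift_coset[OF bal f(1)] .
qed

lemma act_closed: "y \<in> carrier G \<Longrightarrow> v \<in> carrier V \<Longrightarrow> act V y v \<in> carrier V"
  by (simp only: act_eq ulift_closed[OF act_balanced])

lemma act_add: "y \<in> carrier G \<Longrightarrow> v \<in> carrier V \<Longrightarrow> w \<in> carrier V \<Longrightarrow> act V y (v \<oplus>\<^bsub>V\<^esub> w) = act V y v \<oplus>\<^bsub>V\<^esub> act V y w"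
  by (simp only: act_eq vs_closed[OF V_vspace] ulift_add[OF act_balanced])

lemma act_smult: "y \<in> carrier G \<Longrightarrow> v \<in> carrier V \<Longrightarrow> act V y (a \<odot>\<^bsub>V\<^esub> v) = a \<odot>\<^bsub>V\<^esub> act V y v"
  by (simp only: act_eq vs_closed[OF V_vspace] ulift_smult[OF act_balanced])

lemma act_e: "y \<in> carrier G \<Longrightarrow> h \<in> carrier G \<Longrightarrow> act V y (e h w) = e (y \<otimes> h) w"
proof -
  assume yh: "y \<in> carrier G" "h \<in> carrier G"
  have s: "single h \<in> carrier FG" using yh(2) by (simp only: single_carrier)
  show ?thesis
    unfolding act_eq[OF yh(1) e_closed[OF yh(2)]] ulift_\<pi>[OF act_balanced[OF yh(1)] s] case_prod_conv free_map_single ..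
qed

lemma e_mult: "h \<in> carrier G \<Longrightarrow> z \<in> H \<Longrightarrow> e (h \<otimes> z) w = e h (chi z * w)"
  using \<pi>_bal[of "single h" z w] by (simp only: single_carrier free_map_single)

text \<open>If \<open>y\<close> fixes the coset of \<open>x\<close>, it scales the coordinate there,
  and this for every \<open>v\<close>. From here comes the dual form of diagonality.\<close>

lemma \<Phi>_act:
  assumes "x \<in> carrier G" "y \<in> carrier G" "inv x \<otimes> y \<otimes> x \<in> H" "v \<in> carrier V"
  shows "\<Phi> x (act V y v) = chi (inv x \<otimes> y \<otimes> x) * \<Phi> x v"
  using assms(4)
proof (induction rule: V_induct)
  case (e h w)
  let ?z = "inv x \<otimes> y \<otimes> x"
  have eq: "inv x \<otimes> (y \<otimes> h) = ?z \<otimes> (inv x \<otimes> h)"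
    using assms e by (simp add: m_assoc) (metis inv_closed m_assoc m_closed r_inv l_one)
  have "?z \<otimes> (inv x \<otimes> h) \<in> H \<longleftrightarrow> inv x \<otimes> h \<in> H"
  proof
    assume "?z \<otimes> (inv x \<otimes> h) \<in> H"
    from H_mult[OF H_inv[OF assms(3)] this] have "inv ?z \<otimes> (?z \<otimes> (inv x \<otimes> h)) \<in> H" .
    moreover have "inv z \<otimes> (z \<otimes> b) = b" if "z \<in> carrier G" "b \<in> carrier G" for z b
      using that by (simp add: m_assoc[symmetric])
    from this[of ?z "inv x \<otimes> h"] have "inv ?z \<otimes> (?z \<otimes> (inv x \<otimes> h)) = inv x \<otimes> h"
      using assms e by simp
    ultimately show "inv x \<otimes> h \<in> H" by simp
  qed (rule H_mult[OF assms(3)])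
  then show ?case
    using assms e by (simp add: act_e \<Phi>_e eq chi_mult del: H_mult)
next
  case (add v w)
  then show ?case using assms by (simp add: act_add \<Phi>_add act_closed distrib_left)
next
  case (smult a v)
  then show ?case using assms by (simp add: act_smult \<Phi>_smult act_closed)
qed

section \<open>The grading and its homogeneous components\<close>

abbreviation cdeg where "cdeg h \<equiv> h \<otimes> g \<otimes> inv h"

lemma cdeg_eq_iff:
  assumes "x \<in> carrier G" "h \<in> carrier G"
  shows "inv x \<otimes> h \<in> H \<longleftrightarrow> cdeg x = cdeg h"
proof -
  have "inv x \<otimes> h \<in> H \<longleftrightarrow> inv x \<otimes> h \<otimes> g = g \<otimes> (inv x \<otimes> h)"
    using assms by (simp add: centralizer_def)
  also have "\<dots> \<longleftrightarrow> cdeg x = cdeg h"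
  proof
    assume *: "inv x \<otimes> h \<otimes> g = g \<otimes> (inv x \<otimes> h)"
    have "cdeg h = x \<otimes> (inv x \<otimes> h \<otimes> g) \<otimes> inv h" using assms g by (simp add: m_assoc[symmetric])
    also have "\<dots> = x \<otimes> (g \<otimes> (inv x \<otimes> h)) \<otimes> inv h" by (simp only: *)
    also have "\<dots> = cdeg x" using assms g by (simp add: m_assoc)
    finally show "cdeg x = cdeg h" by simp
  next
    assume *: "cdeg x = cdeg h"
    have "inv x \<otimes> h \<otimes> g = inv x \<otimes> cdeg h \<otimes> h" using assms g by (simp add: m_assoc)
    also have "\<dots> = inv x \<otimes> cdeg x \<otimes> h" by (simp only: *)
    also have "\<dots> = g \<otimes> (inv x \<otimes> h)" using assms g by (simp add: m_assoc[symmetric])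
    finally show "inv x \<otimes> h \<otimes> g = g \<otimes> (inv x \<otimes> h)" .
  qed
  finally show ?thesis .
qed

text \<open>The grading is defined as a span in the underlying module record; that record and
  \<open>V\<close> have the same submodules.\<close>

lemma deg_eq: "deg V t = lin_span V {e h w | h w. h \<in> carrier G \<and> cdeg h = t}"
proof -
  have minv: "m_inv (add_monoid V) x = m_inv (add_monoid (quot_module TG R)) x" for x
    unfolding m_inv_def by (simp add: V_simps)
  have "submodule N kring V \<longleftrightarrow> submodule N kring (quot_module TG R)" for N
    unfolding submodule_def submodule_axioms_def subgroup_def minv by (simp add: V_simps)
  then show ?thesis unfolding lin_span_def by (simp add: yd_V_def induced_module_def Let_def lin_span_def)
qed

lemma deg_sub: "deg V t \<subseteq> carrier V" "submodule (deg V t) kring V"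
proof -
  have *: "{e h w | h w. h \<in> carrier G \<and> cdeg h = t} \<subseteq> carrier V" using e_closed by blast
  show "submodule (deg V t) kring V" unfolding deg_eq by (rule lin_span_submodule[OF V_vspace *])
  then show "deg V t \<subseteq> carrier V" by (rule submoduleD(1)[OF V_vspace])
qed

lemma e_deg: "h \<in> carrier G \<Longrightarrow> e h w \<in> deg V (cdeg h)"
  unfolding deg_eq by (rule subsetD[OF lin_span_superset[OF V_vspace]]) blast

text \<open>Group elements of equal degree lie in one coset of the centralizer, which acts through
  \<open>chi\<close>; so the component is at most a line.\<close>

lemma deg_one_dim:
  assumes "h \<in> carrier G" "v \<in> deg V (cdeg h)"
  shows "\<exists>w. v = e h w"
  using assms(2) unfolding deg_eq
proof (induction rule: lin_span_induct[OF V_vspace, consumes 1, case_names carrier base zero add smult])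
  case carrier show ?case using e_closed by blast
next
  case (base v)
  then obtain h' w where h': "v = e h' w" "h' \<in> carrier G" "cdeg h' = cdeg h" by blast
  then have z: "inv h \<otimes> h' \<in> H" using cdeg_eq_iff[OF assms(1)] by simp
  have "h' = h \<otimes> (inv h \<otimes> h')" using assms(1) h'(2) by (simp add: m_assoc[symmetric])
  then have "v = e h (chi (inv h \<otimes> h') * w)" using e_mult[OF assms(1) z, of w] h'(1) by simp
  then show ?case by blast
next
  case zero
  have "single h \<in> carrier FG" using assms by (simp only: single_carrier)
  then have "e h (0 * 0) = 0 \<odot>\<^bsub>V\<^esub> e h 0" by (rule \<pi>_smult2)
  then show ?case using vs_laws(5)[OF V_vspace e_closed[OF assms(1)]] by metis
next
  case (add v v')
  have "single h \<in> carrier FG" using assms by (simp only: single_carrier)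
  then show ?case using add \<pi>_add2 by metis
next
  case (smult a v)
  have "single h \<in> carrier FG" using assms by (simp only: single_carrier)
  then show ?case using smult \<pi>_smult2 by metis
qed

lemma deg_trivial:
  assumes "\<not> (\<exists>h\<in>carrier G. cdeg h = t)" shows "deg V t = {\<zero>\<^bsub>V\<^esub>}"
proof -
  have "{e h w | h w. h \<in> carrier G \<and> cdeg h = t} = {}" using assms by blast
  then have "deg V t = lin_span V {}" unfolding deg_eq by (rule arg_cong)
  moreover have "submodule {\<zero>\<^bsub>V\<^esub>} kring V"
    by (rule submoduleI'[OF V_vspace]) (auto simp: vs_laws[OF V_vspace])
  ultimately show ?thesis
    using lin_span_minimal[OF V_vspace, of "{\<zero>\<^bsub>V\<^esub>}" "{}"] submoduleD(2)[OF V_vspace deg_sub(2)] by blast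
qed

lemma \<Phi>_deg:
  assumes "x \<in> carrier G" "v \<in> deg V t" "cdeg x \<noteq> t"
  shows "\<Phi> x v = 0"
  using assms(2) unfolding deg_eq
proof (induction rule: lin_span_induct[OF V_vspace, consumes 1, case_names carrier base zero add smult])
  case carrier show ?case using e_closed by blast
next
  case (base v)
  then show ?case using assms cdeg_eq_iff[OF assms(1)] by (auto simp: \<Phi>_e)
next
  case zero
  show ?case using \<Phi>_smult[OF assms(1) vs_closed(2)[OF V_vspace], of 0] vs_laws(6)[OF V_vspace] by simp
qed (simp_all add: \<Phi>_add[OF assms(1)] \<Phi>_smult[OF assms(1)])

lemma \<Phi>_finsum:
  assumes "x \<in> carrier G" "finite I" "\<And>i. i \<in> I \<Longrightarrow> F i \<in> carrier V"
  shows "\<Phi> x (finsum V F I) = (\<Sum>i\<in>I. \<Phi> x (F i))"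
  using assms(2,3)
proof (induction I rule: finite_induct)
  case empty
  show ?case using \<Phi>_smult[OF assms(1) vs_closed(2)[OF V_vspace], of 0] vs_laws(6)[OF V_vspace] by simp
next
  case (insert i I)
  have "finsum V F (insert i I) = F i \<oplus>\<^bsub>V\<^esub> finsum V F I"
    using insert by (intro V.M.finsum_insert) auto
  moreover have "finsum V F I \<in> carrier V" using insert by (intro V.M.finsum_closed) auto
  ultimately show ?case using insert \<Phi>_add[OF assms(1)] by simp
qed

definition decomp where
  "decomp v u \<longleftrightarrow> (\<forall>t\<in>carrier G. u t \<in> deg V t) \<and> v = (\<Oplus>\<^bsub>V\<^esub>t\<in>carrier G. u t)"

lemma \<Phi>_decomp:
  assumes "decomp v u" "x \<in> carrier G"
  shows "\<Phi> x v = \<Phi> x (u (cdeg x))"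
proof -
  have u: "t \<in> carrier G \<Longrightarrow> u t \<in> carrier V" for t using assms deg_sub by (auto simp: decomp_def)
  have "\<Phi> x v = (\<Sum>t\<in>carrier G. \<Phi> x (u t))"
    using assms u by (simp add: decomp_def \<Phi>_finsum[OF assms(2) finG])
  also have "\<dots> = (\<Sum>t\<in>carrier G. if t = cdeg x then \<Phi> x (u t) else 0)"
    using assms by (intro sum.cong refl) (auto simp: decomp_def intro: \<Phi>_deg)
  also have "\<dots> = \<Phi> x (u (cdeg x))" using finG g assms by simp
  finally show ?thesis .
qed

text \<open>A component in a degree conjugate to \<open>g\<close> has the form \<open>e h w\<close>,
  and \<Phi> recovers \<open>w\<close>; in other degrees it is zero. This justifies the choice made
  in \<open>homog_component\<close>.\<close>

lemma decomp_unique: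
  assumes "decomp v u" "decomp v u'" "t \<in> carrier G"
  shows "u t = u' t"
proof (cases "\<exists>h\<in>carrier G. cdeg h = t")
  case True
  then obtain h where h: "h \<in> carrier G" "cdeg h = t" by blast
  obtain w w' where w: "u t = e h w" "u' t = e h w'"
    using deg_one_dim[OF h(1)] assms h(2) unfolding decomp_def by metis
  have "\<Phi> h (e h w) = \<Phi> h (e h w')"
    using \<Phi>_decomp[OF assms(1) h(1)] \<Phi>_decomp[OF assms(2) h(1)] w h(2) by simp
  then show ?thesis using w h(1) H_one by (simp add: \<Phi>_e chi_one)
next
  case False
  then have "deg V t = {\<zero>\<^bsub>V\<^esub>}" by (rule deg_trivial)
  moreover have "u t \<in> deg V t" "u' t \<in> deg V t" using assms unfolding decomp_def by simp_all
  ultimately show ?thesis by simp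
qed

lemma decomp_add:
  assumes "decomp v u" "decomp v' u'"
  shows "decomp (v \<oplus>\<^bsub>V\<^esub> v') (\<lambda>t. u t \<oplus>\<^bsub>V\<^esub> u' t)"
  unfolding decomp_def
proof (intro conjI ballI)
  show "u t \<oplus>\<^bsub>V\<^esub> u' t \<in> deg V t" if "t \<in> carrier G" for t
    using assms that submoduleD(3)[OF V_vspace deg_sub(2)] by (auto simp: decomp_def)
  have "u \<in> carrier G \<rightarrow> carrier V" "u' \<in> carrier G \<rightarrow> carrier V" using assms deg_sub(1) by (auto simp: decomp_def)
  from V.M.finsum_addf[OF this] show "v \<oplus>\<^bsub>V\<^esub> v' = (\<Oplus>\<^bsub>V\<^esub>t\<in>carrier G. u t \<oplus>\<^bsub>V\<^esub> u' t)"
    using assms by (simp add: decomp_def)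
qed

lemma decomp_smult:
  assumes "decomp v u"
  shows "decomp (a \<odot>\<^bsub>V\<^esub> v) (\<lambda>t. a \<odot>\<^bsub>V\<^esub> u t)"
  unfolding decomp_def
proof (intro conjI ballI)
  show "a \<odot>\<^bsub>V\<^esub> u t \<in> deg V t" if "t \<in> carrier G" for t
    using assms that submoduleD(4)[OF V_vspace deg_sub(2)] by (auto simp: decomp_def)
  have u: "u \<in> carrier G \<rightarrow> carrier V" using assms deg_sub(1) by (auto simp: decomp_def)
  show "a \<odot>\<^bsub>V\<^esub> v = (\<Oplus>\<^bsub>V\<^esub>t\<in>carrier G. a \<odot>\<^bsub>V\<^esub> u t)"
    using V.finsum_smult_ldistr[OF finG _ u, of a] assms by (simp add: decomp_def)
qed

lemma decomp_e:
  assumes h: "h \<in> carrier G"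
  shows "decomp (e h w) (\<lambda>t. if t = cdeg h then e h w else \<zero>\<^bsub>V\<^esub>)"
  unfolding decomp_def
proof (intro conjI ballI)
  have c: "cdeg h \<in> carrier G" using h g by simp
  show "(if t = cdeg h then e h w else \<zero>\<^bsub>V\<^esub>) \<in> deg V t" for t
    using e_deg[OF h] submoduleD(2)[OF V_vspace deg_sub(2)] by simp
  have "(\<Oplus>\<^bsub>V\<^esub>t\<in>carrier G. if cdeg h = t then e h w else \<zero>\<^bsub>V\<^esub>) = e h w"
    using V.M.add.finprod_singleton[OF c finG, of "\<lambda>_. e h w"] e_closed[OF h] by simp
  moreover have "(\<lambda>t. if cdeg h = t then e h w else \<zero>\<^bsub>V\<^esub>) = (\<lambda>t. if t = cdeg h then e h w else \<zero>\<^bsub>V\<^esub>)"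
    by (intro ext if_cong eq_commute refl)
  ultimately show "e h w = (\<Oplus>\<^bsub>V\<^esub>t\<in>carrier G. if t = cdeg h then e h w else \<zero>\<^bsub>V\<^esub>)" by simp
qed

lemma decomp_exists: "v \<in> carrier V \<Longrightarrow> \<exists>u. decomp v u"
  by (induction rule: V_induct) (blast intro: decomp_e decomp_add decomp_smult)+

abbreviation comp where "comp \<equiv> homog_component G V"

lemma comp_eq: "decomp v u \<Longrightarrow> t \<in> carrier G \<Longrightarrow> comp t v = u t"
proof -
  assume *: "decomp v u" "t \<in> carrier G"
  have "decomp v (SOME u. decomp v u)" by (rule someI[of "decomp v", OF *(1)])
  from decomp_unique[OF this *] show ?thesis by (simp add: homog_component_def decomp_def)
qed

lemma comp_props:
  assumes "t \<in> carrier G" "v \<in> carrier V"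
  shows "comp t v \<in> carrier V"
    "w \<in> carrier V \<Longrightarrow> comp t (v \<oplus>\<^bsub>V\<^esub> w) = comp t v \<oplus>\<^bsub>V\<^esub> comp t w"
    "comp t (a \<odot>\<^bsub>V\<^esub> v) = a \<odot>\<^bsub>V\<^esub> comp t v"
    "x \<in> carrier G \<Longrightarrow> \<Phi> x (comp t v) = (if t = cdeg x then \<Phi> x v else 0)"
proof -
  obtain u where u: "decomp v u" using decomp_exists[OF assms(2)] by blast
  have ut: "comp t v = u t" "u t \<in> deg V t" using comp_eq[OF u assms(1)] u assms(1) by (auto simp: decomp_def)
  then show "comp t v \<in> carrier V" using deg_sub(1) by auto
  show "comp t (a \<odot>\<^bsub>V\<^esub> v) = a \<odot>\<^bsub>V\<^esub> comp t v" using comp_eq[OF decomp_smult[OF u] assms(1)] ut by simp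
  show "comp t (v \<oplus>\<^bsub>V\<^esub> w) = comp t v \<oplus>\<^bsub>V\<^esub> comp t w" if w: "w \<in> carrier V"
  proof -
    obtain u' where u': "decomp w u'" using decomp_exists[OF w] by blast
    show ?thesis using comp_eq[OF decomp_add[OF u u'] assms(1)] comp_eq[OF u' assms(1)] ut by simp
  qed
  show "\<Phi> x (comp t v) = (if t = cdeg x then \<Phi> x v else 0)" if "x \<in> carrier G"
    using \<Phi>_deg[OF that ut(2)] \<Phi>_decomp[OF u that] ut(1) by auto
qed

subsection \<open>The braiding\<close>

definition cfun where
  "cfun l = (case l of
         [v, w] \<Rightarrow> (\<Oplus>\<^bsub>tensor_alg V\<^esub>h\<in>carrier G. pure_tensor V [act V h w, comp h v])
       | _ \<Rightarrow> \<zero>\<^bsub>tensor_alg V\<^esub>)"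

lemma yd_braiding_eq: "yd_braiding G V = tlift V (tensor_alg V) cfun"
  unfolding yd_braiding_def tensor_lift_eq cfun_def ..

interpretation T: Module.module kring "tensor_alg V" by (rule TA_vspace[OF V_vspace])

lemma cfun_pt: "h \<in> carrier G \<Longrightarrow> v \<in> carrier V \<Longrightarrow> w \<in> carrier V \<Longrightarrow> pure_tensor V [act V h w, comp h v] \<in> carrier (tensor_alg V)"
  by (intro pure_tensor_closed[OF V_vspace]) (simp add: act_closed comp_props)

lemma pt2_lin:
  assumes "v \<in> carrier V" "w \<in> carrier V"
  shows "v' \<in> carrier V \<Longrightarrow> pure_tensor V [v \<oplus>\<^bsub>V\<^esub> v', w] = pure_tensor V [v, w] \<oplus>\<^bsub>tensor_alg V\<^esub> pure_tensor V [v', w]"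
    "w' \<in> carrier V \<Longrightarrow> pure_tensor V [v, w \<oplus>\<^bsub>V\<^esub> w'] = pure_tensor V [v, w] \<oplus>\<^bsub>tensor_alg V\<^esub> pure_tensor V [v, w']"
    "pure_tensor V [a \<odot>\<^bsub>V\<^esub> v, w] = a \<odot>\<^bsub>tensor_alg V\<^esub> pure_tensor V [v, w]"
    "pure_tensor V [v, a \<odot>\<^bsub>V\<^esub> w] = a \<odot>\<^bsub>tensor_alg V\<^esub> pure_tensor V [v, w]"
proof -
  note m = pure_tensor_multilinear[OF V_vspace, unfolded multilinear_def, THEN conjunct2, rule_format]
  show "v' \<in> carrier V \<Longrightarrow> pure_tensor V [v \<oplus>\<^bsub>V\<^esub> v', w] = pure_tensor V [v, w] \<oplus>\<^bsub>tensor_alg V\<^esub> pure_tensor V [v', w]"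
    using m[of "[]" "[w]" v] assms by simp
  show "w' \<in> carrier V \<Longrightarrow> pure_tensor V [v, w \<oplus>\<^bsub>V\<^esub> w'] = pure_tensor V [v, w] \<oplus>\<^bsub>tensor_alg V\<^esub> pure_tensor V [v, w']"
    using m[of "[v]" "[]" w] assms by simp
  show "pure_tensor V [a \<odot>\<^bsub>V\<^esub> v, w] = a \<odot>\<^bsub>tensor_alg V\<^esub> pure_tensor V [v, w]"
    using m[of "[]" "[w]" v] assms by simp
  show "pure_tensor V [v, a \<odot>\<^bsub>V\<^esub> w] = a \<odot>\<^bsub>tensor_alg V\<^esub> pure_tensor V [v, w]"
    using m[of "[v]" "[]" w] assms by simp
qed

lemma cfun_closed: "l \<in> lists (carrier V) \<Longrightarrow> cfun l \<in> carrier (tensor_alg V)"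
  unfolding cfun_def by (auto split: list.splits intro!: T.M.finsum_closed cfun_pt)

lemma cfun2:
  assumes v: "v \<in> carrier V" and w: "w \<in> carrier V"
  shows "v' \<in> carrier V \<Longrightarrow> cfun [v \<oplus>\<^bsub>V\<^esub> v', w] = cfun [v, w] \<oplus>\<^bsub>tensor_alg V\<^esub> cfun [v', w]"
    "v' \<in> carrier V \<Longrightarrow> cfun [w, v \<oplus>\<^bsub>V\<^esub> v'] = cfun [w, v] \<oplus>\<^bsub>tensor_alg V\<^esub> cfun [w, v']"
    "cfun [a \<odot>\<^bsub>V\<^esub> v, w] = a \<odot>\<^bsub>tensor_alg V\<^esub> cfun [v, w]"
    "cfun [w, a \<odot>\<^bsub>V\<^esub> v] = a \<odot>\<^bsub>tensor_alg V\<^esub> cfun [w, v]"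
proof -
  have f: "cfun [v, w] = (\<Oplus>\<^bsub>tensor_alg V\<^esub>h\<in>carrier G. pure_tensor V [act V h w, comp h v])" for v w
    by (simp add: cfun_def)
  have Pi: "(\<lambda>h. pure_tensor V [act V h w, comp h v]) \<in> carrier G \<rightarrow> carrier (tensor_alg V)"
    if "v \<in> carrier V" "w \<in> carrier V" for v w using that cfun_pt by auto
  show "cfun [v \<oplus>\<^bsub>V\<^esub> v', w] = cfun [v, w] \<oplus>\<^bsub>tensor_alg V\<^esub> cfun [v', w]" if v': "v' \<in> carrier V"
    unfolding f T.M.finsum_addf[OF Pi[OF v w] Pi[OF v' w], symmetric]
    using v w v' by (intro T.M.finsum_cong' refl)
      (auto simp: comp_props pt2_lin act_closed intro!: T.M.a_closed pure_tensor_closed[OF V_vspace])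
  show "cfun [w, v \<oplus>\<^bsub>V\<^esub> v'] = cfun [w, v] \<oplus>\<^bsub>tensor_alg V\<^esub> cfun [w, v']" if v': "v' \<in> carrier V"
    unfolding f T.M.finsum_addf[OF Pi[OF w v] Pi[OF w v'], symmetric]
    using v w v' by (intro T.M.finsum_cong' refl)
      (auto simp: comp_props pt2_lin act_add act_closed intro!: T.M.a_closed pure_tensor_closed[OF V_vspace])
  show "cfun [a \<odot>\<^bsub>V\<^esub> v, w] = a \<odot>\<^bsub>tensor_alg V\<^esub> cfun [v, w]"
    unfolding f T.finsum_smult_ldistr[OF finG _ Pi[OF v w], of a, unfolded kring_simps, OF UNIV_I]
    using v w by (intro T.M.finsum_cong' refl)
      (auto simp: comp_props pt2_lin act_closed intro!: vs_closed(3)[OF TA_vspace[OF V_vspace]] pure_tensor_closed[OF V_vspace])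
  show "cfun [w, a \<odot>\<^bsub>V\<^esub> v] = a \<odot>\<^bsub>tensor_alg V\<^esub> cfun [w, v]"
    unfolding f T.finsum_smult_ldistr[OF finG _ Pi[OF w v], of a, unfolded kring_simps, OF UNIV_I]
    using v w by (intro T.M.finsum_cong' refl)
      (auto simp: comp_props pt2_lin act_smult act_closed intro!: vs_closed(3)[OF TA_vspace[OF V_vspace]] pure_tensor_closed[OF V_vspace])
qed

lemma cfun_multilinear: "multilinear V (tensor_alg V) cfun"
proof (rule multilinearI)
  fix l1 l2 v assume l: "l1 \<in> lists (carrier V)" "l2 \<in> lists (carrier V)" and v: "v \<in> carrier V"
  consider (a) w where "l1 = []" "l2 = [w]" | (b) w where "l1 = [w]" "l2 = []" | (c) "\<forall>v. cfun (l1 @ v # l2) = \<zero>\<^bsub>tensor_alg V\<^esub>"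
  proof (cases "length l1 + length l2 = 1")
    case True
    then show ?thesis using that(1,2) by (cases l1; cases l2) auto
  next
    case False
    then have "length (l1 @ v # l2) \<noteq> 2" for v by simp
    moreover have "cfun l = \<zero>\<^bsub>tensor_alg V\<^esub>" if "length l \<noteq> 2" for l
      using that by (auto simp: cfun_def split: list.splits)
    ultimately have "cfun (l1 @ v # l2) = \<zero>\<^bsub>tensor_alg V\<^esub>" for v by blast
    then show ?thesis using that(3) by blast
  qed
  note cases = this
  show "cfun (l1 @ (a \<odot>\<^bsub>V\<^esub> v) # l2) = a \<odot>\<^bsub>tensor_alg V\<^esub> cfun (l1 @ v # l2)" for a
    using cases by cases (use l v cfun2 vs_laws(6)[OF TA_vspace[OF V_vspace]] in auto)
  show "cfun (l1 @ (v \<oplus>\<^bsub>V\<^esub> v') # l2) = cfun (l1 @ v # l2) \<oplus>\<^bsub>tensor_alg V\<^esub> cfun (l1 @ v' # l2)" if "v' \<in> carrier V" for v'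
    using cases by cases (use that l v cfun2 in auto)
qed (rule cfun_closed)

lemma braiding_pure:
  assumes "v \<in> carrier V" "w \<in> carrier V"
  shows "yd_braiding G V (pure_tensor V [v, w]) = cfun [v, w]"
  unfolding yd_braiding_eq using assms
  by (intro tlift_pure[OF V_vspace TA_vspace[OF V_vspace] cfun_multilinear]) simp

context
  fixes A :: "'s set" and hh :: "'s \<Rightarrow> 'a" and qq :: "'s \<Rightarrow> 's \<Rightarrow> 'k"
  assumes hh: "\<And>s. s \<in> A \<Longrightarrow> hh s \<in> carrier G"
    and comm: "\<And>s t. s \<in> A \<Longrightarrow> t \<in> A \<Longrightarrow> inv (hh s) \<otimes> cdeg (hh t) \<otimes> hh s \<in> H"
    and dist: "\<And>s t. s \<in> A \<Longrightarrow> t \<in> A \<Longrightarrow> inv (hh s) \<otimes> hh t \<in> H \<Longrightarrow> s = t"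
    and qq: "\<And>s t. s \<in> A \<Longrightarrow> t \<in> A \<Longrightarrow> qq t s = chi (inv (hh s) \<otimes> cdeg (hh t) \<otimes> hh s)"
begin

text \<open>Under the coordinate of the letter \<open>b\<close> only the component of degree
  \<open>cdeg (hh b)\<close> survives, and by \<open>comm\<close> that group element scales the
  coordinate of the letter \<open>a\<close>.\<close>

lemma diag: "diag_braiding V (yd_braiding G V) A (\<lambda>s. \<Phi> (hh s)) (\<lambda>s. e (hh s) 1) qq"
proof (rule diag_braiding.intro)
  show "vspace V" by (rule V_vspace)
  note vc = vs_closed[OF V_vspace]
  fix v w assume v: "v \<in> carrier V" and w: "w \<in> carrier V"
  show "yd_braiding G V (pure_tensor V [v, w]) \<in> carrier (tensor_alg V)"
    unfolding braiding_pure[OF v w] using v w by (intro cfun_closed) simp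
  show "yd_braiding G V (pure_tensor V [a \<odot>\<^bsub>V\<^esub> v, w]) = a \<odot>\<^bsub>tensor_alg V\<^esub> yd_braiding G V (pure_tensor V [v, w])" for a
    using v w by (simp add: braiding_pure vc cfun2)
  show "yd_braiding G V (pure_tensor V [w, a \<odot>\<^bsub>V\<^esub> v]) = a \<odot>\<^bsub>tensor_alg V\<^esub> yd_braiding G V (pure_tensor V [w, v])" for a
    using v w by (simp add: braiding_pure vc cfun2)
  show "yd_braiding G V (pure_tensor V [u \<oplus>\<^bsub>V\<^esub> v, w]) = yd_braiding G V (pure_tensor V [u, w]) \<oplus>\<^bsub>tensor_alg V\<^esub> yd_braiding G V (pure_tensor V [v, w])"
    if "u \<in> carrier V" for u using v w that by (simp add: braiding_pure vc cfun2)
  show "yd_braiding G V (pure_tensor V [w, u \<oplus>\<^bsub>V\<^esub> v]) = yd_braiding G V (pure_tensor V [w, u]) \<oplus>\<^bsub>tensor_alg V\<^esub> yd_braiding G V (pure_tensor V [w, v])"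
    if "u \<in> carrier V" for u using v w that by (simp add: braiding_pure vc cfun2)
  show "\<Phi> (hh s) (v \<oplus>\<^bsub>V\<^esub> w) = \<Phi> (hh s) v + \<Phi> (hh s) w" if "s \<in> A" for s
    using \<Phi>_add[OF hh[OF that] v w] .
next
  show "\<Phi> (hh s) (a \<odot>\<^bsub>V\<^esub> v) = a * \<Phi> (hh s) v" if "s \<in> A" "v \<in> carrier V" for s a v
    using \<Phi>_smult[OF hh[OF that(1)] that(2)] .
next
  show "e (hh s) 1 \<in> carrier V" if "s \<in> A" for s using e_closed[OF hh[OF that]] .
  show "\<Phi> (hh s) (e (hh t) 1) = (if s = t then 1 else 0)" if "s \<in> A" "t \<in> A" for s t
    using dist[OF that] hh that H_one by (auto simp: \<Phi>_e chi_one)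
next
  fix us v w assume us: "us \<in> lists A" and v: "v \<in> carrier V" and w: "w \<in> carrier V"
  have ml: "multilinear V kspace (coord (\<lambda>s. \<Phi> (hh s)) us)"
    by (rule coord_multilinear[OF us]) (simp_all add: \<Phi>_add \<Phi>_smult hh)
  note add = tlift_add[OF V_vspace kspace_vspace ml, unfolded kspace_simps]
  note sm = tlift_smult[OF V_vspace kspace_vspace ml, unfolded kspace_simps]
  note pu = tlift_pure[OF V_vspace kspace_vspace ml]
  let ?t = "tlift V kspace (coord (\<lambda>s. \<Phi> (hh s)) us)"
  have z: "?t \<zero>\<^bsub>tensor_alg V\<^esub> = 0" using sm[of "\<zero>\<^bsub>tensor_alg V\<^esub>" 0] vs_laws(6)[OF TA_vspace[OF V_vspace]] by simp
  have fs: "?t (finsum (tensor_alg V) F I) = (\<Sum>i\<in>I. ?t (F i))" if "finite I" "\<And>i. i \<in> I \<Longrightarrow> F i \<in> carrier (tensor_alg V)" for F and I :: "'a set"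
    using that
  proof (induction I rule: finite_induct)
    case empty then show ?case using z by simp
  next
    case (insert i I)
    have "finsum (tensor_alg V) F (insert i I) = F i \<oplus>\<^bsub>tensor_alg V\<^esub> finsum (tensor_alg V) F I"
      using insert by (intro T.M.finsum_insert) auto
    moreover have "finsum (tensor_alg V) F I \<in> carrier (tensor_alg V)" using insert by (intro T.M.finsum_closed) auto
    ultimately show ?case using insert add by simp
  qed
  have "?t (yd_braiding G V (pure_tensor V [v, w])) = (\<Sum>h\<in>carrier G. ?t (pure_tensor V [act V h w, comp h v]))"
    unfolding braiding_pure[OF v w] using fs[OF finG, of "\<lambda>h. pure_tensor V [act V h w, comp h v]"] cfun_pt[OF _ v w]
    by (simp add: cfun_def)
  also have "\<dots> = (\<Sum>h\<in>carrier G. coord (\<lambda>s. \<Phi> (hh s)) us [act V h w, comp h v])"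
    using v w by (intro sum.cong refl pu) (simp add: act_closed comp_props)
  also have "\<dots> = (case us of [a, b] \<Rightarrow> qq b a * \<Phi> (hh a) w * \<Phi> (hh b) v | _ \<Rightarrow> 0)"
  proof (cases "length us = 2")
    case False
    then have "coord (\<lambda>s. \<Phi> (hh s)) us [act V h w, comp h v] = 0" for h by (intro coord_length) simp
    then show ?thesis using False by (auto split: list.split)
  next
    case True
    then obtain a b where ab: "us = [a, b]" by (auto simp: length_Suc_conv numeral_2_eq_2)
    then have abA: "a \<in> A" "b \<in> A" using us by auto
    have c: "cdeg (hh b) \<in> carrier G" using hh abA g by simp
    have "(\<Sum>h\<in>carrier G. coord (\<lambda>s. \<Phi> (hh s)) us [act V h w, comp h v])
      = (\<Sum>h\<in>carrier G. if h = cdeg (hh b) then \<Phi> (hh a) (act V h w) * \<Phi> (hh b) v else 0)"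
      using v abA by (intro sum.cong refl) (simp add: ab comp_props hh)
    also have "\<dots> = \<Phi> (hh a) (act V (cdeg (hh b)) w) * \<Phi> (hh b) v" using finG c by simp
    also have "\<Phi> (hh a) (act V (cdeg (hh b)) w) = qq b a * \<Phi> (hh a) w"
      using \<Phi>_act[OF hh[OF abA(1)] c comm[OF abA] w] qq[OF abA] by simp
    finally show ?thesis by (simp add: ab)
  qed
  finally show "?t (yd_braiding G V (pure_tensor V [v, w])) = (case us of [a, b] \<Rightarrow> qq b a * \<Phi> (hh a) w * \<Phi> (hh b) v | _ \<Rightarrow> 0)" .
qed

lemma yd_qword_vanish:
  assumes "fin_dim (yd_nichols G V)"
  shows "\<exists>N. \<forall>v\<in>lists A. N \<le> length v \<longrightarrow> qword qq v wsingle = (\<lambda>u. 0)"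
  using diag_braiding.qword_vanish[OF diag] assms unfolding yd_nichols_def by blast

end

end

section \<open>The braiding \<open>q(r, s) = eps \<psi>(r / s)\<close> on the non-zero squares\<close>

text \<open>Adding 1 permutes the field, so the sum of all elements does not change, and
  \<open>CARD('f)\<close> is zero in the field.\<close>

lemma CHAR_finite_field:
  assumes "Factorial_Ring.prime p" "CARD('f::{field, finite}) = p ^ m"
  shows "CHAR('f) = p"
proof -
  have "(\<Sum>x\<in>UNIV. x) = (\<Sum>x\<in>UNIV. x + (1::'f))"
    by (rule sum.reindex_bij_witness[of _ "\<lambda>x. x + 1" "\<lambda>x. x - 1"]) auto
  then have "of_nat CARD('f) = (0::'f)" by (simp add: sum.distrib)
  then have "of_nat p = (0::'f)" by (simp add: assms(2))
  then have "CHAR('f) dvd p" by (simp add: of_nat_eq_0_iff_char_dvd)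
  then show ?thesis using assms(1) CHAR_not_1' by (metis One_nat_def prime_nat_iff)
qed

lemma two_nonzero:
  assumes "Factorial_Ring.prime p" "p \<noteq> 2" "CARD('f::{field, finite}) = p ^ m"
  shows "(2::'f) \<noteq> 0"
proof
  assume "(2::'f) = 0"
  then have "p dvd 2"
    using of_nat_eq_0_iff_char_dvd[of 2, where 'a = 'f] CHAR_finite_field[OF assms(1,3)] by simp
  then show False using assms(1,2) two_is_prime_nat by (metis primes_dvd_imp_eq)
qed

locale square_braiding =
  fixes \<psi> :: "'f::{field, finite} \<Rightarrow> 'k::field_char_0" and eps :: 'k and p m N :: nat
  assumes \<psi>_add: "\<psi> (x + y) = \<psi> x * \<psi> y" and \<psi>_0: "\<psi> 0 = 1"
    and eps2: "eps * eps = 1"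
    and p: "Factorial_Ring.prime p" "p \<noteq> 2" "p \<noteq> 3" and card: "CARD('f) = p ^ m"
    and vanish: "\<And>v. set v \<subseteq> {x. x \<noteq> 0 \<and> (\<exists>y. x = y ^ 2)} \<Longrightarrow> N \<le> length v \<Longrightarrow>
      qword (\<lambda>r s. eps * \<psi> (r / s)) v wsingle = (\<lambda>u. 0)"
begin

definition S :: "'f set" where "S = {x. x \<noteq> 0 \<and> (\<exists>y. x = y ^ 2)}"
text \<open>The prime field. For \<open>c\<close> in it, \<psi> at \<open>c * x\<close> is a power
  of \<psi> at \<open>x\<close>, so all non-zero multiples of \<open>x\<close> by elements of
  \<open>P\<close> have a trivial value as soon as one does.\<close>

definition P :: "'f set" where "P = range of_nat"
abbreviation q where "q \<equiv> \<lambda>r s. eps * \<psi> (r / s)"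
abbreviation nz where "nz r w \<equiv> zop q r w wsingle \<noteq> (\<lambda>u. 0)"
abbreviation f where "f x \<equiv> \<psi> (x + 1 / x)"

lemma vanish_S: "set v \<subseteq> S \<Longrightarrow> N \<le> length v \<Longrightarrow> qword q v wsingle = (\<lambda>u. 0)"
  unfolding S_def by (rule vanish)

section \<open>Values of the sign and the character, and the prime field\<close>

lemma eps_cases: "eps = 1 \<or> eps = - 1"
  using eps2 by (metis square_eq_1_iff)

lemma eps_nz: "eps \<noteq> 0"
  using eps2 by auto

lemma \<psi>_nz: "\<psi> x \<noteq> 0"
  using \<psi>_add[of x "- x"] \<psi>_0 by auto

lemma \<psi>_minus: "\<psi> (- x) = inverse (\<psi> x)"
  using \<psi>_add[of x "- x"] \<psi>_0 \<psi>_nz[of x] by (simp add: field_simps)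

lemma \<psi>_of_nat: "\<psi> (of_nat n * x) = \<psi> x ^ n"
  by (induction n) (simp_all add: \<psi>_0 \<psi>_add algebra_simps)

lemma q_nz: "q r s \<noteq> 0"
  using eps_nz \<psi>_nz by simp

lemma of_nat_0_iff: "of_nat n = (0::'f) \<longleftrightarrow> p dvd n"
  by (simp add: of_nat_eq_0_iff_char_dvd CHAR_finite_field[OF p(1) card])

lemma p5: "p \<ge> 5"
proof -
  have "p \<noteq> 4" using p(1) prime_product[of "2::nat" 2] by auto
  moreover have "p \<ge> 2" using p(1) by (rule prime_ge_2_nat)
  ultimately show ?thesis using p by linarith
qed

lemma small_nz: "0 < n \<Longrightarrow> n < p \<Longrightarrow> of_nat n \<noteq> (0::'f)"
  unfolding of_nat_0_iff by (auto dest: dvd_imp_le)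

lemma nums: "(2::'f) \<noteq> 0" "(3::'f) \<noteq> 0" "(4::'f) \<noteq> 0"
  using small_nz[of 2] small_nz[of 3] small_nz[of 4] p5 by simp_all

lemma minus_one_ne: "- 1 \<noteq> (1::'f)" "1 \<noteq> (- 1::'f)"
proof -
  show "- 1 \<noteq> (1::'f)"
  proof
    assume "- 1 = (1::'f)"
    then have "1 + 1 = (0::'f)" by (metis add.right_inverse)
    then show False using nums(1) by simp
  qed
  then show "1 \<noteq> (- 1::'f)" by metis
qed

lemma P_of_nat [simp]: "of_nat n \<in> P" by (simp add: P_def)

lemma P_0 [simp]: "0 \<in> P" using P_of_nat[of 0] by simp
lemma P_1 [simp]: "1 \<in> P" using P_of_nat[of 1] by simp
lemma P_numeral [simp]: "numeral n \<in> P" using P_of_nat[of "numeral n"] by simp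

lemma P_add: "x \<in> P \<Longrightarrow> y \<in> P \<Longrightarrow> x + y \<in> P"
  unfolding P_def by (auto simp flip: of_nat_add)

lemma P_mult: "x \<in> P \<Longrightarrow> y \<in> P \<Longrightarrow> x * y \<in> P"
  unfolding P_def by (auto simp flip: of_nat_mult)

lemma P_power: "x \<in> P \<Longrightarrow> x ^ n \<in> P"
  by (induction n) (auto intro: P_mult)

lemma P_uminus: "x \<in> P \<Longrightarrow> - x \<in> P"
proof -
  assume "x \<in> P"
  have "of_nat (p - 1) = (-1 :: 'f)"
    using p5 of_nat_0_iff[of p] by (simp add: of_nat_diff)
  then have "- x = of_nat (p - 1) * x" by simp
  then show ?thesis using P_mult[OF P_of_nat \<open>x \<in> P\<close>] by metis
qed

lemma P_diff: "x \<in> P \<Longrightarrow> y \<in> P \<Longrightarrow> x - y \<in> P"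
  using P_add[OF _ P_uminus] by (metis diff_conv_add_uminus)

text \<open>Multiplication by a non-zero \<open>x\<close> is injective on the finite set
  \<open>P\<close>, hence reaches 1.\<close>

lemma P_inverse: "x \<in> P \<Longrightarrow> inverse x \<in> P"
proof (cases "x = 0")
  case False
  assume x: "x \<in> P"
  have "(\<lambda>y. x * y) ` P = P"
    using False x by (intro card_subset_eq) (auto intro: P_mult simp: card_image inj_on_def)
  then obtain y where "y \<in> P" "x * y = 1" using P_1 by (metis imageE)
  then show ?thesis by (metis inverse_unique)
qed simp

lemma P_divide: "x \<in> P \<Longrightarrow> y \<in> P \<Longrightarrow> x / y \<in> P"
  unfolding divide_inverse by (intro P_mult P_inverse)

lemmas P_intros = P_add P_mult P_power P_uminus P_diff P_inverse P_divide P_0 P_1 P_numeral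

lemma \<psi>_P_mult: "c \<in> P \<Longrightarrow> \<psi> x = 1 \<Longrightarrow> \<psi> (c * x) = 1"
  unfolding P_def by (auto simp: \<psi>_of_nat)

lemma \<psi>_P_cancel: "c \<in> P \<Longrightarrow> c \<noteq> 0 \<Longrightarrow> \<psi> (c * x) = 1 \<Longrightarrow> \<psi> x = 1"
  using \<psi>_P_mult[OF P_inverse, of c "c * x"] by (simp add: mult.assoc[symmetric])

lemma \<psi>_P: "c \<in> P \<Longrightarrow> \<psi> 1 = 1 \<Longrightarrow> \<psi> c = 1"
  using \<psi>_P_mult[of c 1] by simp

lemma \<psi>_P_ne: "c \<in> P \<Longrightarrow> c \<noteq> 0 \<Longrightarrow> \<psi> 1 \<noteq> 1 \<Longrightarrow> \<psi> c \<noteq> 1"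
  using \<psi>_P_cancel[of c 1] by auto

text \<open>The values of \<psi> are \<open>p\<close>-th roots of unity, and \<open>p\<close> is
  odd.\<close>

lemma \<psi>_ne_minus_one: "\<psi> x \<noteq> - 1"
proof
  assume *: "\<psi> x = - 1"
  have "odd p" using p(1,2) by (metis prime_odd_nat prime_ge_2_nat le_neq_implies_less)
  then have "\<psi> x ^ p = - 1" using * by simp
  moreover have "\<psi> x ^ p = 1" using \<psi>_of_nat[of p x] of_nat_0_iff[of p] \<psi>_0 by simp
  ultimately show False by simp
qed

lemma S_nz: "x \<in> S \<Longrightarrow> x \<noteq> 0" by (simp add: S_def)

lemma S_square: "x \<noteq> 0 \<Longrightarrow> x ^ 2 \<in> S" by (auto simp: S_def)

lemma S_mult: "x \<in> S \<Longrightarrow> y \<in> S \<Longrightarrow> x * y \<in> S"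
  unfolding S_def by (auto simp flip: power_mult_distrib)

lemma S_inverse: "x \<in> S \<Longrightarrow> inverse x \<in> S"
  unfolding S_def by (auto simp flip: power_inverse)

lemma S_divide: "x \<in> S \<Longrightarrow> y \<in> S \<Longrightarrow> x / y \<in> S"
  unfolding divide_inverse by (intro S_mult S_inverse)

lemma S_1: "1 \<in> S" using S_square[of 1] by simp

lemma S_4: "4 \<in> S" using S_square[of 2] nums by simp

lemma S_power: "x \<in> S \<Longrightarrow> x ^ n \<in> S"
  by (induction n) (auto intro: S_mult S_1)

lemma eps_power: "eps ^ (n + n) = 1"
  using eps2 by (simp add: power_add flip: power_mult_distrib)

lemma qmul_eq: "qmul q w j = eps ^ length w * \<psi> (sum_list w / j)"
  by (induction w) (simp_all add: \<psi>_0 \<psi>_add add_divide_distrib mult_ac)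

lemma qmulr_eq: "qmulr q j w = eps ^ length w * \<psi> (j * sum_list (map inverse w))"
  by (induction w) (simp_all add: \<psi>_0 \<psi>_add distrib_left divide_inverse mult_ac)

lemma qmul_eq': "qmul q w j = eps ^ length w * \<psi> (sum_list w * inverse j)"
  using qmul_eq[of w j] by (simp only: divide_inverse[of "sum_list w"])

lemma qtotal: "prod_list (map (qmul q w) v) = eps ^ (length w * length v) * \<psi> (sum_list w * sum_list (map inverse v))"
  by (induction v) (simp_all add: \<psi>_0 \<psi>_add qmul_eq' distrib_left power_add mult_ac)

text \<open>The square of the number of letters is the exponent of \<open>eps\<close> in the
  self-braiding, so an even number of letters disposes of either sign.\<close>

lemma contra:
  assumes "r \<notin> set w" "set w \<subseteq> S" "r \<in> S" "nz r w"
    and "eps ^ Suc (length w) = 1 \<or> even (Suc (length w))"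
    and "\<psi> ((sum_list w + r) * (sum_list (map inverse w) + inverse r)) = 1"
  shows False
proof -
  have "eps ^ (Suc (length w) * Suc (length w)) = 1"
    using assms(5)
  proof
    assume "eps ^ Suc (length w) = 1"
    then show ?thesis by (simp only: power_mult power_one)
  next
    assume "even (Suc (length w))"
    then obtain k where "Suc (length w) = k + k" by (metis evenE mult_2)
    then show ?thesis by (simp only: power_mult eps_power power_one)
  qed
  then have "prod_list (map (qmul q (w @ [r])) (w @ [r])) = 1"
    unfolding qtotal using assms(6) by simp
  then have "zop q r w wsingle = (\<lambda>u. 0)"
    using assms(2,3) by (intro zop_zero[OF q_nz assms(1), where N = N] vanish_S) auto
  then show False using assms(4) by blast
qed

text \<open>The sign drops out of the double braiding of two letters; what is left depends on their
  ratio alone.\<close>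

lemma left_step:
  assumes "nz r w" "r \<notin> set w" "i \<notin> set w" "i \<noteq> r" "\<psi> (i / r + r / i) \<noteq> 1"
  shows "nz r (i # w)"
proof (rule zop_nonzero_Cons_left[OF q_nz assms(2,3,4) _ assms(1)])
  have "q i r * q r i = \<psi> (i / r + r / i) * (eps * eps)" by (simp add: \<psi>_add mult_ac)
  then show "q i r * q r i \<noteq> 1" using assms(5) eps2 by simp
qed

lemma right_step:
  assumes "nz r w" "i \<notin> set w" "i \<noteq> r"
    and "\<psi> ((sum_list w + r) / i + i * (sum_list (map inverse w) + inverse r)) \<noteq> 1"
  shows "nz r (i # w)"
proof (rule zop_nonzero_Cons_right[OF q_nz assms(2,3) _ assms(1)])
  let ?n = "Suc (length w)"
  have "qmul q (w @ [r]) i * qmulr q i (w @ [r])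
     = eps ^ (?n + ?n) * \<psi> ((sum_list w + r) / i + i * (sum_list (map inverse w) + inverse r))"
    unfolding qmul_eq qmulr_eq \<psi>_add power_add by (simp add: mult_ac)
  then show "qmul q (w @ [r]) i * qmulr q i (w @ [r]) \<noteq> 1" using assms(4) unfolding eps_power by simp
qed

lemma nz_Nil: "nz r []"
  by (rule zop_nonzero_Nil) (rule q_nz)

lemma left_steps:
  assumes "distinct w" "r \<notin> set w" "\<And>i. i \<in> set w \<Longrightarrow> \<psi> (i / r + r / i) \<noteq> 1"
  shows "nz r w"
  using assms
proof (induction w)
  case Nil show ?case by (rule nz_Nil)
next
  case (Cons i w)
  then show ?case by (intro left_step) auto
qed

text \<open>One letter is already a commutator. In the cases below this forces \<psi> to be
  non-trivial at 1 if \<open>eps = 1\<close>, and \<open>eps = - 1\<close> if \<psi> is trivial at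
  1.\<close>

lemma Q_ne: "eps * \<psi> 1 \<noteq> 1"
proof
  assume "eps * \<psi> 1 = 1"
  then have "prod_list (map (qmul q ([] @ [1])) ([] @ [1])) = 1" by simp
  then have "zop q 1 [] wsingle = (\<lambda>u. 0)"
    using S_1 by (intro zop_zero[OF q_nz, where N = N] vanish_S) auto
  then show False using nz_Nil by blast
qed

text \<open>By counting. If \<open>x ^ 2 + 1 / x ^ 2\<close> always lay in the kernel
  \<open>K\<close> of \<psi>, then \<open>CARD('f) - 1 \<le> 4 * card K\<close>, because the fibres
  have at most 4 elements. But as \<open>p \<ge> 5\<close>, \<open>K\<close> has five disjoint
  translates by multiples of \<open>c\<close>, so \<open>5 * card K \<le> CARD('f)\<close>. This
  contradicts that 0 and 1 lie in \<open>K\<close>.\<close>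

lemma exists_edge:
  assumes "\<psi> 1 = 1" "\<psi> c \<noteq> 1"
  shows "\<exists>\<rho>\<in>S. f \<rho> \<noteq> 1"
proof (rule ccontr)
  assume "\<not> ?thesis"
  then have triv: "\<psi> (x ^ 2 + 1 / x ^ 2) = 1" if "x \<noteq> 0" for x using S_square[OF that] by blast
  define K where "K = {x. \<psi> x = 1}"
  have K: "finite K" by simp
  have inj: "inj_on (\<lambda>(j, k). k + of_nat j * c) ({..<5} \<times> K)"
  proof -
    have *: "j = j'" if "j \<le> j'" "j < 5" "j' < 5" "\<psi> k = 1" "\<psi> k' = 1" "k + of_nat j * c = k' + of_nat j' * c" for j j' :: nat and k k'
    proof (rule ccontr)
      assume "j \<noteq> j'"
      have "of_nat (j' - j) * c = k - k'" using that by (simp add: of_nat_diff algebra_simps)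
      then have "\<psi> (of_nat (j' - j) * c) = 1" using that(4,5) \<psi>_add[of k "- k'"] by (simp add: \<psi>_minus)
      moreover have "of_nat (j' - j) \<noteq> (0::'f)" using that \<open>j \<noteq> j'\<close> p5 by (intro small_nz) auto
      ultimately show False using \<psi>_P_cancel[OF P_of_nat] assms(2) by blast
    qed
    show ?thesis
    proof (rule inj_onI)
      fix a b assume ab: "a \<in> {..<5} \<times> K" "b \<in> {..<5} \<times> K"
        "(case a of (j, k) \<Rightarrow> k + of_nat j * c) = (case b of (j, k) \<Rightarrow> k + of_nat j * c)"
      obtain j k j' k' where e: "a = (j, k)" "b = (j', k')" by (cases a, cases b)
      have "j = j'"
      proof (cases "j \<le> j'")
        case True then show ?thesis using *[of j j' k k'] ab by (simp add: K_def e)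
      next
        case False then show ?thesis using *[of j' j k' k] ab by (simp add: K_def e)
      qed
      then show "a = b" using ab by (simp add: e)
    qed
  qed
  have "card ({..<5::nat} \<times> K) \<le> CARD('f)"
    unfolding card_image[OF inj, symmetric] by (intro card_mono) auto
  then have 1: "5 * card K \<le> CARD('f)" by (simp add: card_cartesian_product)
  define fib where "fib c = {x. x \<noteq> 0 \<and> x ^ 2 + 1 / x ^ 2 = c}" for c :: 'f
  have fib: "card (fib c) \<le> 4" for c
  proof (cases "fib c = {}")
    case False
    then obtain x where x: "x \<noteq> 0" "x ^ 2 + 1 / x ^ 2 = c" by (auto simp: fib_def)
    have "fib c \<subseteq> {x, - x, 1 / x, - (1 / x)}"
    proof
      fix y assume "y \<in> fib c"
      then have y: "y \<noteq> 0" "y ^ 2 + 1 / y ^ 2 = x ^ 2 + 1 / x ^ 2" using x by (auto simp: fib_def)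
      then have "(y ^ 2 - x ^ 2) * (y ^ 2 * x ^ 2 - 1) = 0" using x(1) by (simp add: field_simps)
      then consider "y ^ 2 = x ^ 2" | "(y * x) ^ 2 = 1" by (auto simp: power_mult_distrib)
      then show "y \<in> {x, - x, 1 / x, - (1 / x)}"
      proof cases
        case 1 then show ?thesis by (auto simp: power2_eq_iff)
      next
        case 2
        then have "y * x = 1 \<or> y * x = - 1" by (simp add: power2_eq_1_iff)
        then show ?thesis using x(1) by (auto simp: field_simps)
      qed
    qed
    then have "card (fib c) \<le> card {x, - x, 1 / x, - (1 / x)}" by (intro card_mono) auto
    also have "\<dots> \<le> 4" by (simp add: card_insert_if)
    finally show ?thesis .
  qed simp
  have "UNIV - {0} \<subseteq> (\<Union>c\<in>K. fib c)" using triv by (auto simp: K_def fib_def)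
  then have "card (UNIV - {0::'f}) \<le> card (\<Union>c\<in>K. fib c)" by (intro card_mono) auto
  also have "\<dots> \<le> (\<Sum>c\<in>K. card (fib c))" by (rule card_UN_le[OF K])
  also have "\<dots> \<le> (\<Sum>c\<in>K. 4)" by (intro sum_mono fib)
  finally have 2: "CARD('f) \<le> 4 * card K + 1" by (simp add: card_Diff_singleton)
  have "card {0, 1::'f} \<le> card K" using assms(1) \<psi>_0 by (intro card_mono) (auto simp: K_def)
  then show False using 1 2 by simp
qed

text \<open>Letters in pairs of opposite elements are even in number and have sum zero, so only
  non-vanishing is at stake. If \<psi> is non-trivial at 1, it is non-trivial at -2, which links 1
  and -1. Otherwise \<psi> is trivial on the prime field, and \<rho> has to provide the
  links.\<close>

lemma case_minus_one_square:
  assumes "- 1 \<in> S" "\<psi> c \<noteq> 1"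
  shows False
proof (cases "\<psi> 1 = 1")
  case False
  note ne = minus_one_ne
  have "\<psi> (- 2) \<noteq> 1"
    by (rule \<psi>_P_ne[OF _ _ False]) (simp_all add: P_uminus nums)
  moreover have "- 1 / 1 + 1 / - 1 = (- 2 :: 'f)" by simp
  ultimately have "\<psi> (- 1 / 1 + 1 / - 1) \<noteq> 1" by (simp only: not_False_eq_True)
  then have "nz 1 [- 1]" by (intro left_step[OF nz_Nil]) (simp_all add: ne del: div_by_1)
  moreover have "1 \<notin> set [- 1::'f]" using ne by simp
  moreover have "\<psi> ((sum_list [- 1] + 1) * (sum_list (map inverse [- 1]) + inverse 1)) = 1" by (simp add: \<psi>_0)
  ultimately show False using assms(1) S_1 by (intro contra[of 1 "[- 1]"]) simp_all
next
  case True
  then have e: "eps = - 1" using Q_ne eps_cases by auto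
  obtain \<rho> where \<rho>: "\<rho> \<in> S" "f \<rho> \<noteq> 1" using exists_edge[OF True assms(2)] by blast
  have r0: "\<rho> \<noteq> 0" by (rule S_nz[OF \<rho>(1)])
  have P1: "\<psi> x = 1" if "x \<in> P" for x by (rule \<psi>_P[OF that True])
  have "\<rho> \<notin> P" using \<rho>(2) P1[of "\<rho> + 1 / \<rho>"] by (auto intro: P_intros)
  then have "\<rho> \<noteq> x \<and> x \<noteq> \<rho> \<and> - \<rho> \<noteq> x \<and> x \<noteq> - \<rho>" if "x \<in> P" for x
    using that P_uminus by (metis minus_minus)
  from this[OF P_1] this[OF P_uminus[OF P_1]]
  have n: "\<rho> \<noteq> 1" "\<rho> \<noteq> - 1" "- \<rho> \<noteq> 1" "- \<rho> \<noteq> - 1" "1 \<noteq> \<rho>" "- 1 \<noteq> \<rho>" "1 \<noteq> - \<rho>"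
    by blast+
  have "- \<rho> \<noteq> \<rho>"
  proof
    assume "- \<rho> = \<rho>"
    then have "2 * \<rho> = 0" by (metis add.right_inverse mult_2)
    then show False using nums(1) r0 by simp
  qed
  then have n': "- \<rho> \<noteq> \<rho>" "\<rho> \<noteq> - \<rho>" by metis+
  note n' = n' minus_one_ne
  have 1: "nz 1 [\<rho>]" using \<rho>(2) n by (intro left_steps) (auto simp: add.commute)
  have fm: "\<psi> (- (\<rho> + 1 / \<rho>)) \<noteq> 1" using \<rho>(2) by (simp only: \<psi>_minus) simp
  \<comment> \<open>The double braiding of -1 with 1 is trivial here, so the left test fails; the
    right test also sees \<rho>.\<close>
  have 2: "nz 1 [- 1, \<rho>]"
  proof (rule right_step[OF 1])
    have "(sum_list [\<rho>] + 1) / - 1 + - 1 * (sum_list (map inverse [\<rho>]) + inverse 1) = - (\<rho> + 1 / \<rho>) + - 2"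
      by (simp add: field_simps)
    then have "\<psi> ((sum_list [\<rho>] + 1) / - 1 + - 1 * (sum_list (map inverse [\<rho>]) + inverse 1)) = \<psi> (- (\<rho> + 1 / \<rho>)) * \<psi> (- 2)"
      by (simp only: \<psi>_add)
    then show "\<psi> ((sum_list [\<rho>] + 1) / - 1 + - 1 * (sum_list (map inverse [\<rho>]) + inverse 1)) \<noteq> 1"
      using fm P1[OF P_uminus[OF P_numeral], of "num.Bit0 num.One"] by (simp only: mult_1_right) simp
  qed (use n n' in auto)
  have 3: "nz 1 [- \<rho>, - 1, \<rho>]"
  proof (rule left_step[OF 2])
    show "\<psi> (- \<rho> / 1 + 1 / - \<rho>) \<noteq> 1" using fm by (simp add: divide_inverse)
  qed (use n n' in auto)
  have "- \<rho> \<in> S" using S_mult[OF assms(1) \<rho>(1)] by simp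
  then show False using \<psi>_0 n n' assms(1) \<rho>(1) S_1 r0 by (intro contra[OF _ _ _ 3]) auto
qed

section \<open>The case in which -1 is not a square\<close>

context
  assumes m1: "- 1 \<notin> S"
begin

lemma square_ne: "(u::'f) \<noteq> 0 \<Longrightarrow> u ^ 2 \<noteq> - 1"
  using S_square[of u] m1 by auto

text \<open>If 5 or 17 were zero, then -1 would be \<open>4\<close> or \<open>4 ^ 2\<close>, a
  square. The rest follows from 3 = 4 - 1, 3 * 5 = 16 - 1 and 3 * 5 * 17 = 256 - 1.\<close>

lemma nums': "(5::'f) \<noteq> 0" "(17::'f) \<noteq> 0" "(4::'f) \<noteq> 1" "(4::'f) ^ 2 \<noteq> 1" "((4::'f) ^ 2) ^ 2 \<noteq> 1"
proof -
  show 5: "(5::'f) \<noteq> 0"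
  proof
    assume z: "(5::'f) = 0"
    have "(4::'f) - 5 = - 1" by simp
    then have "(4::'f) = - 1" unfolding z by simp
    then show False using S_4 m1 by metis
  qed
  show 17: "(17::'f) \<noteq> 0"
  proof
    assume z: "(17::'f) = 0"
    have "(4::'f) ^ 2 - 17 = - 1" by simp
    then have "(4::'f) ^ 2 = - 1" unfolding z by simp
    then show False using square_ne[OF nums(3)] by blast
  qed
  show "(4::'f) \<noteq> 1"
  proof
    assume z: "(4::'f) = 1"
    have "(3::'f) = 4 - 1" by simp
    also have "\<dots> = 0" unfolding z by simp
    finally show False using nums(2) by simp
  qed
  show "(4::'f) ^ 2 \<noteq> 1"
  proof
    assume z: "(4::'f) ^ 2 = 1"
    have "(3::'f) * 5 = 4 ^ 2 - 1" by simp
    also have "\<dots> = 0" unfolding z by simp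
    finally show False using nums(2) 5 by (simp only: mult_eq_0_iff simp_thms)
  qed
  show "((4::'f) ^ 2) ^ 2 \<noteq> 1"
  proof
    assume z: "((4::'f) ^ 2) ^ 2 = 1"
    have "(3::'f) * (5 * 17) = (4 ^ 2) ^ 2 - 1" by simp
    also have "\<dots> = 0" unfolding z by simp
    finally show False using nums(2) 5 17 by (simp only: mult_eq_0_iff simp_thms)
  qed
qed

lemma p7: "p > 5"
  using p5 nums'(1) of_nat_0_iff[of 5] by (cases "p = 5") auto

text \<open>The powers of \<open>4\<close> form a non-trivial group of squares: its sum vanishes, and its order is odd
  because \<open>-1\<close> is not a square.\<close>

lemma powers_of_4:
  obtains d where "odd d" "distinct (map (\<lambda>k. 4 ^ k :: 'f) [0..<d])"
    "(\<Sum>k\<leftarrow>[0..<d]. 4 ^ k) = (0::'f)" "(\<Sum>k\<leftarrow>[0..<d]. inverse (4 ^ k)) = (0::'f)"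
proof -
  have "\<not> inj (\<lambda>k::nat. 4 ^ k :: 'f)" using finite_imageD[of "\<lambda>k::nat. 4 ^ k :: 'f" UNIV] by auto
  then obtain a b :: nat where ab: "4 ^ a = (4 ^ b :: 'f)" "a < b"
    unfolding inj_def by (metis linorder_neqE_nat)
  have pw: "4 ^ (b - a) = (1::'f)" if "4 ^ a = (4 ^ b :: 'f)" "a < b" for a b :: nat
  proof -
    have "4 ^ a * 4 ^ (b - a) = (4 ^ b :: 'f)" using that(2) by (simp flip: power_add)
    also have "\<dots> = 4 ^ a * 1" using that(1) by simp
    finally show ?thesis using nums(3) by simp
  qed
  define Q where "Q n \<longleftrightarrow> 0 < n \<and> 4 ^ n = (1::'f)" for n :: nat
  define d where "d = (LEAST n. Q n)"
  have "Q (b - a)" using pw[OF ab] ab(2) by (simp add: Q_def)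
  then have "Q d" unfolding d_def by (rule LeastI)
  then have d: "0 < d" "4 ^ d = (1::'f)" by (auto simp: Q_def)
  have least: "d \<le> n" if "0 < n" "4 ^ n = (1::'f)" for n unfolding d_def using that by (intro Least_le) (simp add: Q_def)
  have "odd d"
  proof
    assume "even d"
    then obtain h where h: "d = 2 * h" by (elim evenE)
    then have "(4 ^ h) ^ 2 = (1::'f)" using d(2) by (simp add: power_mult[symmetric] mult.commute)
    then have "4 ^ h = (1::'f) \<or> 4 ^ h = (- 1::'f)" by (simp add: power2_eq_1_iff)
    moreover have "4 ^ h \<noteq> (1::'f)" using least[of h] h d(1) by auto
    ultimately show False using S_power[OF S_4, of h] m1 by metis
  qed
  moreover have "distinct (map (\<lambda>k. 4 ^ k :: 'f) [0..<d])"
  proof -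
    have "inj_on (\<lambda>k. 4 ^ k :: 'f) {0..<d}"
    proof (rule linorder_inj_onI)
      fix a b assume *: "a < b" "a \<in> {0..<d}" "b \<in> {0..<d}"
      then have "\<not> d \<le> b - a" "0 < b - a" by auto
      then have "4 ^ (b - a) \<noteq> (1::'f)" using least[of "b - a"] by blast
      then show "4 ^ a \<noteq> (4 ^ b :: 'f)" using pw[of a b] *(1) by blast
    qed auto
    then show ?thesis by (simp add: distinct_map)
  qed
  moreover have geo: "(\<Sum>k\<leftarrow>[0..<d]. x ^ k) = 0" if "x ^ d = 1" "x \<noteq> 1" for x :: 'f
  proof -
    have "(x - 1) * (\<Sum>k<d. x ^ k) = 0" using that(1) by (simp flip: power_diff_1_eq)
    then have "(\<Sum>k<d. x ^ k) = 0" using that(2) by simp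
    then show ?thesis by (simp add: interv_sum_list_conv_sum_set_nat lessThan_atLeast0)
  qed
  moreover have "(\<Sum>k\<leftarrow>[0..<d]. inverse (4 ^ k)) = (0::'f)"
  proof -
    have "inverse (4::'f) \<noteq> 1" using nums'(3) by (metis inverse_1 inverse_inverse_eq)
    moreover have "inverse (4::'f) ^ d = 1" by (simp only: power_inverse d(2) inverse_1)
    ultimately show ?thesis using geo[of "inverse 4"] unfolding power_inverse by blast
  qed
  ultimately show ?thesis using that geo[OF d(2) nums'(3)] by blast
qed

lemma sum_inverse_ne: "(u::'f) \<noteq> 0 \<Longrightarrow> u + 1 / u \<noteq> 0"
proof
  assume "u \<noteq> 0" "u + 1 / u = 0"
  then have "u ^ 2 + 1 = 0" by (simp add: field_simps power2_eq_square)
  then show False using square_ne[OF \<open>u \<noteq> 0\<close>] by (simp add: eq_neg_iff_add_eq_0)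
qed

text \<open>\<open>u + 1 / u\<close> is a non-zero element of the prime field, since -1 is not a
  square. So any two non-zero letters of the prime field are linked.\<close>

lemma f_P: "u \<in> P \<Longrightarrow> u \<noteq> 0 \<Longrightarrow> \<psi> 1 \<noteq> 1 \<Longrightarrow> f u \<noteq> 1"
  by (rule \<psi>_P_ne) (auto intro: P_intros dest: sum_inverse_ne)

text \<open>For \<open>eps = 1\<close> the odd number of powers of 4 does no harm, and their sum is
  zero. By \<open>Q_ne\<close>, \<psi> is non-trivial at 1, so \<open>f_P\<close> links every letter
  to the innermost one.\<close>

lemma case_trivial_sign:
  assumes "eps = 1"
  shows False
proof -
  have \<psi>1: "\<psi> 1 \<noteq> 1" using Q_ne assms by simp
  obtain d where d: "odd d" "distinct (map (\<lambda>k. 4 ^ k :: 'f) [0..<d])"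
    "(\<Sum>k\<leftarrow>[0..<d]. 4 ^ k) = (0::'f)" "(\<Sum>k\<leftarrow>[0..<d]. inverse (4 ^ k)) = (0::'f)" by (rule powers_of_4)
  have s: "[0..<d] = 0 # [1..<d]" using d(1) by (simp add: upt_conv_Cons odd_pos)
  define w where "w = map (\<lambda>k. 4 ^ k :: 'f) [1..<d]"
  have w: "distinct (1 # w)" using d(2) unfolding s w_def by simp
  have sums: "sum_list w + 1 = 0" using d(3) unfolding s w_def by (simp add: add.commute)
  have "nz 1 w"
  proof (rule left_steps)
    fix i assume "i \<in> set w"
    then have "i \<in> P" "i \<noteq> 0" using nums(3) by (auto simp: w_def intro: P_intros)
    from f_P[OF this \<psi>1] show "\<psi> (i / 1 + 1 / i) \<noteq> 1" by simp
  qed (use w in auto)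
  moreover have "set w \<subseteq> S" using S_power[OF S_4] by (auto simp: w_def)
  ultimately show False using w S_1 \<psi>_0 sums assms by (intro contra[of 1 w]) auto
qed

text \<open>A square has at most two roots, so the squares are at least half of the non-zero
  elements; their negatives form a disjoint set of the same size.\<close>

lemma S_dichotomy: "x \<noteq> 0 \<Longrightarrow> x \<in> S \<or> - x \<in> S"
proof -
  assume x: "x \<noteq> 0"
  have disj: "S \<inter> uminus ` S = {}"
  proof (rule ccontr)
    assume "S \<inter> uminus ` S \<noteq> {}"
    then obtain s where "s \<in> S" "- s \<in> S" by auto
    then have "- s / s \<in> S" "s \<noteq> 0" using S_divide S_nz by blast+
    then show False using m1 by simp
  qed
  have "UNIV - {0} \<subseteq> (\<Union>s\<in>S. {y. y ^ 2 = s})" using S_square by auto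
  then have "card (UNIV - {0::'f}) \<le> card (\<Union>s\<in>S. {y::'f. y ^ 2 = s})" by (intro card_mono) auto
  also have "\<dots> \<le> (\<Sum>s\<in>S. card {y::'f. y ^ 2 = s})" by (intro card_UN_le) simp
  also have "\<dots> \<le> (\<Sum>s\<in>S. 2)"
  proof (intro sum_mono)
    fix s assume "s \<in> S"
    then obtain y where y: "s = y ^ 2" by (auto simp: S_def)
    have "card {z. z ^ 2 = s} \<le> card {y, - y}" unfolding y by (intro card_mono) (auto simp: power2_eq_iff)
    also have "\<dots> \<le> 2" by (simp add: card_insert_if)
    finally show "card {z. z ^ 2 = s} \<le> 2" .
  qed
  also have "\<dots> = card (S \<union> uminus ` S)" using disj by (subst card_Un_disjoint) (auto simp: card_image inj_on_def)
  finally have "card (UNIV - {0::'f}) \<le> card (S \<union> uminus ` S)" .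
  moreover have "S \<union> uminus ` S \<subseteq> UNIV - {0}" using S_nz by auto
  ultimately have "S \<union> uminus ` S = UNIV - {0}" by (intro card_seteq) auto
  then have "x \<in> S \<union> uminus ` S" using x by blast
  then show ?thesis by auto
qed

text \<open>Otherwise, by the dichotomy, \<open>r + 2\<close> is a square whenever \<open>r\<close>
  is, for \<open>r\<close> in the prime field with \<open>r + 2\<close> non-zero. From 1 one reaches
  all odd numbers below \<open>p\<close>, in particular \<open>p - 4\<close>; so -4 and therefore -1
  would be squares.\<close>

lemma exists_minus_two: "\<exists>r. r \<in> S \<and> r \<in> P \<and> - 2 - r \<in> S"
proof (rule ccontr)
  assume no: "\<not> ?thesis"
  have odd: "2 * k + 1 < p \<Longrightarrow> of_nat (2 * k + 1) \<in> S" for k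
  proof (induction k)
    case 0 show ?case using S_1 by simp
  next
    case (Suc k)
    define r where "r = (of_nat (2 * k + 1) :: 'f)"
    have "2 * k + 1 < p" using Suc.prems by simp
    then have r: "r \<in> S" "r \<in> P" using Suc.IH unfolding r_def by (blast, rule_tac P_of_nat)
    have r2: "of_nat (2 * Suc k + 1) = r + 2" by (simp add: r_def)
    have "of_nat (2 * Suc k + 1) \<noteq> (0::'f)" using Suc.prems by (intro small_nz) auto
    then have "r + 2 \<in> S \<or> - (r + 2) \<in> S" unfolding r2 by (rule S_dichotomy)
    moreover have "- (r + 2) = - 2 - r" by simp
    then have "- (r + 2) \<notin> S" using no r by metis
    ultimately show ?case unfolding r2 by blast
  qed
  have "odd p" using p(1,2) by (metis prime_odd_nat prime_ge_2_nat le_neq_implies_less)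
  then obtain k where k: "p = 2 * k + 1" by (elim oddE)
  then have k2: "2 * (k - 2) + 1 = p - 4" using p7 by simp
  then have "of_nat (p - 4) \<in> S" using odd[of "k - 2"] p7 by simp
  moreover have "of_nat (p - 4) = (- 4 :: 'f)" using p7 of_nat_0_iff[of p] by (simp add: of_nat_diff)
  ultimately have "(- 4 :: 'f) / 4 \<in> S" using S_divide[OF _ S_4] by metis
  moreover have "(- 4 :: 'f) / 4 = - 1" using nums(3) by simp
  ultimately show False using m1 by metis
qed

text \<open>As \<open>q 1 1\<close> is minus the value of \<psi> at 1, the geometric sums turn into
  the quantum integers 2 and 3 at this number, times a factor that depends on
  \<open>r\<close>.\<close>

lemma rcoef_eq:
  assumes "eps = - 1"
  shows "rcoef q 1 r [] (Suc 0) = inverse (\<psi> r) * (1 - \<psi> (r + 1 / r))"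
    and "rcoef q 1 r [] 2 = inverse (\<psi> r * \<psi> 1) * (1 - \<psi> 1) * (- \<psi> (r + 1 / r + 1) - 1)"
    and "rcoef q 1 r [] 3 = - inverse (\<psi> r * \<psi> 1 ^ 2) * (1 - \<psi> 1 + \<psi> 1 ^ 2) * (\<psi> (r + 1 / r + 2) - 1)"
proof -
  note R = rcoef_def[where q = q, OF q_nz]
  have two: "\<psi> 2 = \<psi> 1 * \<psi> 1" using \<psi>_add[of 1 1] by simp
  have t: "\<psi> r * inverse (\<psi> r) = 1" "\<psi> 1 * inverse (\<psi> 1) = 1" using \<psi>_nz by simp_all
  show "rcoef q 1 r [] (Suc 0) = inverse (\<psi> r) * (1 - \<psi> (r + 1 / r))"
    unfolding R using \<psi>_nz[of r] by (simp add: assms \<psi>_add field_simps)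
  show "rcoef q 1 r [] 2 = inverse (\<psi> r * \<psi> 1) * (1 - \<psi> 1) * (- \<psi> (r + 1 / r + 1) - 1)"
    using \<psi>_nz[of r] \<psi>_nz[of 1] unfolding R by (simp add: numeral_2_eq_2 assms \<psi>_add field_simps)
  show "rcoef q 1 r [] 3 = - inverse (\<psi> r * \<psi> 1 ^ 2) * (1 - \<psi> 1 + \<psi> 1 ^ 2) * (\<psi> (r + 1 / r + 2) - 1)"
    using \<psi>_nz[of r] \<psi>_nz[of 1] unfolding R by (simp add: numeral_3_eq_3 assms \<psi>_add two field_simps power2_eq_square)
qed

text \<open>The letters \<open>r\<close>, \<open>s\<close>, 1, 1 with \<open>r + s = - 2\<close> are
  even in number and have sum zero. If \<open>r\<close> or \<open>s\<close> is itself 1, the other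
  one is -3, and 1 occurs three times. The repeated 1 is why the factors \<open>rcoef\<close> have
  to be examined.\<close>

lemma case_sign_prime_field:
  assumes e: "eps = - 1" and \<psi>1: "\<psi> 1 \<noteq> 1"
  shows False
proof -
  obtain r s where rs: "r \<in> S" "r \<in> P" "s \<in> S" "s \<in> P" "r + s = - 2"
  proof -
    obtain r where "r \<in> S" "r \<in> P" "- 2 - r \<in> S" using exists_minus_two by blast
    then show ?thesis using that[of r "- 2 - r"] by (auto intro: P_intros)
  qed
  have rc1: "rcoef q 1 r [] (Suc 0) \<noteq> 0" if "r \<in> P" "r \<noteq> 0" for r
    using f_P[OF that \<psi>1] \<psi>_nz[of r] unfolding rcoef_eq[OF e] by simp
  \<comment> \<open>The factor for two copies of 1 could vanish only if \<psi> were trivial at 1 or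
    took the value -1.\<close>
  have rc2: "rcoef q 1 r [] 2 \<noteq> 0" for r
  proof -
    have "- a - 1 \<noteq> 0" if "a \<noteq> - 1" for a :: 'k
    proof
      assume "- a - 1 = 0"
      moreover have "a + 1 = - (- a - 1)" by simp
      ultimately have "a + 1 = 0" by (simp only:) simp
      then show False using that by (simp add: eq_neg_iff_add_eq_0)
    qed
    from this[OF \<psi>_ne_minus_one[of "r + 1 / r + 1"]] show ?thesis
      unfolding rcoef_eq[OF e] using \<psi>1 \<psi>_nz by simp
  qed
  show False
  proof (cases "r = 1 \<or> s = 1")
    case True
    have "s = (r + s) - r" "r = (r + s) - s" by simp_all
    then have "s = - 2 - r" "r = - 2 - s" unfolding rs(5) .
    moreover have "- 2 - 1 = (- 3 :: 'f)" by simp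
    ultimately have three: "- 3 \<in> S" using True rs(1,3) by metis
    have n3: "(1::'f) \<noteq> - 3"
    proof
      assume "(1::'f) = - 3"
      then have "1 + 3 = (0::'f)" by (metis add.left_inverse)
      then show False using nums(3) by simp
    qed
    have rc3: "rcoef q 1 (- 3) [] 3 \<noteq> 0"
    proof -
      \<comment> \<open>A zero of the quadratic factor would have cube -1, but the cube of this
        value is again a value of \<psi>.\<close>
      have "(\<psi> 1 + 1) * (1 - \<psi> 1 + \<psi> 1 ^ 2) = 1 + \<psi> 1 ^ 3" by (simp add: algebra_simps power2_eq_square power3_eq_cube)
      moreover have "1 + \<psi> 1 ^ 3 \<noteq> 0" using \<psi>_ne_minus_one[of "of_nat 3 * 1"] \<psi>_of_nat[of 3 1] by (simp add: add_eq_0_iff)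
      ultimately have "1 - \<psi> 1 + \<psi> 1 ^ 2 \<noteq> 0" by auto
      moreover have "\<psi> (- 3 + 1 / - 3 + 2) \<noteq> 1"
      proof (rule \<psi>_P_ne[OF _ _ \<psi>1])
        show "- 3 + 1 / - 3 + 2 \<in> P" by (intro P_intros)
        have "(- 3) * (- 3 + 1 / - 3 + 2) = (4 :: 'f)" using nums(2) by (simp add: distrib_left)
        then show "- 3 + 1 / - 3 + 2 \<noteq> (0::'f)" using nums(3) by (metis mult_zero_right)
      qed
      ultimately show ?thesis unfolding rcoef_eq[OF e] using \<psi>_nz by simp
    qed
    have "nz (- 3) (replicate 3 1 @ [])"
    proof (rule zop_nonzero_replicate[OF q_nz _ n3 nz_Nil])
      fix k :: nat assume "1 \<le> k" "k \<le> 3"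
      then consider "k = Suc 0" | "k = 2" | "k = 3" by linarith
      then show "rcoef q 1 (- 3) [] k \<noteq> 0" using rc1[of "- 3"] rc2 rc3 nums(2) by cases (auto intro: P_intros)
    qed simp
    then have "nz (- 3) [1, 1, 1]" by (simp add: numeral_3_eq_3 del: zop.simps)
    then show False using three S_1 n3 \<psi>_0 by (intro contra[of "- 3" "[1, 1, 1]"]) auto
  next
    case False
    have rs0: "r \<noteq> 0" "s \<noteq> 0" using rs S_nz by auto
    have ne: "r \<noteq> s"
    proof
      assume "r = s"
      then have "2 * r = 2 * (- 1)" using rs(5) by simp
      then have "r = - 1" using nums(1) by (metis mult_cancel_left)
      then show False using rs(1) m1 by simp
    qed
    have "nz r (replicate 2 1 @ [])"
    proof (rule zop_nonzero_replicate[OF q_nz _ _ nz_Nil])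
      fix k :: nat assume "1 \<le> k" "k \<le> 2"
      then consider "k = Suc 0" | "k = 2" by linarith
      then show "rcoef q 1 r [] k \<noteq> 0" using rc1[OF rs(2) rs0(1)] rc2 by cases auto
    qed (use False in auto)
    then have "nz r [1, 1]" by (simp add: numeral_2_eq_2 del: zop.simps)
    then have "nz r [s, 1, 1]"
    proof (rule left_step)
      have "f (s / r) \<noteq> 1" using rs rs0 by (intro f_P \<psi>1) (auto intro: P_intros)
      then show "\<psi> (s / r + r / s) \<noteq> 1" by simp
    qed (use False ne in auto)
    moreover have "sum_list [s, 1, 1] + r = 0" using rs(5) by (simp add: algebra_simps eq_neg_iff_add_eq_0)
    ultimately show False using rs S_1 False ne \<psi>_0 by (intro contra[of r "[s, 1, 1]"]) auto
  qed
qed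

text \<open>\<psi> is trivial on the prime field, so letters from it are not linked to one another
  and some \<rho> outside is called for. The proof splits on whether there is a square \<rho> that
  is not linked to 1 although \<psi> is non-trivial at \<rho>.\<close>

lemma case_sign_trivial_one:
  assumes e: "eps = - 1" and \<psi>1: "\<psi> 1 = 1" and c: "\<psi> c \<noteq> 1"
  shows False
proof -
  have P1: "\<psi> x = 1" if "x \<in> P" for x by (rule \<psi>_P[OF that \<psi>1])
  show False
  proof (cases "\<exists>\<rho>\<in>S. f \<rho> = 1 \<and> \<psi> \<rho> \<noteq> 1")
    case True
    then obtain \<rho> where \<rho>: "\<rho> \<in> S" "f \<rho> = 1" "\<psi> \<rho> \<noteq> 1" by blast
    \<comment> \<open>The letters are the products of \<open>{1, t, t\<^sup>2}\<close> and \<open>{1, \<rho>}\<close>, in an order for which every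
      commutator is non-zero.\<close>
    have r0: "\<rho> \<noteq> 0" by (rule S_nz[OF \<rho>(1)])
    \<comment> \<open>Scaling the argument by \<open>u\<close> in the prime field keeps the value
      trivial; removing \<open>\<rho> + 1 / \<rho>\<close>, where \<psi> is trivial too, isolates a
      multiple of \<rho>.\<close>
    have h: "\<psi> (\<rho> * u + 1 / (\<rho> * u)) \<noteq> 1" if u: "u \<in> P" "u \<noteq> 0" "u ^ 2 \<noteq> 1" for u
    proof
      assume "\<psi> (\<rho> * u + 1 / (\<rho> * u)) = 1"
      from \<psi>_P_mult[OF u(1) this] have a: "\<psi> (u * (\<rho> * u + 1 / (\<rho> * u))) = 1" .
      have "(u ^ 2 - 1) * \<rho> = u * (\<rho> * u + 1 / (\<rho> * u)) + - (\<rho> + 1 / \<rho>)"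
        using u(2) r0 by (simp add: field_simps power2_eq_square)
      then have "\<psi> ((u ^ 2 - 1) * \<rho>) = 1" using a \<rho>(2) by (simp only: \<psi>_add \<psi>_minus) simp
      then show False using \<psi>_P_cancel[of "u ^ 2 - 1" \<rho>] \<rho>(3) u by (auto intro: P_intros)
    qed
    \<comment> \<open>Of the number 4 only the facts listed next are used: a square in the prime
      field to which, as well as to its square and their inverses, \<open>h\<close> applies.\<close>
    define t :: 'f where "t = 4"
    have t: "t \<in> P" "t \<in> S" "t \<noteq> 0" "t \<noteq> 1" "t ^ 2 \<noteq> 1" "(t ^ 2) ^ 2 \<noteq> 1"
      using S_4 nums nums' by (simp_all add: t_def)
    have ht: "\<psi> (\<rho> * t + 1 / (\<rho> * t)) \<noteq> 1" "\<psi> (\<rho> / t + t / \<rho>) \<noteq> 1"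
      "\<psi> (\<rho> * t ^ 2 + 1 / (\<rho> * t ^ 2)) \<noteq> 1" "\<psi> (\<rho> / t ^ 2 + t ^ 2 / \<rho>) \<noteq> 1"
      using h[of t] h[of "inverse t"] h[of "t ^ 2"] h[of "inverse (t ^ 2)"] t
      by (simp_all add: P_intros power_inverse divide_inverse mult.commute)
    have nP: "\<rho> * u \<notin> P" if "u \<in> P" "u \<noteq> 0" for u
    proof
      assume "\<rho> * u \<in> P"
      from P_divide[OF this that(1)] have "\<rho> \<in> P" using that(2) by simp
      then show False using P1 \<rho>(3) by blast
    qed
    have dP: "x \<noteq> y" "y \<noteq> x" if "x \<in> P" "y \<notin> P" for x y using that by auto
    define t2 where "t2 = t ^ 2"
    have t2: "t2 \<in> P" "t2 \<in> S" "t2 \<noteq> 0" "t2 \<noteq> 1" "t2 \<noteq> t"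
      using t S_power[OF t(2), of 2] by (auto simp: t2_def P_intros power2_eq_square)
    have nPs: "\<rho> \<notin> P" "\<rho> * t \<notin> P" "\<rho> * t2 \<notin> P" using nP[of 1] nP[of t] nP[of t2] t t2 by auto
    have ne: "1 \<noteq> \<rho>" "1 \<noteq> \<rho> * t" "1 \<noteq> \<rho> * t2" "t \<noteq> \<rho>" "t \<noteq> \<rho> * t" "t \<noteq> \<rho> * t2" "t2 \<noteq> \<rho>" "t2 \<noteq> \<rho> * t" "t2 \<noteq> \<rho> * t2"
      using nPs t(1) t2(1) P_1 by metis+
    have ne': "\<rho> \<noteq> \<rho> * t" "\<rho> \<noteq> \<rho> * t2" "\<rho> * t \<noteq> \<rho> * t2" "1 \<noteq> t" "1 \<noteq> t2" "t \<noteq> t2" using r0 t t2 by auto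
    note ne = ne ne' ne[symmetric] ne'[symmetric]
    have ht2: "\<psi> (\<rho> * t2 + 1 / (\<rho> * t2)) \<noteq> 1" "\<psi> (\<rho> / t2 + t2 / \<rho>) \<noteq> 1" using ht by (simp_all add: t2_def)
    \<comment> \<open>In the right tests below, the prime field elements and
      \<open>\<rho> + 1 / \<rho>\<close> can be discarded; one ratio covered by \<open>ht\<close> or
      \<open>ht2\<close> stays.\<close>
    have drop: "\<psi> (x + y) \<noteq> 1" if "\<psi> y = 1" "\<psi> x \<noteq> 1" for x y using that by (simp add: \<psi>_add)
    have 1: "nz 1 [\<rho> * t]"
      by (rule left_step[OF nz_Nil]) (use ht(1) ne in auto)
    have 2: "nz 1 [t2, \<rho> * t]"
    proof (rule right_step[OF 1])
      have eq: "(sum_list [\<rho> * t] + 1) / t2 + t2 * (sum_list (map inverse [\<rho> * t]) + inverse 1) = (\<rho> / t + t / \<rho>) + (1 / t2 + t2)"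
        using t(3) r0 by (simp add: t2_def field_simps power2_eq_square)
      have "\<psi> (1 / t2 + t2) = 1" using t2 by (intro P1 P_intros)
      then show "\<psi> ((sum_list [\<rho> * t] + 1) / t2 + t2 * (sum_list (map inverse [\<rho> * t]) + inverse 1)) \<noteq> 1"
        unfolding eq using ht(2) by (rule drop)
    qed (use ne in auto)
    have 3: "nz 1 [\<rho>, t2, \<rho> * t]"
    proof (rule right_step[OF 2])
      have eq: "(sum_list [t2, \<rho> * t] + 1) / \<rho> + \<rho> * (sum_list (map inverse [t2, \<rho> * t]) + inverse 1) = (\<rho> / t2 + t2 / \<rho>) + ((\<rho> + 1 / \<rho>) + (t + 1 / t))"
        using t(3) t2(3) r0 by (simp add: field_simps)
      have "\<psi> (t + 1 / t) = 1" using t by (intro P1 P_intros)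
      then have "\<psi> ((\<rho> + 1 / \<rho>) + (t + 1 / t)) = 1" unfolding \<psi>_add[of "\<rho> + 1 / \<rho>"] using \<rho>(2) by simp
      then show "\<psi> ((sum_list [t2, \<rho> * t] + 1) / \<rho> + \<rho> * (sum_list (map inverse [t2, \<rho> * t]) + inverse 1)) \<noteq> 1"
        unfolding eq using ht2(2) by (rule drop)
    qed (use ne in auto)
    have 4: "nz 1 [t, \<rho>, t2, \<rho> * t]"
    proof (rule right_step[OF 3])
      have eq: "(sum_list [\<rho>, t2, \<rho> * t] + 1) / t + t * (sum_list (map inverse [\<rho>, t2, \<rho> * t]) + inverse 1) = (\<rho> / t + t / \<rho>) + ((\<rho> + 1 / \<rho>) + (t2 / t + 1 / t + t / t2 + t))"
        using t(3) t2(3) r0 by (simp add: field_simps)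
      have "\<psi> (t2 / t + 1 / t + t / t2 + t) = 1" using t t2 by (intro P1 P_intros)
      then have "\<psi> ((\<rho> + 1 / \<rho>) + (t2 / t + 1 / t + t / t2 + t)) = 1" unfolding \<psi>_add[of "\<rho> + 1 / \<rho>"] using \<rho>(2) by simp
      then show "\<psi> ((sum_list [\<rho>, t2, \<rho> * t] + 1) / t + t * (sum_list (map inverse [\<rho>, t2, \<rho> * t]) + inverse 1)) \<noteq> 1"
        unfolding eq using ht(2) by (rule drop)
    qed (use ne in auto)
    have 5: "nz 1 [\<rho> * t2, t, \<rho>, t2, \<rho> * t]"
      by (rule left_step[OF 4]) (use ht2(1) ne in auto)
    let ?w = "[\<rho> * t2, t, \<rho>, t2, \<rho> * t]"
    have sub: "set ?w \<subseteq> S" using t t2 \<rho>(1) by (auto intro: S_mult)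
    \<comment> \<open>The six letters form a product set, so both sums factor. The result is a prime
      field multiple of an element where \<psi> is trivial.\<close>
    have "(sum_list ?w + 1) * (sum_list (map inverse ?w) + inverse 1)
      = ((1 + t + t2) * (1 + 1 / t + 1 / t2)) * (2 + (\<rho> + 1 / \<rho>))"
    proof -
      have "sum_list ?w + 1 = (1 + t + t2) * (1 + \<rho>)" by (simp add: algebra_simps)
      moreover have "sum_list (map inverse ?w) + inverse 1 = (1 + 1 / t + 1 / t2) * (1 + 1 / \<rho>)"
        using t(3) t2(3) r0 by (simp add: field_simps)
      moreover have "(1 + \<rho>) * (1 + 1 / \<rho>) = 2 + (\<rho> + 1 / \<rho>)" using r0 by (simp add: field_simps)
      ultimately show ?thesis by (simp only: mult.assoc mult.left_commute)
    qed
    moreover have inP: "(1 + t + t2) * (1 + 1 / t + 1 / t2) \<in> P" using t t2 by (intro P_intros)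
    moreover have "\<psi> (2 + (\<rho> + 1 / \<rho>)) = 1" unfolding \<psi>_add[of 2] using \<rho>(2) P1[OF P_numeral] by simp
    ultimately have "\<psi> ((sum_list ?w + 1) * (sum_list (map inverse ?w) + inverse 1)) = 1"
      using \<psi>_P_mult[of "(1 + t + t2) * (1 + 1 / t + 1 / t2)" "2 + (\<rho> + 1 / \<rho>)"] inP by (simp only:)
    moreover have "1 \<notin> set ?w" using ne by auto
    ultimately show False by (intro contra[OF _ sub S_1 5]) simp_all
  next
    case False
    then have triv: "\<rho> \<in> S \<Longrightarrow> f \<rho> = 1 \<Longrightarrow> \<psi> \<rho> = 1" for \<rho> by blast
    obtain \<rho> where \<rho>: "\<rho> \<in> S" "f \<rho> \<noteq> 1" using exists_edge[OF \<psi>1 c] by blast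
    have r0: "\<rho> \<noteq> 0" by (rule S_nz[OF \<rho>(1)])
    \<comment> \<open>Were \<open>i\<close> and \<rho> not linked, \<open>triv\<close> at both
      ratios would make \<psi> trivial at \<rho> and at \<open>1 / \<rho>\<close>, against the
      choice of \<rho>.\<close>
    have edge: "\<psi> (i / \<rho> + \<rho> / i) \<noteq> 1" if i: "i \<in> P" "i \<in> S" for i
    proof
      assume *: "\<psi> (i / \<rho> + \<rho> / i) = 1"
      have i0: "i \<noteq> 0" by (rule S_nz[OF i(2)])
      have "f (\<rho> / i) = 1" "f (i / \<rho>) = 1" using * by (simp_all add: add.commute)
      then have "\<psi> (\<rho> / i) = 1" "\<psi> (i / \<rho>) = 1" using triv S_divide i(2) \<rho>(1) by auto
      then have "\<psi> (i * (\<rho> / i)) = 1" "\<psi> (inverse i * (i / \<rho>)) = 1"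
        using \<psi>_P_mult[OF i(1)] \<psi>_P_mult[OF P_inverse[OF i(1)]] by blast+
      moreover have "i * (\<rho> / i) = \<rho>" "inverse i * (i / \<rho>) = 1 / \<rho>" using i0 by (simp_all add: field_simps)
      ultimately have "\<psi> \<rho> = 1" "\<psi> (1 / \<rho>) = 1" by metis+
      then show False using \<rho>(2) by (simp add: \<psi>_add)
    qed
    obtain d where d: "odd d" "distinct (map (\<lambda>k. 4 ^ k :: 'f) [0..<d])"
      "(\<Sum>k\<leftarrow>[0..<d]. 4 ^ k) = (0::'f)" "(\<Sum>k\<leftarrow>[0..<d]. inverse (4 ^ k)) = (0::'f)" by (rule powers_of_4)
    define w where "w = map (\<lambda>k. 4 ^ k :: 'f) [0..<d]"
    have w: "set w \<subseteq> S" "set w \<subseteq> P" using S_power[OF S_4] by (auto simp: w_def intro: P_intros)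
    have "\<rho> \<notin> P" using \<rho>(2) P1[of "\<rho> + 1 / \<rho>"] by (auto intro: P_intros)
    then have nin: "\<rho> \<notin> set w" using w by blast
    have "nz \<rho> w"
      by (rule left_steps) (use d(2) nin w edge in \<open>auto simp: w_def\<close>)
    \<comment> \<open>The powers of 4 add nothing to either sum, which leaves
      \<open>\<rho> * inverse \<rho> = 1\<close>, where \<psi> is trivial. With \<rho> the number of
      letters is \<open>d + 1\<close>, which is even.\<close>
    moreover have "\<psi> ((sum_list w + \<rho>) * (sum_list (map inverse w) + inverse \<rho>)) = 1"
      using d(3,4) r0 \<psi>1 by (simp add: w_def o_def)
    ultimately show False using d(1) by (intro contra[OF nin w(1) \<rho>(1)]) (simp_all add: w_def)
  qed
qed

end

theorem trivial:
  shows "eps = - 1" and "\<psi> x = 1"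
proof -
  have "\<psi> x = 1" for x
  proof (rule ccontr)
    assume *: "\<psi> x \<noteq> 1"
    show False
    proof (cases "- 1 \<in> S")
      case True then show ?thesis using case_minus_one_square * by blast
    next
      case False
      then show ?thesis using case_trivial_sign[OF False] case_sign_prime_field[OF False] case_sign_trivial_one[OF False _ _ *] eps_cases by blast
    qed
  qed
  then show "\<psi> x = 1" "eps = - 1" using Q_ne eps_cases by auto
qed

end

section \<open>The group \<open>SL(2, F)\<close>\<close>

lemma mat22_nth [simp]: "mat22 a b c d $ 1 $ 1 = a" "mat22 a b c d $ 1 $ 2 = b" "mat22 a b c d $ 2 $ 1 = c" "mat22 a b c d $ 2 $ 2 = d"
  by (simp_all add: mat22_def vector_2)

lemma mat22_cases: obtains a b c d where "A = mat22 a b c d"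
  using that[of "A $ 1 $ 1" "A $ 1 $ 2" "A $ 2 $ 1" "A $ 2 $ 2"] by (simp add: vec_eq_iff forall_2)

lemma mat22_inject [simp]: "mat22 a b c d = mat22 a' b' c' d' \<longleftrightarrow> a = a' \<and> b = b' \<and> c = c' \<and> d = d'"
  by (simp add: vec_eq_iff forall_2)

lemma mat22_mult: "mat22 a b c d ** mat22 a' b' c' d' = mat22 (a * a' + b * c') (a * b' + b * d') (c * a' + d * c') (c * b' + d * d')"
  by (simp add: vec_eq_iff forall_2 matrix_matrix_mult_def sum_2)

lemma mat22_det: "det (mat22 a b c d) = a * d - b * c"
  by (simp add: det_2)

lemma mat22_one: "mat 1 = mat22 1 0 0 1"
  by (simp add: vec_eq_iff forall_2 mat_def)

lemma mat22_uminus: "- mat22 a b c d = mat22 (- a) (- b) (- c) (- d)"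
  by (simp add: vec_eq_iff forall_2)

lemma SL2_simps [simp]:
  "mat22 a b c d \<in> carrier SL2 \<longleftrightarrow> a * d - b * c = 1"
  "x \<otimes>\<^bsub>SL2\<^esub> y = x ** y" "\<one>\<^bsub>SL2\<^esub> = mat22 1 0 0 1"
  by (simp_all add: SL2_def mat22_det mat22_one)

lemma SL2_group: "group (SL2 :: ('f::field^2^2) monoid)"
proof (rule groupI)
  fix x y z :: "'f^2^2" assume x: "x \<in> carrier SL2" and y: "y \<in> carrier SL2"
  show "x \<otimes>\<^bsub>SL2\<^esub> y \<in> carrier SL2" using x y by (simp add: SL2_def det_mul)
  show "x \<otimes>\<^bsub>SL2\<^esub> y \<otimes>\<^bsub>SL2\<^esub> z = x \<otimes>\<^bsub>SL2\<^esub> (y \<otimes>\<^bsub>SL2\<^esub> z)" by (simp add: matrix_mul_assoc)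
  obtain a b c d where e: "x = mat22 a b c d" by (rule mat22_cases)
  show "\<one>\<^bsub>SL2\<^esub> \<otimes>\<^bsub>SL2\<^esub> x = x" by (simp add: e mat22_mult)
  show "\<exists>y\<in>carrier SL2. y \<otimes>\<^bsub>SL2\<^esub> x = \<one>\<^bsub>SL2\<^esub>"
    using x by (intro bexI[of _ "mat22 d (- b) (- c) a"]) (simp_all add: e mat22_mult algebra_simps)
qed simp

lemma SL2_inv:
  assumes "a * d - b * c = 1"
  shows "inv\<^bsub>SL2\<^esub> (mat22 a b c d) = mat22 d (- b) (- c) a"
  using assms by (intro group.inv_equality[OF SL2_group]) (simp_all add: mat22_mult algebra_simps)

lemma pm_upper:
  "mat 1 ** upper_unip t = mat22 1 t 0 1" "(- mat 1) ** upper_unip t = mat22 (- 1) (- t) 0 (- 1)"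
  by (simp_all add: upper_unip_def mat22_one mat22_uminus mat22_mult)

lemma centralizer_eq:
  assumes x: "(x::'f::field) \<noteq> 0"
  shows "centralizer SL2 (mat22 (- 1) x 0 (- 1)) = {mat22 s t 0 s | s t. s = 1 \<or> s = - 1}"
proof (rule Set.set_eqI)
  fix A :: "'f^2^2"
  obtain a b c d where A: "A = mat22 a b c d" by (rule mat22_cases)
  have "A \<in> centralizer SL2 (mat22 (- 1) x 0 (- 1)) \<longleftrightarrow> a * d - b * c = 1 \<and> c = 0 \<and> a = d"
    using x by (auto simp: centralizer_def A mat22_mult algebra_simps)
  also have "\<dots> \<longleftrightarrow> c = 0 \<and> a = d \<and> (a = 1 \<or> a = - 1)"
    using square_eq_1_iff[of a] by auto
  also have "\<dots> \<longleftrightarrow> A \<in> {mat22 s t 0 s | s t. s = 1 \<or> s = - 1}"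
    by (auto simp: A)
  finally show "A \<in> centralizer SL2 (mat22 (- 1) x 0 (- 1)) \<longleftrightarrow> A \<in> {mat22 s t 0 s | s t. s = 1 \<or> s = - 1}" .
qed

lemma pm_upper_set: "{s ** upper_unip t | s t. s \<in> plus_minus_one} = {mat22 s t 0 s | s t. s = 1 \<or> s = (- 1 :: 'f::field)}"
proof (intro equalityI subsetI)
  fix A :: "'f^2^2" assume "A \<in> {s ** upper_unip t | s t. s \<in> plus_minus_one}"
  then show "A \<in> {mat22 s t 0 s | s t. s = 1 \<or> s = - 1}"
    unfolding plus_minus_one_def by (auto simp: pm_upper simp del: matrix_mul_lid)
next
  fix A :: "'f^2^2" assume "A \<in> {mat22 s t 0 s | s t. s = 1 \<or> s = - 1}"
  then consider t where "A = mat22 1 t 0 1" | t where "A = mat22 (- 1) t 0 (- 1)" by auto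
  then show "A \<in> {s ** upper_unip t | s t. s \<in> plus_minus_one}"
  proof cases
    case (1 t)
    then have "A = mat 1 ** upper_unip t" by (simp only: pm_upper)
    then show ?thesis unfolding plus_minus_one_def by blast
  next
    case (2 t)
    then have "A = (- mat 1) ** upper_unip (- t)" by (simp only: pm_upper minus_minus)
    then show ?thesis unfolding plus_minus_one_def by blast
  qed
qed

text \<open>Injectivity rests on 1 and -1 being distinct, which is where \<open>two\<close>
  enters.\<close>

lemma pm_upper_iso:
  assumes x: "(x::'f::field) \<noteq> 0" and two: "(2::'f) \<noteq> 0"
  shows "(\<lambda>(s, t). s ** upper_unip t) \<in>
      iso (SL2\<lparr>carrier := plus_minus_one\<rparr> \<times>\<times> add_monoid (ring_of_type_algebra :: 'f ring))
          (SL2\<lparr>carrier := centralizer SL2 (mat22 (- 1) x 0 (- 1))\<rparr>)"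
proof (rule isoI)
  let ?f = "\<lambda>(s :: 'f^2^2, t). s ** upper_unip t"
  have ne: "- 1 \<noteq> (1::'f)" "1 \<noteq> (- 1 :: 'f)"
  proof -
    show "- 1 \<noteq> (1::'f)"
    proof
      assume "- 1 = (1::'f)"
      then have "1 + 1 = (0::'f)" by (metis add.right_inverse)
      then show False using two by simp
    qed
    then show "1 \<noteq> (- 1 :: 'f)" by metis
  qed
  have C: "centralizer SL2 (mat22 (- 1) x 0 (- 1)) = {s ** upper_unip t | s t. s \<in> plus_minus_one}"
    unfolding centralizer_eq[OF x] pm_upper_set ..
  show "?f \<in> hom (SL2\<lparr>carrier := plus_minus_one\<rparr> \<times>\<times> add_monoid (ring_of_type_algebra :: 'f ring))
          (SL2\<lparr>carrier := centralizer SL2 (mat22 (- 1) x 0 (- 1))\<rparr>)"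
  proof (rule homI)
    fix a :: "('f^2^2) \<times> 'f"
    assume "a \<in> carrier (SL2\<lparr>carrier := plus_minus_one\<rparr> \<times>\<times> add_monoid (ring_of_type_algebra :: 'f ring))"
    then show "?f a \<in> carrier (SL2\<lparr>carrier := centralizer SL2 (mat22 (- 1) x 0 (- 1))\<rparr>)"
      unfolding C by (cases a) (auto simp: DirProd_def)
  next
    fix a b :: "('f^2^2) \<times> 'f"
    assume "a \<in> carrier (SL2\<lparr>carrier := plus_minus_one\<rparr> \<times>\<times> add_monoid (ring_of_type_algebra :: 'f ring))"
      "b \<in> carrier (SL2\<lparr>carrier := plus_minus_one\<rparr> \<times>\<times> add_monoid (ring_of_type_algebra :: 'f ring))"
    then show "?f (a \<otimes>\<^bsub>SL2\<lparr>carrier := plus_minus_one\<rparr> \<times>\<times> add_monoid ring_of_type_algebra\<^esub> b)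
      = ?f a \<otimes>\<^bsub>SL2\<lparr>carrier := centralizer SL2 (mat22 (- 1) x 0 (- 1))\<rparr>\<^esub> ?f b"
      by (cases a; cases b)
        (auto simp: DirProd_def plus_minus_one_def upper_unip_def mat22_one mat22_uminus mat22_mult)
  qed
  show "bij_betw ?f (carrier (SL2\<lparr>carrier := plus_minus_one\<rparr> \<times>\<times> add_monoid (ring_of_type_algebra :: 'f ring)))
          (carrier (SL2\<lparr>carrier := centralizer SL2 (mat22 (- 1) x 0 (- 1))\<rparr>))"
    unfolding bij_betw_def
  proof
    show "inj_on ?f (carrier (SL2\<lparr>carrier := plus_minus_one\<rparr> \<times>\<times> add_monoid (ring_of_type_algebra :: 'f ring)))"
      using ne by (auto simp: inj_on_def DirProd_def plus_minus_one_def pm_upper simp del: matrix_mul_lid)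
    show "?f ` carrier (SL2\<lparr>carrier := plus_minus_one\<rparr> \<times>\<times> add_monoid (ring_of_type_algebra :: 'f ring))
      = carrier (SL2\<lparr>carrier := centralizer SL2 (mat22 (- 1) x 0 (- 1))\<rparr>)"
      unfolding C by (auto simp: DirProd_def image_iff)
  qed
qed

lemma kring_units: "x \<in> carrier (units_of kring) \<Longrightarrow> x \<noteq> 0"
  by (auto simp: units_of_def Units_def)

theorem chi_sgn_triv:
  fixes chi :: "'f::{field, finite}^2^2 \<Rightarrow> 'k::field_char_0"
  assumes p: "Factorial_Ring.prime p" "p \<noteq> 2" "p \<noteq> 3" and card: "CARD('f) = p ^ m"
    and x: "x \<noteq> 0"
    and hom: "chi \<in> hom (SL2\<lparr>carrier := centralizer SL2 (mat22 (- 1) x 0 (- 1))\<rparr>) (units_of ring_of_type_algebra)"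
    and fd: "fin_dim (yd_nichols SL2 (yd_V SL2 (mat22 (- 1) x 0 (- 1)) chi))"
  shows "chi (mat22 1 t 0 1) = 1" "chi (mat22 (- 1) t 0 (- 1)) = - 1"
proof -
  let ?g = "mat22 (- 1) x 0 (- 1)"
  note C = centralizer_eq[OF x]
  have C1: "mat22 1 t 0 1 \<in> centralizer SL2 ?g" "mat22 (- 1) t 0 (- 1) \<in> centralizer SL2 ?g" for t
    unfolding C by blast+
  have chi_mult: "chi (a ** b) = chi a * chi b" if "a \<in> centralizer SL2 ?g" "b \<in> centralizer SL2 ?g" for a b
    using hom_mult[OF hom, of a b] that by (simp add: units_of_def)
  have chi_nz: "chi a \<noteq> 0" if "a \<in> centralizer SL2 ?g" for a
    using hom_in_carrier[OF hom, of a] that by (intro kring_units) simp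
  interpret Y: induced_yd "SL2 :: ('f^2^2) monoid" ?g chi
  proof (intro induced_yd.intro induced_yd_axioms.intro)
    show "group (SL2 :: ('f^2^2) monoid)" by (rule SL2_group)
  qed (use chi_mult chi_nz in auto)
  \<comment> \<open>The factor \<open>- x\<close> is a normalization: the matrix with diagonal -1
    and corner \<open>x * y\<close> is \<open>- mat 1\<close> times the unipotent matrix with corner
    \<open>- x * y\<close>.\<close>
  define \<psi> where "\<psi> y = chi (mat22 1 (- x * y) 0 1)" for y
  define eps where "eps = chi (mat22 (- 1) 0 0 (- 1))"
  have split: "chi (mat22 (- 1) (x * y) 0 (- 1)) = eps * \<psi> y" for y
    using chi_mult[OF C1(2)[of 0] C1(1)[of "- x * y"]] by (simp add: mat22_mult eps_def \<psi>_def)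
  have \<psi>_add: "\<psi> (y + z) = \<psi> y * \<psi> z" for y z
    using chi_mult[OF C1(1)[of "- x * z"] C1(1)[of "- x * y"]] by (simp add: mat22_mult \<psi>_def algebra_simps)
  have one: "chi (mat22 1 0 0 1) = 1" using Y.chi_one by simp
  have eps2: "eps * eps = 1"
    using chi_mult[OF C1(2)[of 0] C1(2)[of 0]] one by (simp add: mat22_mult eps_def)
  define S where "S = {r::'f. r \<noteq> 0 \<and> (\<exists>y. r = y ^ 2)}"
  \<comment> \<open>Either root serves: the other one changes the diagonal matrix
    \<open>hh r\<close> by the central element \<open>- mat 1\<close>.\<close>
  define rt where "rt r = (SOME a. r = a ^ 2)" for r :: 'f
  have rt: "r = rt r ^ 2" "rt r \<noteq> 0" if "r \<in> S" for r
  proof -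
    have "\<exists>a. r = a ^ 2" using that by (auto simp: S_def)
    then show "r = rt r ^ 2" unfolding rt_def by (rule someI_ex)
    then show "rt r \<noteq> 0" using that by (auto simp: S_def)
  qed
  define hh where "hh r = mat22 (rt r) 0 0 (1 / rt r)" for r
  have hh: "hh r \<in> carrier SL2" if "r \<in> S" for r using rt[OF that] by (simp add: hh_def)
  have hinv: "inv\<^bsub>SL2\<^esub> hh r = mat22 (1 / rt r) 0 0 (rt r)" if "r \<in> S" for r
    using SL2_inv[of "rt r" "1 / rt r" 0 0] rt[OF that] by (simp add: hh_def)
  \<comment> \<open>Conjugation by a diagonal matrix of determinant 1 multiplies the corner entry by
    a square, so the letters are indexed by squares.\<close>
  have conj: "inv\<^bsub>SL2\<^esub> (hh s) \<otimes>\<^bsub>SL2\<^esub> (hh t \<otimes>\<^bsub>SL2\<^esub> ?g \<otimes>\<^bsub>SL2\<^esub> inv\<^bsub>SL2\<^esub> (hh t)) \<otimes>\<^bsub>SL2\<^esub> hh s = mat22 (- 1) (x * (t / s)) 0 (- 1)"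
    if "s \<in> S" "t \<in> S" for s t
  proof -
    have e: "t / s = rt t ^ 2 / rt s ^ 2" using rt(1)[OF that(1)] rt(1)[OF that(2)] by simp
    show ?thesis unfolding e hinv[OF that(1)] hinv[OF that(2)]
      using rt(2)[OF that(1)] rt(2)[OF that(2)]
      by (simp add: hh_def mat22_mult field_simps power2_eq_square)
  qed
  have "\<exists>N. \<forall>v\<in>lists S. N \<le> length v \<longrightarrow> qword (\<lambda>r s. eps * \<psi> (r / s)) v wsingle = (\<lambda>u. 0)"
  proof (rule Y.yd_qword_vanish[OF hh _ _ _ fd])
    fix s t assume st: "s \<in> S" "t \<in> S"
    show "inv\<^bsub>SL2\<^esub> (hh s) \<otimes>\<^bsub>SL2\<^esub> (hh t \<otimes>\<^bsub>SL2\<^esub> ?g \<otimes>\<^bsub>SL2\<^esub> inv\<^bsub>SL2\<^esub> (hh t)) \<otimes>\<^bsub>SL2\<^esub> hh s \<in> centralizer SL2 ?g"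
      unfolding conj[OF st] by (rule C1)
    show "eps * \<psi> (t / s) = chi (inv\<^bsub>SL2\<^esub> (hh s) \<otimes>\<^bsub>SL2\<^esub> (hh t \<otimes>\<^bsub>SL2\<^esub> ?g \<otimes>\<^bsub>SL2\<^esub> inv\<^bsub>SL2\<^esub> (hh t)) \<otimes>\<^bsub>SL2\<^esub> hh s)"
      unfolding conj[OF st] split ..
    \<comment> \<open>Elements of the centralizer have equal diagonal entries, so different squares
      give different cosets and hence independent vectors.\<close>
    assume "inv\<^bsub>SL2\<^esub> (hh s) \<otimes>\<^bsub>SL2\<^esub> hh t \<in> centralizer SL2 ?g"
    then have "rt t / rt s = rt s / rt t" unfolding C hinv[OF st(1)] by (auto simp: hh_def mat22_mult)
    then have "rt t ^ 2 = rt s ^ 2" using rt(2)[OF st(1)] rt(2)[OF st(2)] by (simp add: field_simps power2_eq_square)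
    then show "s = t" using rt(1)[OF st(1)] rt(1)[OF st(2)] by simp
  qed
  then obtain N where N: "\<And>v. set v \<subseteq> S \<Longrightarrow> N \<le> length v \<Longrightarrow> qword (\<lambda>r s. eps * \<psi> (r / s)) v wsingle = (\<lambda>u. 0)"
    by (auto simp: lists_eq_set)
  interpret B: square_braiding \<psi> eps p m N
  proof
    show "\<psi> 0 = 1" using one by (simp add: \<psi>_def)
  qed (use \<psi>_add eps2 p card N in \<open>auto simp: S_def\<close>)
  have \<psi>t: "\<psi> (- t / x) = 1" for t by (rule B.trivial(2))
  show "chi (mat22 1 t 0 1) = 1" using \<psi>t[of t] x by (simp add: \<psi>_def)
  show "chi (mat22 (- 1) t 0 (- 1)) = - 1" using split[of "t / x"] B.trivial x by simp
qed

theorem proposition3p9: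
  fixes p q m :: nat
    and g :: "'f::{field, finite}^2^2"
  assumes "Factorial_Ring.prime p" and "p \<noteq> 2" and "p \<noteq> 3"
    and "q = p ^ m" and "m > 0"
    and "CARD('f) = q"
    and "g = mat22 (-1) 1 0 (-1) \<or>
         (\<exists>x. x \<noteq> 0 \<and> \<not> (\<exists>y. x = y ^ 2) \<and> g = mat22 (-1) x 0 (-1))"
  shows "centralizer SL2 g = {s ** upper_unip t | s t. s \<in> plus_minus_one} \<and>
    (\<lambda>(s, t). s ** upper_unip t) \<in>
      iso (SL2\<lparr>carrier := plus_minus_one\<rparr> \<times>\<times> add_monoid (ring_of_type_algebra :: 'f ring))
          (SL2\<lparr>carrier := centralizer SL2 g\<rparr>) \<and>
    (\<forall>chi :: 'f^2^2 \<Rightarrow> 'k::{alg_closed_field, field_char_0}.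
       chi \<in> hom (SL2\<lparr>carrier := centralizer SL2 g\<rparr>) (units_of ring_of_type_algebra) \<longrightarrow>
       fin_dim (yd_nichols SL2 (yd_V SL2 g chi)) \<longrightarrow>
       (\<forall>s\<in>plus_minus_one. \<forall>t. chi (s ** upper_unip t) = sgn_char s * triv_char t))"
proof -
  obtain x where x: "x \<noteq> 0" "g = mat22 (- 1) x 0 (- 1)" using assms(7) by auto
  have card: "CARD('f) = p ^ m" using assms by simp
  have two: "(2::'f) \<noteq> 0" by (rule two_nonzero[OF assms(1,2) card])
  \<comment> \<open>This separates the two branches of \<open>sgn_char\<close> on
    \<open>plus_minus_one\<close>.\<close>
  have "- mat 1 \<noteq> (mat 1 :: 'f^2^2)"
  proof
    assume "- mat 1 = (mat 1 :: 'f^2^2)"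
    then have "- 1 = (1::'f)" by (simp add: mat22_one mat22_uminus)
    then have "1 + 1 = (0::'f)" by (metis add.right_inverse)
    then show False using two by simp
  qed
  then have "chi (s ** upper_unip t) = sgn_char s * triv_char t"
    if "chi \<in> hom (SL2\<lparr>carrier := centralizer SL2 g\<rparr>) (units_of ring_of_type_algebra)"
      "fin_dim (yd_nichols SL2 (yd_V SL2 g chi))" "s \<in> plus_minus_one"
    for chi :: "'f^2^2 \<Rightarrow> 'k" and s t
    using chi_sgn_triv[OF assms(1-3) card x(1) that(1,2)[unfolded x(2)]] that(3)
    unfolding plus_minus_one_def by (auto simp: pm_upper sgn_char_def triv_char_def simp del: matrix_mul_lid)
  moreover have "centralizer SL2 g = {s ** upper_unip t | s t. s \<in> plus_minus_one}"
    unfolding x(2) centralizer_eq[OF x(1)] pm_upper_set ..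
  ultimately show ?thesis using pm_upper_iso[OF x(1) two] unfolding x(2) by blast
qed

end
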